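(* Let $\mathfrak g$ be a finite-dimensional simple complex Lie algebra with Lie bracket $[\cdot,\cdot]$ and Killing form $\kappa$. Let $B$ be a basis of $\mathfrak g$ and let $\{b^\vee : b\in B\}$ be the dual basis, defined by $\kappa(a^\vee,b)=\delta_{a,b}$ (Kronecker delta) for $a,b\in B$. Put $\delta=\dim_{\mathbb C}\mathfrak g$. Then there is a unique monoidal functor $$\Phi\colon \mathcal T_{\delta}\to \mathfrak g\text{-mod}$$ given on objects by sending the generating object $X$ to the adjoint representation $\mathfrak g$, and on generating morphisms by $$\Phi(m)\colon \mathfrak g\otimes\mathfrak g\to\mathfrak g,\quad a\otimes b\mapsto [a,b],$$ $$\Phi(s)\colon \mathfrak g\otimes\mathfrak g\to\mathfrak g\otimes\mathfrak g,\quad a\otimes b\mapsto b\otimes a,$$ $$\Phi(\eta)\colon \mathbb C\to\mathfrak g\otimes\mathfrak g,\quad 1\mapsto \sum_{b\in B} b\otimes b^\vee,$$ $$\Phi(\varepsilon)\colon \mathfrak g\otimes\mathfrak g\to\mathbb C,\quad a\otimes b\mapsto \kappa(a,b).$$ Furthermore, $\Phi(\sigma)\colon\mathfrak g\to\mathfrak g\otimes\mathfrak g$ is given by $a\mapsto\sum_{b\in B}[a,b]\otimes b^\vee$.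
   Context: The ground field is $\Bbbk=\mathbb C$. All categories and functors are $\Bbbk$-linear, and associativity and unit isomorphisms for tensor products of vector spaces are treated as identities. $\mathfrak g\text{-mod}$ is the category of finite-dimensional representations of $\mathfrak g$. For $\delta\in\Bbbk$ and $\alpha\in\Bbbk^\times$, $\mathcal T_{\delta,\alpha}$ is the strict $\Bbbk$-linear monoidal category (unit object $\mathbf 1$) generated by one object $X$ and morphisms $$m\colon X\otimes X\to X,\quad s\colon X\otimes X\to X\otimes X,\quad \eta\colon\mathbf 1\to X\otimes X,\quad \varepsilon\colon X\otimes X\to\mathbf 1,$$ subject to the following relations (writing $1$ for $\mathrm{id}_X$ and composing right to left): (i) $(\varepsilon\otimes1)(1\otimes\eta)=1=(1\otimes\varepsilon)(\eta\otimes1)$; (ii) $\sigma:=(1\otimes m)(\eta\otimes 1)=(m\otimes1)(1\otimes\eta)\colon X\to X\otimes X$; (iii) $(1\otimes\varepsilon)(s\otimes1)=(\varepsilon\otimes1)(1\otimes s)$; (iv) $s\circ s=1\otimes1$ and $(s\otimes1)(1\otimes s)(s\otimes1)=(1\otimes s)(s\otimes1)(1\otimes s)$; (v) $(1\otimes m)(s\otimes1)(1\otimes s)=s(m\otimes1)$ and $(1\otimes s)(s\otimes1)(1\otimes\sigma)=(\sigma\otimes1)s$; (vi) $\varepsilon s=\varepsilon$, $\; m s=-m$, $\; m\sigma=\alpha\,1$, $\;\varepsilon\eta=\delta\,\mathrm{id}_{\mathbf 1}$. One writes $\mathcal T_\delta:=\mathcal T_{\delta,1}$. *)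

theory Defs
  imports Complex_Main "HOL-Library.FuncSet" "HOL-Library.Function_Algebras"
begin

section \<open>Strict \<open>\<complex>\<close>-linear monoidal categories and functors\<close>

text \<open>
  Hom-sets are required to be pairwise disjoint, so a morphism determines its source and target
  and the operations on morphisms need no object arguments.
\<close>

record ('o, 'm) lin_mon_cat =
  obj  :: "'o set"
  hom  :: "'o \<Rightarrow> 'o \<Rightarrow> 'm set"
  idm  :: "'o \<Rightarrow> 'm"
  cmp  :: "'m \<Rightarrow> 'm \<Rightarrow> 'm"
  unit :: "'o"
  tobj :: "'o \<Rightarrow> 'o \<Rightarrow> 'o"
  tmor :: "'m \<Rightarrow> 'm \<Rightarrow> 'm"
  zer  :: "'o \<Rightarrow> 'o \<Rightarrow> 'm"
  madd :: "'m \<Rightarrow> 'm \<Rightarrow> 'm"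
  smul :: "complex \<Rightarrow> 'm \<Rightarrow> 'm"

definition mor :: "('o, 'm) lin_mon_cat \<Rightarrow> 'm set" where
  "mor C = (\<Union>a\<in>obj C. \<Union>b\<in>obj C. hom C a b)"

locale category =
  fixes C :: "('o, 'm) lin_mon_cat"
  assumes hom_disjoint:
      "\<lbrakk>a \<in> obj C; b \<in> obj C; a' \<in> obj C; b' \<in> obj C; f \<in> hom C a b; f \<in> hom C a' b'\<rbrakk>
        \<Longrightarrow> a = a' \<and> b = b'"
    and id_hom: "a \<in> obj C \<Longrightarrow> idm C a \<in> hom C a a"
    and cmp_hom:
      "\<lbrakk>a \<in> obj C; b \<in> obj C; c \<in> obj C; g \<in> hom C b c; f \<in> hom C a b\<rbrakk> \<Longrightarrow> cmp C g f \<in> hom C a c"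
    and id_left: "\<lbrakk>a \<in> obj C; b \<in> obj C; f \<in> hom C a b\<rbrakk> \<Longrightarrow> cmp C (idm C b) f = f"
    and id_right: "\<lbrakk>a \<in> obj C; b \<in> obj C; f \<in> hom C a b\<rbrakk> \<Longrightarrow> cmp C f (idm C a) = f"
    and cmp_assoc:
      "\<lbrakk>a \<in> obj C; b \<in> obj C; c \<in> obj C; d \<in> obj C; h \<in> hom C c d; g \<in> hom C b c; f \<in> hom C a b\<rbrakk>
        \<Longrightarrow> cmp C (cmp C h g) f = cmp C h (cmp C g f)"

locale linear_category = category +
  assumes zer_hom: "\<lbrakk>a \<in> obj C; b \<in> obj C\<rbrakk> \<Longrightarrow> zer C a b \<in> hom C a b"
    and plus_hom:
      "\<lbrakk>a \<in> obj C; b \<in> obj C; f \<in> hom C a b; g \<in> hom C a b\<rbrakk> \<Longrightarrow> madd C f g \<in> hom C a b"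
    and smul_hom: "\<lbrakk>a \<in> obj C; b \<in> obj C; f \<in> hom C a b\<rbrakk> \<Longrightarrow> smul C r f \<in> hom C a b"
    and plus_assoc:
      "\<lbrakk>a \<in> obj C; b \<in> obj C; f \<in> hom C a b; g \<in> hom C a b; h \<in> hom C a b\<rbrakk>
        \<Longrightarrow> madd C (madd C f g) h = madd C f (madd C g h)"
    and plus_comm:
      "\<lbrakk>a \<in> obj C; b \<in> obj C; f \<in> hom C a b; g \<in> hom C a b\<rbrakk> \<Longrightarrow> madd C f g = madd C g f"
    and plus_zer: "\<lbrakk>a \<in> obj C; b \<in> obj C; f \<in> hom C a b\<rbrakk> \<Longrightarrow> madd C f (zer C a b) = f"
    and plus_neg:
      "\<lbrakk>a \<in> obj C; b \<in> obj C; f \<in> hom C a b\<rbrakk> \<Longrightarrow> madd C f (smul C (-1) f) = zer C a b"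
    and smul_plus:
      "\<lbrakk>a \<in> obj C; b \<in> obj C; f \<in> hom C a b; g \<in> hom C a b\<rbrakk>
        \<Longrightarrow> smul C r (madd C f g) = madd C (smul C r f) (smul C r g)"
    and smul_add:
      "\<lbrakk>a \<in> obj C; b \<in> obj C; f \<in> hom C a b\<rbrakk>
        \<Longrightarrow> smul C (r + t) f = madd C (smul C r f) (smul C t f)"
    and smul_smul:
      "\<lbrakk>a \<in> obj C; b \<in> obj C; f \<in> hom C a b\<rbrakk> \<Longrightarrow> smul C r (smul C t f) = smul C (r * t) f"
    and smul_one: "\<lbrakk>a \<in> obj C; b \<in> obj C; f \<in> hom C a b\<rbrakk> \<Longrightarrow> smul C 1 f = f"
    and cmp_plus_left:
      "\<lbrakk>a \<in> obj C; b \<in> obj C; c \<in> obj C; f \<in> hom C a b; g \<in> hom C b c; g' \<in> hom C b c\<rbrakk>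
        \<Longrightarrow> cmp C (madd C g g') f = madd C (cmp C g f) (cmp C g' f)"
    and cmp_plus_right:
      "\<lbrakk>a \<in> obj C; b \<in> obj C; c \<in> obj C; f \<in> hom C a b; f' \<in> hom C a b; g \<in> hom C b c\<rbrakk>
        \<Longrightarrow> cmp C g (madd C f f') = madd C (cmp C g f) (cmp C g f')"
    and cmp_smul_left:
      "\<lbrakk>a \<in> obj C; b \<in> obj C; c \<in> obj C; f \<in> hom C a b; g \<in> hom C b c\<rbrakk>
        \<Longrightarrow> cmp C (smul C r g) f = smul C r (cmp C g f)"
    and cmp_smul_right:
      "\<lbrakk>a \<in> obj C; b \<in> obj C; c \<in> obj C; f \<in> hom C a b; g \<in> hom C b c\<rbrakk>
        \<Longrightarrow> cmp C g (smul C r f) = smul C r (cmp C g f)"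

locale strict_linear_monoidal_category = linear_category +
  assumes unit_obj: "unit C \<in> obj C"
    and tobj_obj: "\<lbrakk>a \<in> obj C; b \<in> obj C\<rbrakk> \<Longrightarrow> tobj C a b \<in> obj C"
    and tobj_assoc:
      "\<lbrakk>a \<in> obj C; b \<in> obj C; c \<in> obj C\<rbrakk> \<Longrightarrow> tobj C (tobj C a b) c = tobj C a (tobj C b c)"
    and tobj_unit_left: "a \<in> obj C \<Longrightarrow> tobj C (unit C) a = a"
    and tobj_unit_right: "a \<in> obj C \<Longrightarrow> tobj C a (unit C) = a"
    and tmor_hom:
      "\<lbrakk>a \<in> obj C; b \<in> obj C; a' \<in> obj C; b' \<in> obj C; f \<in> hom C a b; g \<in> hom C a' b'\<rbrakk>
        \<Longrightarrow> tmor C f g \<in> hom C (tobj C a a') (tobj C b b')"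
    and tmor_assoc:
      "\<lbrakk>f \<in> mor C; g \<in> mor C; h \<in> mor C\<rbrakk> \<Longrightarrow> tmor C (tmor C f g) h = tmor C f (tmor C g h)"
    and tmor_unit_left: "f \<in> mor C \<Longrightarrow> tmor C (idm C (unit C)) f = f"
    and tmor_unit_right: "f \<in> mor C \<Longrightarrow> tmor C f (idm C (unit C)) = f"
    and tmor_id: "\<lbrakk>a \<in> obj C; b \<in> obj C\<rbrakk> \<Longrightarrow> tmor C (idm C a) (idm C b) = idm C (tobj C a b)"
    and interchange:
      "\<lbrakk>a \<in> obj C; b \<in> obj C; c \<in> obj C; a' \<in> obj C; b' \<in> obj C; c' \<in> obj C;
        f \<in> hom C a b; g \<in> hom C b c; f' \<in> hom C a' b'; g' \<in> hom C b' c'\<rbrakk>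
        \<Longrightarrow> cmp C (tmor C g g') (tmor C f f') = tmor C (cmp C g f) (cmp C g' f')"
    and tmor_plus_left:
      "\<lbrakk>a \<in> obj C; b \<in> obj C; f \<in> hom C a b; f' \<in> hom C a b; g \<in> mor C\<rbrakk>
        \<Longrightarrow> tmor C (madd C f f') g = madd C (tmor C f g) (tmor C f' g)"
    and tmor_plus_right:
      "\<lbrakk>a \<in> obj C; b \<in> obj C; f \<in> mor C; g \<in> hom C a b; g' \<in> hom C a b\<rbrakk>
        \<Longrightarrow> tmor C f (madd C g g') = madd C (tmor C f g) (tmor C f g')"
    and tmor_smul_left:
      "\<lbrakk>f \<in> mor C; g \<in> mor C\<rbrakk> \<Longrightarrow> tmor C (smul C r f) g = smul C r (tmor C f g)"
    and tmor_smul_right: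
      "\<lbrakk>f \<in> mor C; g \<in> mor C\<rbrakk> \<Longrightarrow> tmor C f (smul C r g) = smul C r (tmor C f g)"

datatype ('o, 'm, 'p, 'n) fctr = Functor (on_obj: "'o \<Rightarrow> 'p") (on_mor: "'m \<Rightarrow> 'n")

text \<open>
  Since associativity and unit isomorphisms are identities, a monoidal functor preserves tensor
  products and the unit on the nose.  The two \<open>extensional\<close> clauses only fix the irrelevant
  values of the underlying total HOL functions outside the category, so that equality of functors is
  equality on objects and morphisms.
\<close>

locale monoidal_functor =
  C: strict_linear_monoidal_category C + D: strict_linear_monoidal_category D
  for C :: "('o, 'm) lin_mon_cat" and D :: "('p, 'n) lin_mon_cat" +
  fixes F :: "('o, 'm, 'p, 'n) fctr"
  assumes ext_obj: "on_obj F \<in> extensional (obj C)"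
    and ext_mor: "on_mor F \<in> extensional (mor C)"
    and F_obj: "a \<in> obj C \<Longrightarrow> on_obj F a \<in> obj D"
    and F_hom: "\<lbrakk>a \<in> obj C; b \<in> obj C; f \<in> hom C a b\<rbrakk>
      \<Longrightarrow> on_mor F f \<in> hom D (on_obj F a) (on_obj F b)"
    and F_id: "a \<in> obj C \<Longrightarrow> on_mor F (idm C a) = idm D (on_obj F a)"
    and F_cmp: "\<lbrakk>a \<in> obj C; b \<in> obj C; c \<in> obj C; g \<in> hom C b c; f \<in> hom C a b\<rbrakk>
      \<Longrightarrow> on_mor F (cmp C g f) = cmp D (on_mor F g) (on_mor F f)"
    and F_plus: "\<lbrakk>a \<in> obj C; b \<in> obj C; f \<in> hom C a b; g \<in> hom C a b\<rbrakk>
      \<Longrightarrow> on_mor F (madd C f g) = madd D (on_mor F f) (on_mor F g)"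
    and F_smul: "f \<in> mor C \<Longrightarrow> on_mor F (smul C r f) = smul D r (on_mor F f)"
    and F_unit: "on_obj F (unit C) = unit D"
    and F_tobj: "\<lbrakk>a \<in> obj C; b \<in> obj C\<rbrakk>
      \<Longrightarrow> on_obj F (tobj C a b) = tobj D (on_obj F a) (on_obj F b)"
    and F_tmor: "\<lbrakk>f \<in> mor C; g \<in> mor C\<rbrakk>
      \<Longrightarrow> on_mor F (tmor C f g) = tmor D (on_mor F f) (on_mor F g)"


section \<open>The category \<open>\<T>\<^bsub>\<delta>,\<alpha>\<^esub>\<close>\<close>

text \<open>
  The objects are the tensor powers \<open>X\<^sup>\<otimes>\<^sup>n\<close> of the generating object, encoded by \<open>n\<close>.
  Morphisms are classes of well-typed terms built from the four generators by the operations of a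
  strict linear monoidal category, modulo the least congruence containing the axioms of such a
  category and the defining relations.
\<close>

datatype tm =
    M | S | Eta | Eps
  | I nat
  | Cmp tm tm (infixr "\<cdot>" 65)
  | Ten tm tm (infixr "\<odot>" 75)
  | Zero nat nat
  | Add tm tm (infixl "\<^bold>+" 60)
  | Scale complex tm (infixr "\<^bold>*" 70)

inductive typed :: "tm \<Rightarrow> nat \<Rightarrow> nat \<Rightarrow> bool" where
  "typed M 2 1"
| "typed S 2 2"
| "typed Eta 0 2"
| "typed Eps 2 0"
| "typed (I n) n n"
| "typed g b c \<Longrightarrow> typed f a b \<Longrightarrow> typed (g \<cdot> f) a c"
| "typed f a b \<Longrightarrow> typed g a' b' \<Longrightarrow> typed (f \<odot> g) (a + a') (b + b')"
| "typed (Zero a b) a b"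
| "typed f a b \<Longrightarrow> typed g a b \<Longrightarrow> typed (f \<^bold>+ g) a b"
| "typed f a b \<Longrightarrow> typed (r \<^bold>* f) a b"

abbreviation "one \<equiv> I 1"

definition sigma :: tm where
  "sigma = (one \<odot> M) \<cdot> (Eta \<odot> one)"

inductive rels :: "complex \<Rightarrow> complex \<Rightarrow> tm \<Rightarrow> tm \<Rightarrow> bool" for \<delta> \<alpha> where
  "rels \<delta> \<alpha> ((Eps \<odot> one) \<cdot> (one \<odot> Eta)) one"
| "rels \<delta> \<alpha> ((one \<odot> Eps) \<cdot> (Eta \<odot> one)) one"
| "rels \<delta> \<alpha> sigma ((M \<odot> one) \<cdot> (one \<odot> Eta))"
| "rels \<delta> \<alpha> ((one \<odot> Eps) \<cdot> (S \<odot> one)) ((Eps \<odot> one) \<cdot> (one \<odot> S))"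
| "rels \<delta> \<alpha> (S \<cdot> S) (one \<odot> one)"
| "rels \<delta> \<alpha> ((S \<odot> one) \<cdot> (one \<odot> S) \<cdot> (S \<odot> one)) ((one \<odot> S) \<cdot> (S \<odot> one) \<cdot> (one \<odot> S))"
| "rels \<delta> \<alpha> ((one \<odot> M) \<cdot> (S \<odot> one) \<cdot> (one \<odot> S)) (S \<cdot> (M \<odot> one))"
| "rels \<delta> \<alpha> ((one \<odot> S) \<cdot> (S \<odot> one) \<cdot> (one \<odot> sigma)) ((sigma \<odot> one) \<cdot> S)"
| "rels \<delta> \<alpha> (Eps \<cdot> S) Eps"
| "rels \<delta> \<alpha> (M \<cdot> S) ((-1) \<^bold>* M)"
| "rels \<delta> \<alpha> (M \<cdot> sigma) (\<alpha> \<^bold>* one)"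
| "rels \<delta> \<alpha> (Eps \<cdot> Eta) (\<delta> \<^bold>* I 0)"

inductive teq :: "complex \<Rightarrow> complex \<Rightarrow> tm \<Rightarrow> tm \<Rightarrow> bool" for \<delta> \<alpha> where
  rel: "rels \<delta> \<alpha> f g \<Longrightarrow> teq \<delta> \<alpha> f g"
| refl: "typed f a b \<Longrightarrow> teq \<delta> \<alpha> f f"
| sym: "teq \<delta> \<alpha> f g \<Longrightarrow> teq \<delta> \<alpha> g f"
| trans: "teq \<delta> \<alpha> f g \<Longrightarrow> teq \<delta> \<alpha> g h \<Longrightarrow> teq \<delta> \<alpha> f h"
  \<comment> \<open>congruence\<close>
| "typed g b c \<Longrightarrow> typed f a b \<Longrightarrow> teq \<delta> \<alpha> g g' \<Longrightarrow> teq \<delta> \<alpha> f f' \<Longrightarrow> teq \<delta> \<alpha> (g \<cdot> f) (g' \<cdot> f')"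
| "teq \<delta> \<alpha> f f' \<Longrightarrow> teq \<delta> \<alpha> g g' \<Longrightarrow> teq \<delta> \<alpha> (f \<odot> g) (f' \<odot> g')"
| "typed f a b \<Longrightarrow> typed g a b \<Longrightarrow> teq \<delta> \<alpha> f f' \<Longrightarrow> teq \<delta> \<alpha> g g' \<Longrightarrow> teq \<delta> \<alpha> (f \<^bold>+ g) (f' \<^bold>+ g')"
| "teq \<delta> \<alpha> f f' \<Longrightarrow> teq \<delta> \<alpha> (r \<^bold>* f) (r \<^bold>* f')"
  \<comment> \<open>category\<close>
| "typed f a b \<Longrightarrow> teq \<delta> \<alpha> (I b \<cdot> f) f"
| "typed f a b \<Longrightarrow> teq \<delta> \<alpha> (f \<cdot> I a) f"
| "typed h c d \<Longrightarrow> typed g b c \<Longrightarrow> typed f a b \<Longrightarrow> teq \<delta> \<alpha> ((h \<cdot> g) \<cdot> f) (h \<cdot> g \<cdot> f)"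
  \<comment> \<open>strict monoidal structure\<close>
| "typed f a b \<Longrightarrow> typed g a' b' \<Longrightarrow> typed h a'' b'' \<Longrightarrow> teq \<delta> \<alpha> ((f \<odot> g) \<odot> h) (f \<odot> g \<odot> h)"
| "typed f a b \<Longrightarrow> teq \<delta> \<alpha> (I 0 \<odot> f) f"
| "typed f a b \<Longrightarrow> teq \<delta> \<alpha> (f \<odot> I 0) f"
| "teq \<delta> \<alpha> (I a \<odot> I b) (I (a + b))"
| "typed g b c \<Longrightarrow> typed f a b \<Longrightarrow> typed g' b' c' \<Longrightarrow> typed f' a' b'
    \<Longrightarrow> teq \<delta> \<alpha> ((g \<odot> g') \<cdot> (f \<odot> f')) ((g \<cdot> f) \<odot> (g' \<cdot> f'))"
  \<comment> \<open>vector space structure on morphisms\<close>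
| "typed f a b \<Longrightarrow> typed g a b \<Longrightarrow> typed h a b \<Longrightarrow> teq \<delta> \<alpha> ((f \<^bold>+ g) \<^bold>+ h) (f \<^bold>+ (g \<^bold>+ h))"
| "typed f a b \<Longrightarrow> typed g a b \<Longrightarrow> teq \<delta> \<alpha> (f \<^bold>+ g) (g \<^bold>+ f)"
| "typed f a b \<Longrightarrow> teq \<delta> \<alpha> (f \<^bold>+ Zero a b) f"
| "typed f a b \<Longrightarrow> teq \<delta> \<alpha> (f \<^bold>+ (-1) \<^bold>* f) (Zero a b)"
| "typed f a b \<Longrightarrow> typed g a b \<Longrightarrow> teq \<delta> \<alpha> (r \<^bold>* (f \<^bold>+ g)) (r \<^bold>* f \<^bold>+ r \<^bold>* g)"
| "typed f a b \<Longrightarrow> teq \<delta> \<alpha> ((r + t) \<^bold>* f) (r \<^bold>* f \<^bold>+ t \<^bold>* f)"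
| "typed f a b \<Longrightarrow> teq \<delta> \<alpha> (r \<^bold>* t \<^bold>* f) ((r * t) \<^bold>* f)"
| "typed f a b \<Longrightarrow> teq \<delta> \<alpha> (1 \<^bold>* f) f"
  \<comment> \<open>bilinearity of composition\<close>
| "typed g b c \<Longrightarrow> typed g' b c \<Longrightarrow> typed f a b \<Longrightarrow> teq \<delta> \<alpha> ((g \<^bold>+ g') \<cdot> f) ((g \<cdot> f) \<^bold>+ (g' \<cdot> f))"
| "typed g b c \<Longrightarrow> typed f a b \<Longrightarrow> typed f' a b \<Longrightarrow> teq \<delta> \<alpha> (g \<cdot> (f \<^bold>+ f')) ((g \<cdot> f) \<^bold>+ (g \<cdot> f'))"
| "typed g b c \<Longrightarrow> typed f a b \<Longrightarrow> teq \<delta> \<alpha> ((r \<^bold>* g) \<cdot> f) (r \<^bold>* (g \<cdot> f))"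
| "typed g b c \<Longrightarrow> typed f a b \<Longrightarrow> teq \<delta> \<alpha> (g \<cdot> (r \<^bold>* f)) (r \<^bold>* (g \<cdot> f))"
  \<comment> \<open>bilinearity of the tensor product\<close>
| "typed f a b \<Longrightarrow> typed f' a b \<Longrightarrow> typed g a' b' \<Longrightarrow> teq \<delta> \<alpha> ((f \<^bold>+ f') \<odot> g) ((f \<odot> g) \<^bold>+ (f' \<odot> g))"
| "typed f a b \<Longrightarrow> typed g a' b' \<Longrightarrow> typed g' a' b' \<Longrightarrow> teq \<delta> \<alpha> (f \<odot> (g \<^bold>+ g')) ((f \<odot> g) \<^bold>+ (f \<odot> g'))"
| "typed f a b \<Longrightarrow> typed g a' b' \<Longrightarrow> teq \<delta> \<alpha> ((r \<^bold>* f) \<odot> g) (r \<^bold>* (f \<odot> g))"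
| "typed f a b \<Longrightarrow> typed g a' b' \<Longrightarrow> teq \<delta> \<alpha> (f \<odot> (r \<^bold>* g)) (r \<^bold>* (f \<odot> g))"

definition cls :: "complex \<Rightarrow> complex \<Rightarrow> tm \<Rightarrow> tm set" where
  "cls \<delta> \<alpha> f = {g. teq \<delta> \<alpha> f g}"

definition T :: "complex \<Rightarrow> complex \<Rightarrow> (nat, tm set) lin_mon_cat" where
  "T \<delta> \<alpha> = \<lparr>
     obj = UNIV,
     hom = (\<lambda>a b. {f. typed f a b} // {(f, g). typed f a b \<and> typed g a b \<and> teq \<delta> \<alpha> f g}),
     idm = (\<lambda>a. cls \<delta> \<alpha> (I a)),
     cmp = (\<lambda>G F. \<Union>g\<in>G. \<Union>f\<in>F. cls \<delta> \<alpha> (g \<cdot> f)),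
     unit = 0,
     tobj = (+),
     tmor = (\<lambda>F G. \<Union>f\<in>F. \<Union>g\<in>G. cls \<delta> \<alpha> (f \<odot> g)),
     zer = (\<lambda>a b. cls \<delta> \<alpha> (Zero a b)),
     madd = (\<lambda>F G. \<Union>f\<in>F. \<Union>g\<in>G. cls \<delta> \<alpha> (f \<^bold>+ g)),
     smul = (\<lambda>r F. \<Union>f\<in>F. cls \<delta> \<alpha> (r \<^bold>* f)) \<rparr>"


section \<open>Finite-dimensional spaces with a strictly associative tensor product\<close>

text \<open>
  Vector spaces are realised as spaces of complex-valued functions on \<open>n\<close>-tuples
  (lists of length \<open>n\<close>) over a fixed index type.  For \<open>V\<close> in degree \<open>m\<close> and \<open>W\<close> in degree \<open>n\<close>
  the elementary tensor of \<open>v\<close> and \<open>w\<close> is the function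
  \<open>(x\<^sub>1, \<dots>, x\<^sub>m, y\<^sub>1, \<dots>, y\<^sub>n) \<mapsto> v (x\<^sub>1, \<dots>, x\<^sub>m) w (y\<^sub>1, \<dots>, y\<^sub>n)\<close>, and \<open>V \<otimes> W\<close> is the span of
  these, in degree \<open>m + n\<close>.  This satisfies the universal property of the tensor product
  (lemma \<open>tensor_universal\<close> below), and the associativity and unit isomorphisms are identities.
\<close>

type_synonym 'x tup = "'x list \<Rightarrow> complex"

definition fscale :: "complex \<Rightarrow> 'x tup \<Rightarrow> 'x tup" where
  "fscale c f = (\<lambda>xs. c * f xs)"

global_interpretation fun_vs: vector_space fscale
  by unfold_locales (auto simp: fscale_def algebra_simps)

definition linear_map_on :: "'x tup set \<Rightarrow> ('x tup \<Rightarrow> 'y tup) \<Rightarrow> bool" where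
  "linear_map_on V f \<longleftrightarrow> (\<forall>u\<in>V. \<forall>v\<in>V. f (u + v) = f u + f v) \<and>
     (\<forall>c. \<forall>v\<in>V. f (fscale c v) = fscale c (f v))"

definition fd_space :: "nat \<Rightarrow> 'x tup set \<Rightarrow> bool" where
  "fd_space n V \<longleftrightarrow> fun_vs.subspace V \<and> (\<exists>A. finite A \<and> fun_vs.span A = V) \<and>
     (\<forall>v\<in>V. \<forall>xs. length xs \<noteq> n \<longrightarrow> v xs = 0)"

definition elt :: "nat \<Rightarrow> 'x tup \<Rightarrow> 'x tup \<Rightarrow> 'x tup" where
  "elt m v w = (\<lambda>xs. v (take m xs) * w (drop m xs))"

definition tensor_space :: "nat \<Rightarrow> 'x tup set \<Rightarrow> 'x tup set \<Rightarrow> 'x tup set" where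
  "tensor_space m V W = fun_vs.span {elt m v w | v w. v \<in> V \<and> w \<in> W}"

text \<open>The linear map on \<open>V \<otimes> W\<close> induced by a bilinear map \<open>b\<close> on \<open>V \<times> W\<close>.\<close>

definition tensor_lift ::
    "nat \<Rightarrow> 'x tup set \<Rightarrow> 'x tup set \<Rightarrow> ('x tup \<Rightarrow> 'x tup \<Rightarrow> 'y tup) \<Rightarrow> 'x tup \<Rightarrow> 'y tup" where
  "tensor_lift m V W b = (THE h. h \<in> extensional (tensor_space m V W) \<and>
     linear_map_on (tensor_space m V W) h \<and> (\<forall>v\<in>V. \<forall>w\<in>W. h (elt m v w) = b v w))"


lemma linear_map_on_zero:
  assumes "linear_map_on V f" "0 \<in> V"
  shows "f 0 = 0"
proof -
  have "f (fscale 0 0) = fscale 0 (f 0)" using assms unfolding linear_map_on_def by blast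
  then show ?thesis by (metis fun_vs.scale_zero_left)
qed

lemma linear_map_on_sum:
  assumes "fun_vs.subspace V" "linear_map_on V f" "finite A" "\<And>i. i \<in> A \<Longrightarrow> g i \<in> V"
  shows "f (\<Sum>i\<in>A. g i) = (\<Sum>i\<in>A. f (g i))"
  using assms(3,4)
proof (induction A rule: finite_induct)
  case empty
  show ?case
    using linear_map_on_zero[OF assms(2) fun_vs.subspace_0[OF assms(1)]] by (metis sum.empty)
next
  case (insert i A)
  then have "(\<Sum>i\<in>A. g i) \<in> V"
    using assms(1) by (intro fun_vs.subspace_sum) auto
  then have "f (g i + (\<Sum>i\<in>A. g i)) = f (g i) + f (\<Sum>i\<in>A. g i)"
    using assms(2) insert.prems unfolding linear_map_on_def by blast
  moreover have "f (\<Sum>i\<in>A. g i) = (\<Sum>i\<in>A. f (g i))" using insert by blast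
  ultimately show ?case using insert(1,2) by (metis sum.insert)
qed

lemma elt_add_left: "elt m (u + v) w = elt m u w + elt m v w"
  and elt_add_right: "elt m v (w + w') = elt m v w + elt m v w'"
  and elt_scale_left: "elt m (fscale c v) w = fscale c (elt m v w)"
  and elt_scale_right: "elt m v (fscale c w) = fscale c (elt m v w)"
  by (auto simp: elt_def fscale_def algebra_simps)

lemma elt_sum_left: "elt m (\<Sum>i\<in>A. g i) w = (\<Sum>i\<in>A. elt m (g i) w)"
proof (induction A rule: infinite_finite_induct)
  case (insert i A)
  then show ?case by (metis elt_add_left sum.insert)
qed (auto simp: elt_def)

lemma linear_map_on_span:
  assumes "linear_map_on (fun_vs.span G) f" "linear_map_on (fun_vs.span G) g"
    and eq: "\<And>x. x \<in> G \<Longrightarrow> f x = g x" and x: "x \<in> fun_vs.span G"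
  shows "f x = g x"
proof -
  have "x \<in> fun_vs.span G \<and> f x = g x"
    using x
  proof (induction rule: fun_vs.span_induct_alt)
    case base
    show ?case
      using assms(1,2)[THEN linear_map_on_zero, OF fun_vs.span_zero] fun_vs.span_zero by metis
  next
    case (step c x y)
    then have *: "fscale c x \<in> fun_vs.span G" "x \<in> fun_vs.span G" "y \<in> fun_vs.span G"
      by (auto intro: fun_vs.span_base fun_vs.span_scale)
    then have "f (fscale c x + y) = fscale c (f x) + f y" "g (fscale c x + y) = fscale c (g x) + g y"
      using assms(1,2) unfolding linear_map_on_def by metis+
    then show ?case using step eq * by (metis fun_vs.span_add)
  qed
  then show ?thesis ..
qed

theorem tensor_universal:
  fixes b :: "'x tup \<Rightarrow> 'x tup \<Rightarrow> 'y tup"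
  assumes V: "fd_space m V" and W: "fd_space n W"
    and b1: "\<And>w. w \<in> W \<Longrightarrow> linear_map_on V (\<lambda>v. b v w)"
    and b2: "\<And>v. v \<in> V \<Longrightarrow> linear_map_on W (b v)"
  shows "\<exists>!h. h \<in> extensional (tensor_space m V W) \<and> linear_map_on (tensor_space m V W) h \<and>
    (\<forall>v\<in>V. \<forall>w\<in>W. h (elt m v w) = b v w)"
proof (rule ex_ex1I)
  let ?T = "tensor_space m V W"
  have sV: "fun_vs.subspace V" and sW: "fun_vs.subspace W" using V W by (auto simp: fd_space_def)
  obtain B where B: "B \<subseteq> V" "fun_vs.independent B" "V \<subseteq> fun_vs.span B"
    using fun_vs.maximal_independent_subset by blast
  obtain A where A: "finite A" "fun_vs.span A = V" using V by (auto simp: fd_space_def)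
  have fB: "finite B" using fun_vs.independent_span_bound[OF A(1) B(2)] B(1) A(2) by auto
  define dec where "dec t w \<longleftrightarrow> w \<in> B \<rightarrow>\<^sub>E W \<and> t = (\<Sum>c\<in>B. elt m c (w c))" for t w
  have ev: "(\<Sum>c\<in>B. elt m c (w c)) xs = (\<Sum>c\<in>B. c (take m xs) * w c (drop m xs))" for w and xs :: "'x list"
    using fB by (induction B rule: finite_induct) (auto simp: elt_def)
  have uniq: "w = w'" if "dec t w" "dec t w'" for t w w'
  proof (rule PiE_ext)
    show "w \<in> B \<rightarrow>\<^sub>E W" "w' \<in> B \<rightarrow>\<^sub>E W" using that by (auto simp: dec_def)
    fix c assume c: "c \<in> B"
    show "w c = w' c"
    proof
      fix ys
      have mW: "w c \<in> W" "w' c \<in> W" using that c by (auto simp: dec_def)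
      show "w c ys = w' c ys"
      proof (cases "length ys = n")
        case False
        then have "w c ys = 0" "w' c ys = 0" using mW W unfolding fd_space_def by blast+
        then show ?thesis by simp
      next
        case True
        have "(\<Sum>c\<in>B. fscale (w c ys - w' c ys) c) = 0"
        proof
          fix xs
          have e: "(\<Sum>c\<in>B. fscale (w c ys - w' c ys) c) xs = (\<Sum>c\<in>B. (w c ys - w' c ys) * c xs)"
            using fB by (induction B rule: finite_induct) (auto simp: fscale_def)
          show "(\<Sum>c\<in>B. fscale (w c ys - w' c ys) c) xs = 0 xs"
          proof (cases "length xs = m")
            case False
            then have "c xs = 0" if "c \<in> B" for c using that B V by (auto simp: fd_space_def)
            then have "(\<Sum>c\<in>B. (w c ys - w' c ys) * c xs) = 0" by (intro sum.neutral) simp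
            then show ?thesis unfolding e by simp
          next
            case True
            have "(\<Sum>c\<in>B. elt m c (w c)) (xs @ ys) = (\<Sum>c\<in>B. elt m c (w' c)) (xs @ ys)"
              using that by (auto simp: dec_def)
            then have "(\<Sum>c\<in>B. c xs * w c ys) = (\<Sum>c\<in>B. c xs * w' c ys)"
              using True by (simp add: ev)
            then have "(\<Sum>c\<in>B. (w c ys - w' c ys) * c xs) = 0"
              by (simp add: algebra_simps sum_subtractf)
            then show ?thesis unfolding e by simp
          qed
        qed
        then have "w c ys - w' c ys = 0"
          using fun_vs.independentD[OF B(2) fB order_refl, of "\<lambda>c. w c ys - w' c ys"] c by blast
        then show ?thesis by simp
      qed
    qed
  qed
  have dadd: "dec (t + t') (\<lambda>c\<in>B. w c + w' c)" if "dec t w" "dec t' w'" for t t' w w'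
    using that sW by (auto simp: dec_def elt_add_right sum.distrib intro!: fun_vs.subspace_add)
  have dscale: "dec (fscale r t) (\<lambda>c\<in>B. fscale r (w c))" if "dec t w" for t w r
    using that sW by (auto simp: dec_def elt_scale_right fun_vs.scale_sum_right intro!: fun_vs.subspace_scale)
  have rep: "v = (\<Sum>c\<in>B. fscale (fun_vs.representation B v c) c)" if "v \<in> V" for v
    using fun_vs.sum_representation_eq[OF B(2) _ fB order_refl, of v] that B(3) by auto
  have delt: "dec (elt m v w) (\<lambda>c\<in>B. fscale (fun_vs.representation B v c) w)"
    if "v \<in> V" "w \<in> W" for v w
  proof -
    have "elt m v w = (\<Sum>c\<in>B. elt m c (fscale (fun_vs.representation B v c) w))"
      by (subst rep[OF that(1)]) (simp add: elt_sum_left elt_scale_left elt_scale_right)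
    then show ?thesis using that sW by (auto simp: dec_def intro!: fun_vs.subspace_scale)
  qed
  have elt_zero: "elt m c 0 = 0" for c :: "'x tup" by (rule ext) (simp add: elt_def)
  have dzero: "dec 0 (\<lambda>c\<in>B. 0)"
    unfolding dec_def
  proof
    show "(\<lambda>c\<in>B. 0) \<in> B \<rightarrow>\<^sub>E W"
      using fun_vs.subspace_0[OF sW] by (intro restrict_PiE_iff[THEN iffD2]) blast
    show "0 = (\<Sum>c\<in>B. elt m c ((\<lambda>c\<in>B. 0) c))"
      by (intro sum.neutral[symmetric] ballI) (metis elt_zero restrict_apply')
  qed
  have ex: "\<exists>w. dec t w" if "t \<in> ?T" for t
    using that unfolding tensor_space_def
  proof (induction rule: fun_vs.span_induct_alt)
    case base
    show ?case using dzero by blast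
  next
    case (step r x y)
    then show ?case using dadd dscale delt by blast
  qed
  define D where "D t = (SOME w. dec t w)" for t
  have D: "D t = w" if "dec t w" for t w
    using someI[of "dec t", OF that] uniq that unfolding D_def by blast
  define h where "h = (\<lambda>t\<in>?T. \<Sum>c\<in>B. b c (D t c))"
  have sT: "fun_vs.subspace ?T" by (simp add: tensor_space_def)
  have lin: "linear_map_on ?T h"
    unfolding linear_map_on_def
  proof (intro conjI ballI allI)
    fix t t' assume t: "t \<in> ?T" "t' \<in> ?T"
    then obtain w w' where w: "dec t w" "dec t' w'" using ex by blast
    have "(\<Sum>c\<in>B. b c (w c + w' c)) = (\<Sum>c\<in>B. b c (w c) + b c (w' c))"
      using w b2 B(1) by (intro sum.cong) (auto simp: dec_def linear_map_on_def PiE_iff)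
    moreover have "h (t + t') = (\<Sum>c\<in>B. b c (w c + w' c))"
      using fun_vs.subspace_add[OF sT t] D[OF dadd[OF w]] by (simp only: h_def restrict_apply') simp
    moreover have "h t = (\<Sum>c\<in>B. b c (w c))" "h t' = (\<Sum>c\<in>B. b c (w' c))"
      using t D[OF w(1)] D[OF w(2)] by (simp_all only: h_def restrict_apply')
    ultimately show "h (t + t') = h t + h t'" by (simp only: sum.distrib)
  next
    fix r t assume t: "t \<in> ?T"
    then obtain w where w: "dec t w" using ex by blast
    have "(\<Sum>c\<in>B. b c (fscale r (w c))) = (\<Sum>c\<in>B. fscale r (b c (w c)))"
      using w b2 B(1) by (intro sum.cong) (auto simp: dec_def linear_map_on_def PiE_iff)
    moreover have "h (fscale r t) = (\<Sum>c\<in>B. b c (fscale r (w c)))"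
      using fun_vs.subspace_scale[OF sT t] D[OF dscale[OF w]] by (simp only: h_def restrict_apply') simp
    moreover have "h t = (\<Sum>c\<in>B. b c (w c))"
      using t D[OF w] by (simp only: h_def restrict_apply')
    ultimately show "h (fscale r t) = fscale r (h t)" by (simp only: fun_vs.scale_sum_right)
  qed
  have val: "h (elt m v w) = b v w" if vw: "v \<in> V" "w \<in> W" for v w
  proof -
    have in_T: "elt m v w \<in> ?T"
      using vw unfolding tensor_space_def by (blast intro: fun_vs.span_base)
    have "b v w = b (\<Sum>c\<in>B. fscale (fun_vs.representation B v c) c) w"
      by (rule arg_cong[OF rep[OF vw(1)], of "\<lambda>v. b v w"])
    also have "\<dots> = (\<Sum>c\<in>B. b (fscale (fun_vs.representation B v c) c) w)"
      using B(1) sV fun_vs.subspace_scale by (intro linear_map_on_sum[OF sV b1[OF vw(2)] fB]) blast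
    also have "\<dots> = (\<Sum>c\<in>B. b c (fscale (fun_vs.representation B v c) w))"
      using b1[OF vw(2)] b2 vw B(1) by (intro sum.cong) (auto simp: linear_map_on_def subset_iff)
    also have "\<dots> = h (elt m v w)"
      using in_T D[OF delt[OF vw]] by (simp add: h_def)
    finally show ?thesis ..
  qed
  show "\<exists>h. h \<in> extensional ?T \<and> linear_map_on ?T h \<and> (\<forall>v\<in>V. \<forall>w\<in>W. h (elt m v w) = b v w)"
    using lin val by (intro exI[of _ h]) (auto simp: h_def)
next
  let ?P = "\<lambda>h. h \<in> extensional (tensor_space m V W) \<and> linear_map_on (tensor_space m V W) h \<and>
      (\<forall>v\<in>V. \<forall>w\<in>W. h (elt m v w) = b v w)"
  fix h h' assume h: "?P h" "?P h'"
  show "h = h'"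
  proof (rule extensionalityI)
    fix t assume t: "t \<in> tensor_space m V W"
    show "h t = h' t"
    proof (rule linear_map_on_span[where G = "{elt m v w | v w. v \<in> V \<and> w \<in> W}"])
      show "t \<in> fun_vs.span {elt m v w | v w. v \<in> V \<and> w \<in> W}"
        using t unfolding tensor_space_def .
      show "h x = h' x" if x: "x \<in> {elt m v w | v w. v \<in> V \<and> w \<in> W}" for x
      proof -
        obtain v w where "v \<in> V" "w \<in> W" "x = elt m v w" using x by blast
        then show ?thesis using h by simp
      qed
    qed (use h in \<open>unfold tensor_space_def, blast+\<close>)
  qed (use h in blast)+
qed


section \<open>Lie algebras and their finite-dimensional representations\<close>

record ('g, 'x) repn =
  deg :: nat
  space :: "'x tup set"
  act :: "'g \<Rightarrow> 'x tup \<Rightarrow> 'x tup"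

datatype ('g, 'x) arrow =
  Arrow (src: "('g, 'x) repn") (fn: "'x tup \<Rightarrow> 'x tup") (tgt: "('g, 'x) repn")

locale lie_algebra = vector_space scale
  for scale :: "complex \<Rightarrow> 'g::ab_group_add \<Rightarrow> 'g" +
  fixes bracket :: "'g \<Rightarrow> 'g \<Rightarrow> 'g"
  assumes bracket_add_left: "bracket (x + y) z = bracket x z + bracket y z"
    and bracket_add_right: "bracket x (y + z) = bracket x y + bracket x z"
    and bracket_scale_left: "bracket (scale c x) y = scale c (bracket x y)"
    and bracket_scale_right: "bracket x (scale c y) = scale c (bracket x y)"
    and bracket_self: "bracket x x = 0"
    and jacobi: "bracket x (bracket y z) + bracket y (bracket z x) + bracket z (bracket x y) = 0"
begin

definition ideal :: "'g set \<Rightarrow> bool" where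
  "ideal J \<longleftrightarrow> subspace J \<and> (\<forall>x. \<forall>y\<in>J. bracket x y \<in> J)"

definition is_basis :: "'g set \<Rightarrow> bool" where
  "is_basis B \<longleftrightarrow> independent B \<and> span B = UNIV"

text \<open>The value of the trace does not depend on the chosen basis.\<close>

definition trace :: "('g \<Rightarrow> 'g) \<Rightarrow> complex" where
  "trace f = (let B = (SOME B. is_basis B) in \<Sum>b\<in>B. representation B (f b) b)"

definition killing :: "'g \<Rightarrow> 'g \<Rightarrow> complex" where
  "killing x y = trace (\<lambda>z. bracket x (bracket y z))"

definition is_rep :: "('g, 'x) repn \<Rightarrow> bool" where
  "is_rep V \<longleftrightarrow> fd_space (deg V) (space V) \<and>
     (\<forall>x. act V x \<in> space V \<rightarrow>\<^sub>E space V \<and> linear_map_on (space V) (act V x)) \<and>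
     (\<forall>x y. \<forall>v\<in>space V. act V (x + y) v = act V x v + act V y v) \<and>
     (\<forall>c x. \<forall>v\<in>space V. act V (scale c x) v = fscale c (act V x v)) \<and>
     (\<forall>x y. \<forall>v\<in>space V. act V (bracket x y) v = act V x (act V y v) - act V y (act V x v))"

definition is_intertwiner :: "('g, 'x) repn \<Rightarrow> ('g, 'x) repn \<Rightarrow> ('x tup \<Rightarrow> 'x tup) \<Rightarrow> bool" where
  "is_intertwiner V W f \<longleftrightarrow> f \<in> space V \<rightarrow>\<^sub>E space W \<and> linear_map_on (space V) f \<and>
     (\<forall>x. \<forall>v\<in>space V. f (act V x v) = act W x (f v))"

definition scalar :: "complex \<Rightarrow> 'x tup" where
  "scalar c = (\<lambda>xs. if xs = [] then c else 0)"

definition trivial_rep :: "('g, 'x) repn" where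
  "trivial_rep = \<lparr>deg = 0, space = range scalar, act = (\<lambda>x. \<lambda>v\<in>range scalar. 0)\<rparr>"

definition tensor_rep :: "('g, 'x) repn \<Rightarrow> ('g, 'x) repn \<Rightarrow> ('g, 'x) repn" where
  "tensor_rep V W = \<lparr>
     deg = deg V + deg W,
     space = tensor_space (deg V) (space V) (space W),
     act = (\<lambda>x. tensor_lift (deg V) (space V) (space W)
       (\<lambda>v w. elt (deg V) (act V x v) w + elt (deg V) v (act W x w)))\<rparr>"

definition tensor_arrow :: "('g, 'x) arrow \<Rightarrow> ('g, 'x) arrow \<Rightarrow> ('g, 'x) arrow" where
  "tensor_arrow f g = Arrow (tensor_rep (src f) (src g))
     (tensor_lift (deg (src f)) (space (src f)) (space (src g))
       (\<lambda>v w. elt (deg (tgt f)) (fn f v) (fn g w)))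
     (tensor_rep (tgt f) (tgt g))"

definition gmod :: "(('g, 'x) repn, ('g, 'x) arrow) lin_mon_cat" where
  "gmod = \<lparr>
     obj = {V. is_rep V},
     hom = (\<lambda>V W. {Arrow V f W | f. is_intertwiner V W f}),
     idm = (\<lambda>V. Arrow V (\<lambda>v\<in>space V. v) V),
     cmp = (\<lambda>g f. Arrow (src f) (compose (space (src f)) (fn g) (fn f)) (tgt g)),
     unit = trivial_rep,
     tobj = tensor_rep,
     tmor = tensor_arrow,
     zer = (\<lambda>V W. Arrow V (\<lambda>v\<in>space V. 0) W),
     madd = (\<lambda>f g. Arrow (src f) (\<lambda>v\<in>space (src f). fn f v + fn g v) (tgt f)),
     smul = (\<lambda>c f. Arrow (src f) (\<lambda>v\<in>space (src f). fscale c (fn f v)) (tgt f)) \<rparr>"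

text \<open>
  The underlying space of the Lie algebra is realised in degree \<open>1\<close> over the index type of its
  linear functionals, an element being identified with evaluation at it; this is injective.  (The
  index type contains all functions; the non-linear ones are evaluated to \<open>0\<close>.)
\<close>

definition vec :: "'g \<Rightarrow> ('g \<Rightarrow> complex) tup" where
  "vec a = (\<lambda>xs. case xs of [\<phi>] \<Rightarrow> if Vector_Spaces.linear scale (*) \<phi> then \<phi> a else 0 | _ \<Rightarrow> 0)"

definition adjoint_rep :: "('g, 'g \<Rightarrow> complex) repn" where
  "adjoint_rep = \<lparr>deg = 1, space = range vec, act = (\<lambda>x. \<lambda>v\<in>range vec. vec (bracket x (inv vec v)))\<rparr>"

text \<open>The elementary tensor of two elements of the adjoint representation.\<close>

definition vtensor :: "'g \<Rightarrow> 'g \<Rightarrow> ('g \<Rightarrow> complex) tup" where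
  "vtensor a b = elt 1 (vec a) (vec b)"

text \<open>
  Every finite-dimensional representation on an arbitrary complex vector space is isomorphic to an
  object of \<open>gmod\<close>, provided the index type \<open>'x\<close> is infinite.  This applies to the index type
  \<open>'g \<Rightarrow> complex\<close> used below for the adjoint representation.
\<close>

theorem rep_realisation:
  fixes s :: "complex \<Rightarrow> 'v::ab_group_add \<Rightarrow> 'v" and r :: "'g \<Rightarrow> 'v \<Rightarrow> 'v"
  assumes inf: "infinite (UNIV :: 'x set)"
    and vs: "vector_space s" and fd: "\<exists>A. finite A \<and> module.span s A = UNIV"
    and lin: "\<And>x. Vector_Spaces.linear s s (r x)"
    and r_add: "\<And>x y v. r (x + y) v = r x v + r y v"
    and r_scale: "\<And>c x v. r (scale c x) v = s c (r x v)"
    and r_bracket: "\<And>x y v. r (bracket x y) v = r x (r y v) - r y (r x v)"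
  shows "\<exists>(V :: ('g, 'x) repn) j. is_rep V \<and> Vector_Spaces.linear s fscale j \<and>
    bij_betw j UNIV (space V) \<and> (\<forall>x v. j (r x v) = act V x (j v))"
proof -
  interpret U: vector_space s by (rule vs)
  obtain A where A: "finite A" "U.span A = UNIV" using fd by blast
  obtain B where B: "U.independent B" and "UNIV \<subseteq> U.span B"
    by (rule U.maximal_independent_subset[of UNIV])
  then have spanB: "U.span B = UNIV" by auto
  have fB: "finite B" using U.independent_span_bound[OF A(1) B] A(2) by auto
  obtain E :: "'x set" where E: "finite E" "card E = card B"
    using infinite_arbitrarily_large[OF inf] by blast
  obtain e :: "'v \<Rightarrow> 'x" where "bij_betw e B E"
    using finite_same_card_bij[OF fB E(1) E(2)[symmetric]] by blast
  then have e: "inj_on e B" by (rule bij_betw_imp_inj_on)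
  define j :: "'v \<Rightarrow> 'x tup" where
    "j v = (\<lambda>xs. \<Sum>b\<in>B. if xs = [e b] then U.representation B v b else 0)" for v
  have j_e: "j v [e b] = U.representation B v b" if "b \<in> B" for v b
  proof -
    have "j v [e b] = (\<Sum>b'\<in>B. if b' = b then U.representation B v b' else 0)"
      unfolding j_def using that e by (intro sum.cong) (auto dest: inj_onD)
    then show ?thesis using that fB by simp
  qed
  have linj: "Vector_Spaces.linear s fscale j"
  proof (unfold_locales)
    fix u v show "j (u + v) = j u + j v"
    proof
      fix xs
      show "j (u + v) xs = (j u + j v) xs"
        unfolding j_def plus_fun_apply sum.distrib[symmetric] using B spanB
        by (intro sum.cong) (auto simp: U.representation_add)
    qed
  next
    fix c v show "j (s c v) = fscale c (j v)"
    proof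
      fix xs
      show "j (s c v) xs = fscale c (j v) xs"
        unfolding j_def fscale_def sum_distrib_left using B spanB
        by (intro sum.cong) (auto simp: U.representation_scale)
    qed
  qed
  interpret j: Vector_Spaces.linear s fscale j by (rule linj)
  have inj: "inj j"
  proof (rule injI)
    fix u v assume "j u = j v"
    then have *: "U.representation B u b = U.representation B v b" if "b \<in> B" for b
      using that j_e by metis
    have "u = (\<Sum>b\<in>B. s (U.representation B u b) b)" "v = (\<Sum>b\<in>B. s (U.representation B v b) b)"
      using U.sum_representation_eq[OF B _ fB order_refl] spanB by auto
    then show "u = v" using * by (metis (no_types, lifting) sum.cong)
  qed
  define V :: "('g, 'x) repn" where
    "V = \<lparr>deg = 1, space = range j, act = (\<lambda>x. \<lambda>v\<in>range j. j (r x (inv j v)))\<rparr>"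
  have "fd_space 1 (range j)"
    unfolding fd_space_def
  proof (intro conjI ballI allI impI)
    show "fun_vs.subspace (range j)" using j.subspace_image[OF U.subspace_UNIV] .
    show "\<exists>A. finite A \<and> fun_vs.span A = range j"
      using j.span_image[of A] A by (intro exI[of _ "j ` A"]) auto
  qed (auto simp: j_def intro!: sum.neutral)
  moreover have act: "act V x (j v) = j (r x v)" for x v using inj by (simp add: V_def)
  moreover have "act V x \<in> space V \<rightarrow>\<^sub>E space V" for x by (auto simp: V_def)
  moreover have "linear_map_on (space V) (act V x)" for x
  proof -
    interpret r: Vector_Spaces.linear s s "r x" by (rule lin)
    have "act V x (j u + j v) = act V x (j u) + act V x (j v)" for u v
      by (simp only: act j.add[symmetric] r.add)
    moreover have "act V x (fscale c (j v)) = fscale c (act V x (j v))" for c v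
      by (simp only: act j.scale[symmetric] r.scale)
    ultimately show ?thesis unfolding linear_map_on_def by (auto simp: V_def)
  qed
  moreover have "act V (x + y) (j v) = act V x (j v) + act V y (j v)" for x y v
    by (simp only: act r_add j.add)
  moreover have "act V (scale c x) (j v) = fscale c (act V x (j v))" for c x v
    by (simp only: act r_scale j.scale)
  moreover have "act V (bracket x y) (j v) = act V x (act V y (j v)) - act V y (act V x (j v))" for x y v
    by (simp only: act r_bracket j.diff)
  moreover have "deg V = 1" "space V = range j" by (simp_all add: V_def)
  ultimately have "is_rep V" unfolding is_rep_def by auto
  moreover have "bij_betw j UNIV (space V)" using inj by (simp add: bij_betw_def V_def)
  moreover have "j (r x v) = act V x (j v)" for x v using inj by (simp add: V_def)
  ultimately show ?thesis using linj by blast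
qed

lemma inj_vec: "inj vec"
proof (rule injI)
  interpret L: vector_space_pair scale "(*) :: complex \<Rightarrow> complex \<Rightarrow> complex"
    by (intro vector_space_pair.intro vector_space_axioms) (unfold_locales; simp add: algebra_simps)
  fix a b assume ab: "vec a = vec b"
  show "a = b"
  proof (rule ccontr)
    assume "a \<noteq> b"
    then have "independent {a - b}" by simp
    then obtain \<phi> where \<phi>: "Vector_Spaces.linear scale (*) \<phi>" "\<phi> (a - b) = 1"
      using L.linear_independent_extend[of "{a - b}" "\<lambda>_. 1"] by auto
    have "vec a [\<phi>] = vec b [\<phi>]" using ab by simp
    then have "\<phi> a = \<phi> b" using \<phi>(1) by (simp add: vec_def)
    then show False using \<phi> L.linear_diff[OF \<phi>(1)] by simp
  qed
qed

definition dimension :: complex where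
  "dimension = of_nat (dim (UNIV :: 'g set))"

definition is_adjoint_functor :: "'g set \<Rightarrow> ('g \<Rightarrow> 'g) \<Rightarrow>
    (nat, tm set, ('g, 'g \<Rightarrow> complex) repn, ('g, 'g \<Rightarrow> complex) arrow) fctr \<Rightarrow> bool" where
  "is_adjoint_functor B dual \<Phi> \<longleftrightarrow>
     monoidal_functor (T dimension 1) gmod \<Phi> \<and>
     on_obj \<Phi> 1 = adjoint_rep \<and>
     (\<forall>a b. fn (on_mor \<Phi> (cls dimension 1 M)) (vtensor a b) = vec (bracket a b)) \<and>
     (\<forall>a b. fn (on_mor \<Phi> (cls dimension 1 S)) (vtensor a b) = vtensor b a) \<and>
     fn (on_mor \<Phi> (cls dimension 1 Eta)) (scalar 1) = (\<Sum>b\<in>B. vtensor b (dual b)) \<and>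
     (\<forall>a b. fn (on_mor \<Phi> (cls dimension 1 Eps)) (vtensor a b) = scalar (killing a b))"

end

locale fd_simple_lie_algebra = lie_algebra +
  assumes finite_dim: "\<exists>A. finite A \<and> span A = UNIV"
    and nonabelian: "\<exists>x y. bracket x y \<noteq> 0"
    and simple: "ideal J \<Longrightarrow> J = {0} \<or> J = UNIV"

end

theory Submission
  imports Defs
begin

text \<open>
  A monoidal category given by generators and relations is as free as the relations permit: a monoidal
  functor from \<open>\<T>\<^bsub>\<delta>,\<alpha>\<^esub>\<close> to a strict linear monoidal category \<open>D\<close> is the same thing as an object with
  four morphisms in \<open>D\<close> that satisfy the defining relations.  This is \<open>universal_property\<close>.  Existence
  is evaluation of terms in \<open>D\<close>, which respects the congruence \<open>teq\<close> because \<open>teq\<close> is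
  generated by axioms that hold in \<open>D\<close> and the defining relations; uniqueness is induction on terms.

  To apply this, representations must form a strict linear monoidal category.  A linear map out of a
  tensor product is determined by its values on elementary tensors (\<open>tensor_map_eqI\<close>), so every axiom
  becomes an identity between elementary tensors, and there strictness is the associativity of
  concatenating tuples (\<open>elt_assoc\<close>).

  It remains to check the relations for the bracket, the flip, the canonical element and the Killing
  form of the Lie algebra, again on elementary tensors.  Writing \<open>b'\<close> for the dual basis vector of \<open>b\<close>,
  everything rests on three facts.

  \<^item> The two expansions \<open>x = \<Sum> \<kappa>(b', x) b\<close> and \<open>x = \<Sum> \<kappa>(x, b) b'\<close> (\<open>expand_basis\<close>, \<open>expand_dual\<close>), which
  are the zigzag relations.  The first says that pairing with \<open>b'\<close> reads off the \<open>b\<close>-coordinate; hence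
  \<open>\<kappa>\<close> is nondegenerate, and the second follows.

  \<^item> The sliding identity \<open>\<Sum> [a, b] \<otimes> b' = \<Sum> b \<otimes> [b', a]\<close> (\<open>copairing_slide\<close>), which follows from the
  expansions and the invariance of \<open>\<kappa>\<close>.  It makes the canonical element \<open>\<Sum> b \<otimes> b'\<close> invariant, identifies
  the two expressions for \<open>\<sigma>\<close>, and gives the formula for \<open>\<sigma>\<close> in the theorem.

  \<^item> The Casimir element acts on the adjoint representation as the identity (\<open>casimir\<close>), which is the
  relation \<open>m \<sigma> = 1\<close>.  Schur's lemma can be bypassed: by invariance
  \<open>\<kappa>(\<Sum> [[a, b], b'], x) = \<Sum> \<kappa>(b', [x, [a, b]])\<close>, the right-hand side is the sum of the diagonal
  coordinates of \<open>ad x \<circ> ad a\<close>, that is \<open>\<kappa>(x, a)\<close>, and \<open>\<kappa>\<close> is nondegenerate.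
\<close>

section \<open>\<open>\<T>\<^bsub>\<delta>,\<alpha>\<^esub>\<close> as a strict linear monoidal category\<close>

text \<open>
  Typing is syntax-directed, so it is split into a source, a target and a well-formedness predicate.
  In this form typing conditions have no existentially quantified intermediate objects and are decided
  by rewriting.
\<close>

primrec tsrc :: "tm \<Rightarrow> nat" where
  "tsrc M = 2" | "tsrc S = 2" | "tsrc Eta = 0" | "tsrc Eps = 2" | "tsrc (I n) = n"
| "tsrc (g \<cdot> f) = tsrc f" | "tsrc (f \<odot> g) = tsrc f + tsrc g"
| "tsrc (Zero a b) = a" | "tsrc (f \<^bold>+ g) = tsrc f" | "tsrc (r \<^bold>* f) = tsrc f"

primrec ttgt :: "tm \<Rightarrow> nat" where
  "ttgt M = 1" | "ttgt S = 2" | "ttgt Eta = 2" | "ttgt Eps = 0" | "ttgt (I n) = n"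
| "ttgt (g \<cdot> f) = ttgt g" | "ttgt (f \<odot> g) = ttgt f + ttgt g"
| "ttgt (Zero a b) = b" | "ttgt (f \<^bold>+ g) = ttgt f" | "ttgt (r \<^bold>* f) = ttgt f"

primrec wf_tm :: "tm \<Rightarrow> bool" where
  "wf_tm M = True" | "wf_tm S = True" | "wf_tm Eta = True" | "wf_tm Eps = True" | "wf_tm (I n) = True"
| "wf_tm (g \<cdot> f) = (wf_tm g \<and> wf_tm f \<and> tsrc g = ttgt f)" | "wf_tm (f \<odot> g) = (wf_tm f \<and> wf_tm g)"
| "wf_tm (Zero a b) = True"
| "wf_tm (f \<^bold>+ g) = (wf_tm f \<and> wf_tm g \<and> tsrc f = tsrc g \<and> ttgt f = ttgt g)"
| "wf_tm (r \<^bold>* f) = wf_tm f"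

lemma typed_iff: "typed f a b \<longleftrightarrow> wf_tm f \<and> tsrc f = a \<and> ttgt f = b"
proof
  show "typed f a b \<Longrightarrow> wf_tm f \<and> tsrc f = a \<and> ttgt f = b"
    by (induction rule: typed.induct) auto
  have "wf_tm f \<Longrightarrow> typed f (tsrc f) (ttgt f)"
    by (induction f) (auto intro: typed.intros simp del: One_nat_def)
  then show "wf_tm f \<and> tsrc f = a \<and> ttgt f = b \<Longrightarrow> typed f a b" by auto
qed

lemma rels_same_type:
  "rels \<delta> \<alpha> f g \<Longrightarrow> wf_tm f \<and> wf_tm g \<and> tsrc f = tsrc g \<and> ttgt f = ttgt g"
  by (induction rule: rels.induct) (auto simp: sigma_def)

lemma teq_same_type:
  "teq \<delta> \<alpha> f g \<Longrightarrow> wf_tm f \<and> wf_tm g \<and> tsrc f = tsrc g \<and> ttgt f = ttgt g"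
  by (induction rule: teq.induct) (auto simp: typed_iff rels_same_type)

text \<open>
  The operations of \<open>T\<close> are unions over all representatives of two classes; the congruence rules make the
  family constant.
\<close>

lemma UN_UN_const:
  "x \<in> A \<Longrightarrow> y \<in> B \<Longrightarrow> (\<And>x y. x \<in> A \<Longrightarrow> y \<in> B \<Longrightarrow> h x y = c) \<Longrightarrow> (\<Union>x\<in>A. \<Union>y\<in>B. h x y) = c"
  by blast

lemma cls_eqI: "teq \<delta> \<alpha> f g \<Longrightarrow> cls \<delta> \<alpha> f = cls \<delta> \<alpha> g"
  unfolding cls_def by (auto intro: teq.trans teq.sym)

lemma cls_self: "wf_tm f \<Longrightarrow> f \<in> cls \<delta> \<alpha> f"
  unfolding cls_def by (auto intro: teq.refl simp: typed_iff)

lemma cls_same_type: "g \<in> cls \<delta> \<alpha> f \<Longrightarrow> wf_tm g \<and> tsrc g = tsrc f \<and> ttgt g = ttgt f"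
  by (auto simp: cls_def dest: teq_same_type)

lemma T_simps [simp]:
  "obj (T \<delta> \<alpha>) = UNIV" "idm (T \<delta> \<alpha>) a = cls \<delta> \<alpha> (I a)" "unit (T \<delta> \<alpha>) = 0"
  "tobj (T \<delta> \<alpha>) a b = a + b" "zer (T \<delta> \<alpha>) a b = cls \<delta> \<alpha> (Zero a b)"
  by (simp_all add: T_def)

lemma hom_T: "hom (T \<delta> \<alpha>) a b = {cls \<delta> \<alpha> f | f. wf_tm f \<and> tsrc f = a \<and> ttgt f = b}"
proof -
  have "{(f, g). typed f a b \<and> typed g a b \<and> teq \<delta> \<alpha> f g} `` {f} = cls \<delta> \<alpha> f"
    if "typed f a b" for f
    using that by (auto simp: cls_def typed_iff dest: teq_same_type)
  then show ?thesis unfolding T_def quotient_def typed_iff[symmetric] by auto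
qed

lemma mor_T: "mor (T \<delta> \<alpha>) = {cls \<delta> \<alpha> f | f. wf_tm f}"
  by (auto simp: mor_def hom_T)

lemma cmp_cls [simp]:
  assumes "wf_tm g" "wf_tm f" "tsrc g = ttgt f"
  shows "cmp (T \<delta> \<alpha>) (cls \<delta> \<alpha> g) (cls \<delta> \<alpha> f) = cls \<delta> \<alpha> (g \<cdot> f)"
  using assms unfolding T_def lin_mon_cat.simps
  by (intro UN_UN_const[OF cls_self cls_self] cls_eqI[symmetric] teq.intros(5))
    (auto simp: cls_def typed_iff)

lemma tmor_cls [simp]:
  assumes "wf_tm f" "wf_tm g"
  shows "tmor (T \<delta> \<alpha>) (cls \<delta> \<alpha> f) (cls \<delta> \<alpha> g) = cls \<delta> \<alpha> (f \<odot> g)"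
  using assms unfolding T_def lin_mon_cat.simps
  by (intro UN_UN_const[OF cls_self cls_self] cls_eqI[symmetric] teq.intros(6))
    (auto simp: cls_def typed_iff)

lemma madd_cls [simp]:
  assumes "wf_tm f" "wf_tm g" "tsrc f = tsrc g" "ttgt f = ttgt g"
  shows "madd (T \<delta> \<alpha>) (cls \<delta> \<alpha> f) (cls \<delta> \<alpha> g) = cls \<delta> \<alpha> (f \<^bold>+ g)"
  using assms unfolding T_def lin_mon_cat.simps
  by (intro UN_UN_const[OF cls_self cls_self] cls_eqI[symmetric] teq.intros(7))
    (auto simp: cls_def typed_iff)

lemma smul_cls [simp]:
  assumes "wf_tm f"
  shows "smul (T \<delta> \<alpha>) r (cls \<delta> \<alpha> f) = cls \<delta> \<alpha> (r \<^bold>* f)"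
proof -
  have "cls \<delta> \<alpha> (r \<^bold>* f') = cls \<delta> \<alpha> (r \<^bold>* f)" if "f' \<in> cls \<delta> \<alpha> f" for f'
    using that by (intro cls_eqI[symmetric] teq.intros(8)) (auto simp: cls_def)
  then show ?thesis using cls_self[OF assms] unfolding T_def lin_mon_cat.simps by blast
qed

lemma hom_TE:
  assumes "F \<in> hom (T \<delta> \<alpha>) a b"
  obtains f where "F = cls \<delta> \<alpha> f" "wf_tm f" "a = tsrc f" "b = ttgt f"
  using assms unfolding hom_T by blast

lemma mor_TE:
  assumes "F \<in> mor (T \<delta> \<alpha>)"
  obtains f where "F = cls \<delta> \<alpha> f" "wf_tm f"
  using assms unfolding mor_T by blast

lemma cls_in_hom: "wf_tm f \<Longrightarrow> tsrc f = a \<Longrightarrow> ttgt f = b \<Longrightarrow> cls \<delta> \<alpha> f \<in> hom (T \<delta> \<alpha>) a b"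
  by (auto simp: hom_T)

lemma cls_in_mor: "wf_tm f \<Longrightarrow> cls \<delta> \<alpha> f \<in> mor (T \<delta> \<alpha>)"
  by (auto simp: mor_T)

text \<open>
  Every equational axiom about morphisms is one of the rules of \<open>teq\<close>; those about objects are laws of addition.
\<close>

theorem T_strict_monoidal: "strict_linear_monoidal_category (T \<delta> \<alpha>)"
proof (unfold_locales, goal_cases)
  \<comment> \<open>Hom-sets are disjoint because the members of a class all have the type of the class.\<close>
  case (1 a b a' b' f)
  then show ?case by (metis hom_TE cls_self cls_same_type)
\<comment> \<open>The rules of \<open>teq\<close> from the ninth on are the axioms; before them come the relations and the congruence rules.\<close>
qed (((elim hom_TE mor_TE)?, (simp add: cls_in_hom; fail |
    (simp?, rule cls_eqI, rule teq.intros(9-); (simp add: typed_iff; fail))))[1])+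

section \<open>The universal property of the presentation\<close>

context strict_linear_monoidal_category
begin

lemma hom_mor: "f \<in> hom C a b \<Longrightarrow> a \<in> obj C \<Longrightarrow> b \<in> obj C \<Longrightarrow> f \<in> mor C"
  by (auto simp: mor_def)

end

text \<open>
  Typed values for the four generators, before any relation is imposed.
\<close>

locale T_data = strict_linear_monoidal_category D for D :: "('p, 'n) lin_mon_cat" +
  fixes X :: 'p and m s e p :: 'n
  assumes X_obj: "X \<in> obj D"
    and m_hom: "m \<in> hom D (tobj D X X) X"
    and s_hom: "s \<in> hom D (tobj D X X) (tobj D X X)"
    and e_hom: "e \<in> hom D (unit D) (tobj D X X)"
    and p_hom: "p \<in> hom D (tobj D X X) (unit D)"
begin

abbreviation id_X :: 'n where "id_X \<equiv> idm D X"
abbreviation comp :: "'n \<Rightarrow> 'n \<Rightarrow> 'n" (infixr "\<bullet>" 65) where "g \<bullet> f \<equiv> cmp D g f"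
abbreviation tens :: "'n \<Rightarrow> 'n \<Rightarrow> 'n" (infixr "\<otimes>" 75) where "f \<otimes> g \<equiv> tmor D f g"

definition sig :: 'n where "sig = (id_X \<otimes> m) \<bullet> (e \<otimes> id_X)"

primrec X_power :: "nat \<Rightarrow> 'p" where
  "X_power 0 = unit D"
| "X_power (Suc n) = tobj D X (X_power n)"

primrec eval :: "tm \<Rightarrow> 'n" where
  "eval M = m" | "eval S = s" | "eval Eta = e" | "eval Eps = p"
| "eval (I n) = idm D (X_power n)"
| "eval (g \<cdot> f) = eval g \<bullet> eval f"
| "eval (f \<odot> g) = eval f \<otimes> eval g"
| "eval (Zero a b) = zer D (X_power a) (X_power b)"
| "eval (f \<^bold>+ g) = madd D (eval f) (eval g)"
| "eval (r \<^bold>* f) = smul D r (eval f)"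

lemma X_power_obj [simp]: "X_power n \<in> obj D"
  by (induction n) (auto intro: unit_obj tobj_obj X_obj)

lemma X_power_add: "X_power (a + b) = tobj D (X_power a) (X_power b)"
  by (induction a) (auto simp: tobj_unit_left tobj_assoc X_obj)

lemma X_power_1 [simp]: "X_power (Suc 0) = X"
  by (simp add: tobj_unit_right X_obj)

lemma X_power_2 [simp]: "X_power 2 = tobj D X X"
  by (simp add: numeral_2_eq_2 tobj_unit_right X_obj)

lemma eval_hom: "typed f a b \<Longrightarrow> eval f \<in> hom D (X_power a) (X_power b)"
proof (induction rule: typed.induct)
  case (6 g b c f a)
  then show ?case using cmp_hom[OF X_power_obj X_power_obj X_power_obj] by auto
next
  case (7 f a b g a' b')
  then show ?case using tmor_hom[OF X_power_obj X_power_obj X_power_obj X_power_obj]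
    by (auto simp: X_power_add)
qed (auto simp: m_hom s_hom e_hom p_hom id_hom zer_hom plus_hom smul_hom simp del: X_power.simps(2))

lemma eval_mor: "typed f a b \<Longrightarrow> eval f \<in> mor D"
  using eval_hom hom_mor X_power_obj by blast

end

text \<open>
  An object with morphisms satisfying the defining relations, that is, a model of the presentation in
  \<open>D\<close>.
\<close>

locale T_algebra = T_data D X m s e p
  for D :: "('p, 'n) lin_mon_cat" and X m s e p +
  fixes \<delta> \<alpha> :: complex
  assumes zigzag_right: "(p \<otimes> id_X) \<bullet> (id_X \<otimes> e) = id_X"
    and zigzag_left: "(id_X \<otimes> p) \<bullet> (e \<otimes> id_X) = id_X"
    and sig_alt: "sig = (m \<otimes> id_X) \<bullet> (id_X \<otimes> e)"
    and slide_cap: "(id_X \<otimes> p) \<bullet> (s \<otimes> id_X) = (p \<otimes> id_X) \<bullet> (id_X \<otimes> s)"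
    and swap_invol: "s \<bullet> s = id_X \<otimes> id_X"
    and braid: "(s \<otimes> id_X) \<bullet> (id_X \<otimes> s) \<bullet> (s \<otimes> id_X) =
      (id_X \<otimes> s) \<bullet> (s \<otimes> id_X) \<bullet> (id_X \<otimes> s)"
    and slide_mult: "(id_X \<otimes> m) \<bullet> (s \<otimes> id_X) \<bullet> (id_X \<otimes> s) = s \<bullet> (m \<otimes> id_X)"
    and slide_comult: "(id_X \<otimes> s) \<bullet> (s \<otimes> id_X) \<bullet> (id_X \<otimes> sig) = (sig \<otimes> id_X) \<bullet> s"
    and cap_sym: "p \<bullet> s = p"
    and mult_skew: "m \<bullet> s = smul D (-1) m"
    and mult_sig: "m \<bullet> sig = smul D \<alpha> id_X"
    and cap_cup: "p \<bullet> e = smul D \<delta> (idm D (unit D))"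
begin

lemma eval_sigma: "eval sigma = sig"
  by (simp add: sigma_def sig_def tobj_unit_right X_obj)

lemma eval_rels: "rels \<delta> \<alpha> f g \<Longrightarrow> eval f = eval g"
  by (induction rule: rels.induct)
    (simp_all add: eval_sigma tobj_unit_right X_obj zigzag_right zigzag_left sig_alt slide_cap swap_invol
      braid slide_mult slide_comult[unfolded sig_alt] cap_sym mult_skew mult_sig[unfolded sig_alt] cap_cup)

text \<open>
  Each rule of \<open>teq\<close> is sound: the congruence rules trivially, the structural rules because they are axioms
  of \<open>D\<close>, and the relations by the assumptions on the model.
\<close>

lemma eval_teq: "teq \<delta> \<alpha> f g \<Longrightarrow> eval f = eval g"
proof (induction rule: teq.induct)
  case (rel f g)
  then show ?case by (rule eval_rels)
qed (simp_all only: eval.simps X_power.simps(1) X_power_add, (blast intro: eval_hom eval_mor X_power_obj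
  id_left id_right cmp_assoc tmor_assoc tmor_unit_left tmor_unit_right tmor_id interchange
  plus_assoc plus_comm plus_zer plus_neg smul_plus smul_add smul_smul smul_one
  cmp_plus_left cmp_plus_right cmp_smul_left cmp_smul_right
  tmor_plus_left tmor_plus_right tmor_smul_left tmor_smul_right)+)

definition eval_functor :: "(nat, tm set, 'p, 'n) fctr" where
  "eval_functor = Functor X_power (\<lambda>F\<in>mor (T \<delta> \<alpha>). eval (SOME f. f \<in> F))"

lemma on_obj_eval_functor [simp]: "on_obj eval_functor = X_power"
  by (simp add: eval_functor_def)

lemma on_mor_eval_functor [simp]: "wf_tm f \<Longrightarrow> on_mor eval_functor (cls \<delta> \<alpha> f) = eval f"
proof -
  assume f: "wf_tm f"
  have "(SOME g. g \<in> cls \<delta> \<alpha> f) \<in> cls \<delta> \<alpha> f" using cls_self[OF f] by (rule someI)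
  then have "eval f = eval (SOME g. g \<in> cls \<delta> \<alpha> f)"
    by (intro eval_teq) (simp add: cls_def)
  then show ?thesis using f by (simp add: eval_functor_def cls_in_mor)
qed

lemma eval_functor_monoidal: "monoidal_functor (T \<delta> \<alpha>) D eval_functor"
proof -
  interpret T: strict_linear_monoidal_category "T \<delta> \<alpha>" by (rule T_strict_monoidal)
  show ?thesis
  proof (unfold_locales, goal_cases)
    case 2
    then show ?case by (simp add: eval_functor_def)
  next
    case (4 a b f)
    then show ?case by (elim hom_TE) (simp add: eval_hom typed_iff)
  qed ((elim hom_TE mor_TE)?, simp add: X_power_add)+
qed

text \<open>
  Terms are built from the generators by operations that a monoidal functor preserves.  The only term
  constructor about which functors make no explicit promise is the zero morphism.
\<close>

lemma functor_eq_eval_functor: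
  assumes F: "monoidal_functor (T \<delta> \<alpha>) D F" and X: "on_obj F 1 = X"
    and M: "on_mor F (cls \<delta> \<alpha> M) = m" and S: "on_mor F (cls \<delta> \<alpha> S) = s"
    and Eta: "on_mor F (cls \<delta> \<alpha> Eta) = e" and Eps: "on_mor F (cls \<delta> \<alpha> Eps) = p"
  shows "F = eval_functor"
proof -
  interpret F: monoidal_functor "T \<delta> \<alpha>" D F by (rule F)
  have obj: "on_obj F n = X_power n" for n
  proof (induction n)
    case 0
    show ?case using F.F_unit by simp
  next
    case (Suc n)
    then show ?case using F.F_tobj[of 1 n] X by simp
  qed
  have mor: "on_mor F (cls \<delta> \<alpha> f) = eval f" if "wf_tm f" for f
    using that
  proof (induction f)
    case (I n)
    show ?case using F.F_id[of n] obj by simp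
  next
    case (Cmp g f)
    then have "cls \<delta> \<alpha> g \<in> hom (T \<delta> \<alpha>) (ttgt f) (ttgt g)" "cls \<delta> \<alpha> f \<in> hom (T \<delta> \<alpha>) (tsrc f) (ttgt f)"
      by (simp_all add: cls_in_hom)
    then show ?case using F.F_cmp[of "tsrc f" "ttgt f" "ttgt g" "cls \<delta> \<alpha> g" "cls \<delta> \<alpha> f"] Cmp by simp
  next
    case (Ten f g)
    then show ?case using F.F_tmor[of "cls \<delta> \<alpha> f" "cls \<delta> \<alpha> g"] by (simp add: cls_in_mor)
  next
    \<comment> \<open>Additivity alone forces zero to go to zero: \<open>0 = 0 + (-1) 0\<close>.\<close>
    case (Zero a b)
    let ?Z = "cls \<delta> \<alpha> (Zero a b)"
    have Z: "?Z \<in> hom (T \<delta> \<alpha>) a b" by (simp add: cls_in_hom)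
    have "on_mor F ?Z = on_mor F (madd (T \<delta> \<alpha>) ?Z (smul (T \<delta> \<alpha>) (-1) ?Z))"
      using F.C.plus_neg[OF _ _ Z] by simp
    also have "\<dots> = madd D (on_mor F ?Z) (smul D (-1) (on_mor F ?Z))"
      using F.F_plus[OF _ _ Z F.C.smul_hom[OF _ _ Z]] F.F_smul[OF F.C.hom_mor[OF Z]] by simp
    also have "\<dots> = zer D (X_power a) (X_power b)"
      using F.F_hom[OF _ _ Z] obj by (intro plus_neg) auto
    finally show ?case by simp
  next
    case (Add f g)
    then have "cls \<delta> \<alpha> g \<in> hom (T \<delta> \<alpha>) (tsrc f) (ttgt f)" "cls \<delta> \<alpha> f \<in> hom (T \<delta> \<alpha>) (tsrc f) (ttgt f)"
      by (simp_all add: cls_in_hom)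
    then show ?case using F.F_plus[of "tsrc f" "ttgt f" "cls \<delta> \<alpha> f" "cls \<delta> \<alpha> g"] Add by simp
  next
    case (Scale r f)
    then show ?case using F.F_smul[of "cls \<delta> \<alpha> f"] by (simp add: cls_in_mor)
  qed (use M S Eta Eps in simp_all)
  have "on_mor F = on_mor eval_functor"
  proof (rule extensionalityI[OF F.ext_mor])
    interpret E: monoidal_functor "T \<delta> \<alpha>" D eval_functor by (rule eval_functor_monoidal)
    show "on_mor eval_functor \<in> extensional (mor (T \<delta> \<alpha>))" by (rule E.ext_mor)
  qed (auto elim: mor_TE simp: mor)
  moreover have "on_obj F = on_obj eval_functor" using obj by auto
  ultimately show ?thesis by (simp add: fctr.expand)
qed

theorem universal_property:
  "\<exists>!F. monoidal_functor (T \<delta> \<alpha>) D F \<and> on_obj F 1 = X \<and> on_mor F (cls \<delta> \<alpha> M) = m \<and>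
    on_mor F (cls \<delta> \<alpha> S) = s \<and> on_mor F (cls \<delta> \<alpha> Eta) = e \<and> on_mor F (cls \<delta> \<alpha> Eps) = p"
  (is "\<exists>!F. ?P F")
proof (rule ex1I[of _ eval_functor])
  show "?P eval_functor" by (simp add: eval_functor_monoidal tobj_unit_right X_obj)
  show "F = eval_functor" if "?P F" for F using that functor_eq_eval_functor by blast
qed

end

section \<open>Linear maps between spaces of functions on tuples\<close>

lemma linear_map_on_add: "linear_map_on V f \<Longrightarrow> u \<in> V \<Longrightarrow> v \<in> V \<Longrightarrow> f (u + v) = f u + f v"
  and linear_map_on_scale: "linear_map_on V f \<Longrightarrow> v \<in> V \<Longrightarrow> f (fscale c v) = fscale c (f v)"
  unfolding linear_map_on_def by blast+

lemma linear_map_on_cong: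
  assumes V: "fun_vs.subspace V" and eq: "\<And>v. v \<in> V \<Longrightarrow> f v = g v" and g: "linear_map_on V g"
  shows "linear_map_on V f"
  using g unfolding linear_map_on_def
  by (simp add: eq fun_vs.subspace_add[OF V] fun_vs.subspace_scale[OF V])

lemma linear_map_on_compose:
  "linear_map_on V f \<Longrightarrow> linear_map_on W g \<Longrightarrow> (\<And>v. v \<in> V \<Longrightarrow> f v \<in> W) \<Longrightarrow> linear_map_on V (\<lambda>v. g (f v))"
  by (simp add: linear_map_on_def)

lemma linear_map_on_plus:
  "linear_map_on V f \<Longrightarrow> linear_map_on V g \<Longrightarrow> linear_map_on V (\<lambda>v. f v + g v)"
  by (simp add: linear_map_on_def fun_vs.scale_right_distrib)

lemma linear_map_on_minus:
  "linear_map_on V f \<Longrightarrow> linear_map_on V g \<Longrightarrow> linear_map_on V (\<lambda>v. f v - g v)"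
  by (simp add: linear_map_on_def fun_vs.scale_right_diff_distrib)

lemma linear_map_on_fscale:
  "linear_map_on V f \<Longrightarrow> linear_map_on V (\<lambda>v. fscale c (f v))"
  by (simp add: linear_map_on_def fun_vs.scale_right_distrib fun_vs.scale_left_commute)

lemma linear_map_on_id: "linear_map_on V (\<lambda>v. v)"
  by (simp add: linear_map_on_def)

lemma linear_map_on_null: "linear_map_on V (\<lambda>v. 0)"
  by (simp add: linear_map_on_def)

text \<open>
  Membership of values in a subspace is checked on generators, later on elementary tensors.
\<close>

lemma linear_map_on_span_mem:
  assumes f: "linear_map_on (fun_vs.span G) f" and U: "fun_vs.subspace U"
    and G: "\<And>x. x \<in> G \<Longrightarrow> f x \<in> U" and x: "x \<in> fun_vs.span G"
  shows "f x \<in> U"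
proof -
  have "x \<in> fun_vs.span G \<and> f x \<in> U"
    using x
  proof (induction rule: fun_vs.span_induct_alt)
    case base
    show ?case
      using linear_map_on_zero[OF f] fun_vs.subspace_0[OF U] fun_vs.span_zero by metis
  next
    case (step c x y)
    then have mem: "x \<in> fun_vs.span G" "fscale c x \<in> fun_vs.span G" "y \<in> fun_vs.span G"
      by (auto intro: fun_vs.span_base fun_vs.span_scale)
    then have "f (fscale c x + y) = fscale c (f x) + f y"
      using linear_map_on_add[OF f] linear_map_on_scale[OF f] by metis
    then have "f (fscale c x + y) \<in> U"
      using step(1,2) U G by (simp only: fun_vs.subspace_add fun_vs.subspace_scale)
    moreover have "fscale c x + y \<in> fun_vs.span G"
      using mem(2,3) by (rule fun_vs.span_add)
    ultimately show ?case by (rule conjI[rotated])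
  qed
  then show ?thesis ..
qed

section \<open>Tensor products of spaces\<close>

lemma linear_elt_left: "linear_map_on V (\<lambda>v. elt m v w)"
  and linear_elt_right: "linear_map_on W (elt m v)"
  by (auto simp: linear_map_on_def elt_add_left elt_add_right elt_scale_left elt_scale_right)

lemma elt_mem: "v \<in> V \<Longrightarrow> w \<in> W \<Longrightarrow> elt m v w \<in> tensor_space m V W"
  unfolding tensor_space_def by (blast intro: fun_vs.span_base)

lemma subspace_tensor [simp]: "fun_vs.subspace (tensor_space m V W)"
  by (simp add: tensor_space_def)

text \<open>
  Both sides cut a tuple into the same three consecutive pieces.  This is the source of strictness.
\<close>

lemma elt_assoc: "elt (m + n) (elt m u v) w = elt m u (elt n v w)"
  by (rule ext) (simp add: elt_def take_drop add.commute min_def mult.assoc)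

lemma tensor_map_mem:
  assumes "linear_map_on (tensor_space m V W) f" "fun_vs.subspace U"
    and "\<And>v w. v \<in> V \<Longrightarrow> w \<in> W \<Longrightarrow> f (elt m v w) \<in> U" "t \<in> tensor_space m V W"
  shows "f t \<in> U"
  by (rule linear_map_on_span_mem[OF assms(1)[unfolded tensor_space_def] assms(2) _
        assms(4)[unfolded tensor_space_def]]) (use assms(3) in blast)

text \<open>
  Elementary tensors span, so linear maps on a tensor product may be compared on them.
\<close>

lemma tensor_map_eqI:
  assumes "linear_map_on (tensor_space m V W) f" "linear_map_on (tensor_space m V W) g"
    and "\<And>v w. v \<in> V \<Longrightarrow> w \<in> W \<Longrightarrow> f (elt m v w) = g (elt m v w)" "t \<in> tensor_space m V W"
  shows "f t = g t"
  by (rule linear_map_on_span[OF assms(1,2)[unfolded tensor_space_def] _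
        assms(4)[unfolded tensor_space_def]]) (use assms(3) in blast)

lemma tensor_subspaceI:
  assumes "fun_vs.subspace U" "\<And>v w. v \<in> V \<Longrightarrow> w \<in> W \<Longrightarrow> elt m v w \<in> U"
  shows "tensor_space m V W \<subseteq> U"
  unfolding tensor_space_def by (rule fun_vs.span_minimal[OF _ assms(1)]) (use assms(2) in blast)

lemma tensor_space_assoc:
  "tensor_space (m + n) (tensor_space m U V) W = tensor_space m U (tensor_space n V W)"
  (is "?L = ?R")
proof (intro equalityI tensor_subspaceI subspace_tensor)
  fix t w assume t: "t \<in> tensor_space m U V" and w: "w \<in> W"
  show "elt (m + n) t w \<in> ?R"
    by (rule tensor_map_mem[OF linear_elt_left subspace_tensor _ t])
      (simp add: elt_assoc elt_mem w)
next
  fix u t assume u: "u \<in> U" and t: "t \<in> tensor_space n V W"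
  show "elt m u t \<in> ?L"
    by (rule tensor_map_mem[OF linear_elt_right subspace_tensor _ t])
      (simp add: elt_assoc[symmetric] elt_mem u)
qed

text \<open>
  Fix the first factor and compare in the other two.
\<close>

lemma tensor3_map_eqI:
  assumes f: "linear_map_on (tensor_space m U (tensor_space n V W)) f"
    and g: "linear_map_on (tensor_space m U (tensor_space n V W)) g"
    and eq: "\<And>u v w. u \<in> U \<Longrightarrow> v \<in> V \<Longrightarrow> w \<in> W \<Longrightarrow> f (elt m u (elt n v w)) = g (elt m u (elt n v w))"
    and t: "t \<in> tensor_space m U (tensor_space n V W)"
  shows "f t = g t"
proof (rule tensor_map_eqI[OF f g _ t])
  fix u t assume u: "u \<in> U" and t: "t \<in> tensor_space n V W"
  have m: "elt m u t \<in> tensor_space m U (tensor_space n V W)" if "t \<in> tensor_space n V W" for t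
    using u that by (rule elt_mem)
  show "f (elt m u t) = g (elt m u t)"
    by (rule tensor_map_eqI[OF linear_map_on_compose[OF linear_elt_right f m]
          linear_map_on_compose[OF linear_elt_right g m] eq[OF u] t])
qed

lemma fd_space_subspace: "fd_space n V \<Longrightarrow> fun_vs.subspace V"
  by (simp add: fd_space_def)

text \<open>
  Products of the elements of two finite spanning sets span the tensor product; and an elementary tensor
  vanishes on tuples of the wrong length since one of its two factors does.
\<close>

lemma fd_space_tensor:
  assumes V: "fd_space m V" and W: "fd_space n W"
  shows "fd_space (m + n) (tensor_space m V W)"
  unfolding fd_space_def
proof (intro conjI ballI allI impI)
  obtain A B where A: "finite A" "fun_vs.span A = V" and B: "finite B" "fun_vs.span B = W"
    using V W by (auto simp: fd_space_def)
  define G where "G = (\<lambda>(a, b). elt m a b) ` (A \<times> B)"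
  have G: "elt m a b \<in> G" if "a \<in> A" "b \<in> B" for a b
    unfolding G_def using that by (intro image_eqI[of _ _ "(a, b)"]) simp_all
  have AV: "A \<subseteq> V" and BW: "B \<subseteq> W" using A B fun_vs.span_superset by blast+
  have "fun_vs.span G = tensor_space m V W"
  proof
    have "G \<subseteq> tensor_space m V W"
      unfolding G_def using AV BW by (clarsimp simp: elt_mem subset_iff)
    then show "fun_vs.span G \<subseteq> tensor_space m V W"
      by (rule fun_vs.span_minimal[OF _ subspace_tensor])
    show "tensor_space m V W \<subseteq> fun_vs.span G"
    proof (rule tensor_subspaceI)
      fix v w assume v: "v \<in> V" and w: "w \<in> W"
      have "elt m a w \<in> fun_vs.span G" if "a \<in> A" for a
        by (rule linear_map_on_span_mem[OF linear_elt_right fun_vs.subspace_span _ w[folded B(2)]])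
          (rule fun_vs.span_base[OF G[OF that]])
      then show "elt m v w \<in> fun_vs.span G"
        by (rule linear_map_on_span_mem[OF linear_elt_left fun_vs.subspace_span _ v[folded A(2)]])
    qed (rule fun_vs.subspace_span)
  qed
  moreover have "finite G" unfolding G_def using A(1) B(1) by blast
  ultimately show "\<exists>G. finite G \<and> fun_vs.span G = tensor_space m V W" by blast
next
  fix t and xs :: "'a list" assume t: "t \<in> tensor_space m V W" and len: "length xs \<noteq> m + n"
  have "tensor_space m V W \<subseteq> {t. t xs = 0}"
  proof (rule tensor_subspaceI)
    show "fun_vs.subspace {t. t xs = 0}" by (simp add: fun_vs.subspace_def fscale_def)
    fix v w assume vw: "v \<in> V" "w \<in> W"
    have "length (take m xs) \<noteq> m \<or> length (drop m xs) \<noteq> n" using len by auto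
    then have "v (take m xs) = 0 \<or> w (drop m xs) = 0"
      using vw V W unfolding fd_space_def by blast
    then show "elt m v w \<in> {t. t xs = 0}" by (auto simp: elt_def)
  qed
  then show "t xs = 0" using t by blast
qed simp

definition bilinear_on where
  "bilinear_on V W b \<longleftrightarrow> (\<forall>w\<in>W. linear_map_on V (\<lambda>v. b v w)) \<and> (\<forall>v\<in>V. linear_map_on W (b v))"

lemma
  fixes b :: "'x tup \<Rightarrow> 'x tup \<Rightarrow> 'y tup"
  assumes "fd_space m V" "fd_space n W" "bilinear_on V W b"
  shows tensor_lift_extensional: "tensor_lift m V W b \<in> extensional (tensor_space m V W)"
    and tensor_lift_linear: "linear_map_on (tensor_space m V W) (tensor_lift m V W b)"
    and tensor_lift_elt: "v \<in> V \<Longrightarrow> w \<in> W \<Longrightarrow> tensor_lift m V W b (elt m v w) = b v w"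
proof -
  have "\<exists>!h. h \<in> extensional (tensor_space m V W) \<and> linear_map_on (tensor_space m V W) h \<and>
    (\<forall>v\<in>V. \<forall>w\<in>W. h (elt m v w) = b v w)"
    using assms(3) unfolding bilinear_on_def
    by (intro tensor_universal[OF assms(1,2)]) blast+
  from theI'[OF this]
  show "tensor_lift m V W b \<in> extensional (tensor_space m V W)"
    "linear_map_on (tensor_space m V W) (tensor_lift m V W b)"
    "v \<in> V \<Longrightarrow> w \<in> W \<Longrightarrow> tensor_lift m V W b (elt m v w) = b v w"
    unfolding tensor_lift_def by blast+
qed

section \<open>The category of representations\<close>

context lie_algebra
begin

lemma elt_scalar_left: "elt 0 (scalar c) w = fscale c w"
  by (rule ext) (simp add: elt_def scalar_def fscale_def)

text \<open>
  Here \<open>v\<close> must vanish off tuples of length \<open>m\<close>: on longer tuples the scalar factor gives \<open>0\<close>, and on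
  shorter ones cutting at \<open>m\<close> does not shorten the tuple.
\<close>

lemma elt_scalar_right:
  assumes "fd_space m V" "v \<in> V"
  shows "elt m v (scalar c) = fscale c v"
proof
  fix xs
  have "v (take m xs) * scalar c (drop m xs) = c * v xs" if "length xs = m"
    using that by (simp add: scalar_def)
  moreover have "v (take m xs) * scalar c (drop m xs) = c * v xs" if "length xs \<noteq> m"
  proof -
    have "v xs = 0" using assms that by (auto simp: fd_space_def)
    moreover have "v (take m xs) = 0 \<or> drop m xs \<noteq> []"
      using assms that by (cases "length xs < m") (auto simp: fd_space_def)
    ultimately show ?thesis by (auto simp: scalar_def)
  qed
  ultimately have "v (take m xs) * scalar c (drop m xs) = c * v xs" by blast
  then show "elt m v (scalar c) xs = fscale c v xs"
    by (simp only: elt_def fscale_def)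
qed

lemma scalar_add: "scalar (c + d) = scalar c + scalar d"
  and scalar_mult: "scalar (c * d) = fscale c (scalar d)"
  and scalar_0: "scalar 0 = 0"
  by (auto simp: scalar_def fscale_def)

lemma range_scalar_span: "range scalar = fun_vs.span {scalar 1}"
  by (auto simp: fun_vs.span_singleton scalar_mult[symmetric])

lemma fd_space_scalar: "fd_space 0 (range scalar)"
proof -
  have "\<exists>A. finite A \<and> fun_vs.span A = range (scalar :: complex \<Rightarrow> 'x tup)"
    by (intro exI[of _ "{scalar 1}"]) (simp only: range_scalar_span finite.intros simp_thms)
  moreover have "fun_vs.subspace (range (scalar :: complex \<Rightarrow> 'x tup))"
    unfolding range_scalar_span by (rule fun_vs.subspace_span)
  ultimately show ?thesis by (auto simp: fd_space_def scalar_def)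
qed

lemma
  assumes "is_rep V"
  shows rep_fd: "fd_space (deg V) (space V)"
    and rep_subspace: "fun_vs.subspace (space V)"
    and act_mem: "v \<in> space V \<Longrightarrow> act V x v \<in> space V"
    and act_extensional: "act V x \<in> extensional (space V)"
    and act_linear: "linear_map_on (space V) (act V x)"
    and act_add: "v \<in> space V \<Longrightarrow> act V (x + y) v = act V x v + act V y v"
    and act_scale: "v \<in> space V \<Longrightarrow> act V (scale c x) v = fscale c (act V x v)"
    and act_bracket: "v \<in> space V \<Longrightarrow>
      act V (bracket x y) v = act V x (act V y v) - act V y (act V x v)"
  using assms unfolding is_rep_def fd_space_def PiE_def by blast+

lemma is_repI:
  assumes "fd_space (deg V) (space V)"
    and "\<And>x v. v \<in> space V \<Longrightarrow> act V x v \<in> space V"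
    and "\<And>x. act V x \<in> extensional (space V)"
    and "\<And>x. linear_map_on (space V) (act V x)"
    and "\<And>x y v. v \<in> space V \<Longrightarrow> act V (x + y) v = act V x v + act V y v"
    and "\<And>c x v. v \<in> space V \<Longrightarrow> act V (scale c x) v = fscale c (act V x v)"
    and "\<And>x y v. v \<in> space V \<Longrightarrow>
      act V (bracket x y) v = act V x (act V y v) - act V y (act V x v)"
  shows "is_rep V"
  using assms unfolding is_rep_def PiE_def by blast

lemma tensor_rep_simps [simp]:
  "deg (tensor_rep V W) = deg V + deg W"
  "space (tensor_rep V W) = tensor_space (deg V) (space V) (space W)"
  by (simp_all add: tensor_rep_def)

lemma act_tensor_bilinear:
  assumes "is_rep V" "is_rep W"
  shows "bilinear_on (space V) (space W)
    (\<lambda>v w. elt (deg V) (act V x v) w + elt (deg V) v (act W x w))"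
proof -
  have "linear_map_on (space V) (\<lambda>v. elt (deg V) (act V x v) w)" for w
    using act_linear[OF assms(1), of x] by (simp add: linear_map_on_def elt_add_left elt_scale_left)
  then have 1: "linear_map_on (space V) (\<lambda>v. elt (deg V) (act V x v) w + elt (deg V) v (act W x w))" for w
    by (rule linear_map_on_plus[OF _ linear_elt_left])
  have "linear_map_on (space W) (\<lambda>w. elt (deg V) v (act W x w))" for v
    using act_linear[OF assms(2), of x] by (simp add: linear_map_on_def elt_add_right elt_scale_right)
  then have "linear_map_on (space W) (\<lambda>w. elt (deg V) (act V x v) w + elt (deg V) v (act W x w))" for v
    by (rule linear_map_on_plus[OF linear_elt_right])
  with 1 show ?thesis unfolding bilinear_on_def by blast
qed

lemma
  assumes "is_rep V" "is_rep W"
  shows act_tensor_extensional: "act (tensor_rep V W) x \<in> extensional (space (tensor_rep V W))"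
    and act_tensor_linear: "linear_map_on (tensor_space (deg V) (space V) (space W)) (act (tensor_rep V W) x)"
    and act_tensor_elt: "v \<in> space V \<Longrightarrow> w \<in> space W \<Longrightarrow> act (tensor_rep V W) x (elt (deg V) v w) =
      elt (deg V) (act V x v) w + elt (deg V) v (act W x w)"
proof -
  have act: "act (tensor_rep V W) x = tensor_lift (deg V) (space V) (space W)
      (\<lambda>v w. elt (deg V) (act V x v) w + elt (deg V) v (act W x w))"
    by (simp add: tensor_rep_def)
  note lift = rep_fd[OF assms(1)] rep_fd[OF assms(2)] act_tensor_bilinear[OF assms]
  show "act (tensor_rep V W) x \<in> extensional (space (tensor_rep V W))"
    unfolding act tensor_rep_simps by (rule tensor_lift_extensional[OF lift])
  show "linear_map_on (tensor_space (deg V) (space V) (space W)) (act (tensor_rep V W) x)"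
    unfolding act by (rule tensor_lift_linear[OF lift])
  show "act (tensor_rep V W) x (elt (deg V) v w) = elt (deg V) (act V x v) w + elt (deg V) v (act W x w)"
    if "v \<in> space V" "w \<in> space W"
    unfolding act by (rule tensor_lift_elt[OF lift that])
qed

lemma is_rep_tensor:
  assumes V: "is_rep V" and W: "is_rep W"
  shows "is_rep (tensor_rep V W)"
proof (rule is_repI)
  let ?T = "tensor_space (deg V) (space V) (space W)"
  note lin = act_tensor_linear[OF V W]
  note val = act_tensor_elt[OF V W]
  have mem: "act (tensor_rep V W) x t \<in> ?T" if "t \<in> ?T" for t x
    by (rule tensor_map_mem[OF lin subspace_tensor _ that])
      (auto simp: val intro!: fun_vs.subspace_add elt_mem act_mem V W)
  show "fd_space (deg (tensor_rep V W)) (space (tensor_rep V W))"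
    by (simp add: fd_space_tensor rep_fd V W)
  show "act (tensor_rep V W) x \<in> extensional (space (tensor_rep V W))" for x
    by (rule act_tensor_extensional[OF V W])
  show "linear_map_on (space (tensor_rep V W)) (act (tensor_rep V W) x)" for x
    using lin by simp
  fix x y t c assume "t \<in> space (tensor_rep V W)"
  then have t: "t \<in> ?T" by simp
  show "act (tensor_rep V W) x t \<in> space (tensor_rep V W)" using mem t by simp
  show "act (tensor_rep V W) (x + y) t = act (tensor_rep V W) x t + act (tensor_rep V W) y t"
    by (rule tensor_map_eqI[OF lin linear_map_on_plus[OF lin lin] _ t])
      (simp add: val act_add V W elt_add_left elt_add_right)
  show "act (tensor_rep V W) (scale c x) t = fscale c (act (tensor_rep V W) x t)"
    by (rule tensor_map_eqI[OF lin linear_map_on_fscale[OF lin] _ t])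
      (simp add: val act_scale V W elt_scale_left elt_scale_right fun_vs.scale_right_distrib)
  have comp: "linear_map_on ?T (\<lambda>t. act (tensor_rep V W) x (act (tensor_rep V W) y t))" for x y
    by (rule linear_map_on_compose[OF lin lin mem])
  have elt_diff: "elt m (u - u') w = elt m u w - elt m u' w" "elt m w (u - u') = elt m w u - elt m w u'"
    for m and u u' w :: "'b tup" by (auto simp: elt_def algebra_simps)
  show "act (tensor_rep V W) (bracket x y) t =
    act (tensor_rep V W) x (act (tensor_rep V W) y t) - act (tensor_rep V W) y (act (tensor_rep V W) x t)"
    by (rule tensor_map_eqI[OF lin linear_map_on_minus[OF comp comp] _ t])
      (simp add: val linear_map_on_add[OF lin] elt_mem act_mem act_bracket V W elt_diff)
qed

lemma trivial_rep_simps [simp]: "deg trivial_rep = 0" "space trivial_rep = range scalar"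
  "act trivial_rep x = (\<lambda>v\<in>range scalar. 0)"
  by (simp_all add: trivial_rep_def)

lemma is_rep_trivial: "is_rep (trivial_rep :: ('g, 'x) repn)"
proof -
  have zero: "0 \<in> range (scalar :: complex \<Rightarrow> 'x tup)" using scalar_0 by (metis rangeI)
  show ?thesis
  proof (rule is_repI)
    show "act trivial_rep x v \<in> space trivial_rep" if "v \<in> space trivial_rep" for x and v :: "'x tup"
      using zero that by simp
    have "linear_map_on (range scalar) (\<lambda>v::'x tup\<in>range scalar. 0 :: 'x tup)"
      by (rule linear_map_on_cong[OF fd_space_subspace[OF fd_space_scalar] _ linear_map_on_null]) simp
    then show "linear_map_on (space trivial_rep) (act trivial_rep x :: 'x tup \<Rightarrow> 'x tup)" for x by simp
  qed (simp_all add: fd_space_scalar)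
qed

text \<open>
  Strictness asks for equality of representations, not isomorphism.  The actions are total functions, so
  equality needs that they are extensional.
\<close>

lemma repn_eqI:
  assumes "deg V = deg W" "space V = space W" "\<And>x. act V x \<in> extensional (space V)"
    "\<And>x. act W x \<in> extensional (space V)" "\<And>x v. v \<in> space V \<Longrightarrow> act V x v = act W x v"
  shows "V = (W :: ('a, 'x) repn)"
proof -
  have "act V = act W"
    by (rule ext, rule extensionalityI[OF assms(3,4)]) (rule assms(5))
  then show ?thesis using assms(1,2) by simp
qed

text \<open>
  On triple elementary tensors both actions are the sum of the three actions on one factor.
\<close>

lemma tensor_rep_assoc:
  assumes "is_rep U" "is_rep V" "is_rep W"
  shows "tensor_rep (tensor_rep U V) W = tensor_rep U (tensor_rep V W)" (is "?L = ?R")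
proof (rule repn_eqI)
  have L: "is_rep ?L" and R: "is_rep ?R" using assms is_rep_tensor by blast+
  show sp: "space ?L = space ?R" by (simp add: tensor_space_assoc)
  show "act ?L x \<in> extensional (space ?L)" for x by (rule act_extensional[OF L])
  show "act ?R x \<in> extensional (space ?L)" for x unfolding sp by (rule act_extensional[OF R])
  fix x t assume t: "t \<in> space ?L"
  let ?T = "tensor_space (deg U) (space U) (tensor_space (deg V) (space V) (space W))"
  have T: "space ?L = ?T" "space ?R = ?T" using sp by simp_all
  show "act ?L x t = act ?R x t"
  proof (rule tensor3_map_eqI[OF act_linear[OF L, unfolded T] act_linear[OF R, unfolded T] _ t[unfolded T]])
    fix u v w assume "u \<in> space U" "v \<in> space V" "w \<in> space W"
    then show "act ?L x (elt (deg U) u (elt (deg V) v w)) = act ?R x (elt (deg U) u (elt (deg V) v w))"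
      using assms act_tensor_elt[of "tensor_rep U V" W "elt (deg U) u v" w]
      by (simp add: act_tensor_elt is_rep_tensor elt_mem elt_assoc elt_add_left elt_add_right add.assoc)
  qed
qed simp

lemma tensor_space_scalar_left: "fun_vs.subspace V \<Longrightarrow> tensor_space 0 (range scalar) V = V"
proof
  assume V: "fun_vs.subspace V"
  then show "tensor_space 0 (range scalar) V \<subseteq> V"
    by (intro tensor_subspaceI) (auto simp: elt_scalar_left fun_vs.subspace_scale)
  show "V \<subseteq> tensor_space 0 (range scalar) V"
  proof
    fix v assume "v \<in> V"
    then have "elt 0 (scalar 1) v \<in> tensor_space 0 (range scalar) V" by (intro elt_mem) auto
    then show "v \<in> tensor_space 0 (range scalar) V" by (simp add: elt_scalar_left)
  qed
qed

lemma tensor_space_scalar_right: "fd_space m V \<Longrightarrow> tensor_space m V (range scalar) = V"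
proof
  assume V: "fd_space m V"
  then show "tensor_space m V (range scalar) \<subseteq> V"
    by (intro tensor_subspaceI) (auto simp: elt_scalar_right fun_vs.subspace_scale fd_space_subspace)
  show "V \<subseteq> tensor_space m V (range scalar)"
  proof
    fix v assume v: "v \<in> V"
    then have "elt m v (scalar 1) \<in> tensor_space m V (range scalar)" by (intro elt_mem) auto
    then show "v \<in> tensor_space m V (range scalar)" by (simp add: elt_scalar_right[OF V v])
  qed
qed

lemma tensor_rep_unit_left:
  assumes V: "is_rep V"
  shows "tensor_rep trivial_rep V = V" (is "?L = _")
proof (rule repn_eqI)
  have L: "is_rep ?L" using V is_rep_trivial is_rep_tensor by blast
  show sp: "space ?L = space V" by (simp add: tensor_space_scalar_left rep_subspace V)
  show "act ?L x \<in> extensional (space ?L)" for x by (rule act_extensional[OF L])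
  show "act V x \<in> extensional (space ?L)" for x unfolding sp by (rule act_extensional[OF V])
  fix x v assume "v \<in> space ?L"
  then have "v \<in> space V" unfolding sp .
  then have "act ?L x (elt 0 (scalar 1) v) = elt 0 0 v + elt 0 (scalar 1) (act V x v)"
    using act_tensor_elt[OF is_rep_trivial V, of "scalar 1" v x] by simp
  moreover have "elt 0 0 v = 0" by (auto simp: elt_def)
  ultimately show "act ?L x v = act V x v" by (simp add: elt_scalar_left)
qed simp

lemma tensor_rep_unit_right:
  assumes V: "is_rep V"
  shows "tensor_rep V trivial_rep = V" (is "?L = _")
proof (rule repn_eqI)
  have L: "is_rep ?L" using V is_rep_trivial is_rep_tensor by blast
  show sp: "space ?L = space V" by (simp add: tensor_space_scalar_right rep_fd V)
  show "act ?L x \<in> extensional (space ?L)" for x by (rule act_extensional[OF L])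
  show "act V x \<in> extensional (space ?L)" for x unfolding sp by (rule act_extensional[OF V])
  fix x v assume "v \<in> space ?L"
  then have v: "v \<in> space V" unfolding sp .
  then have "act ?L x (elt (deg V) v (scalar 1)) = elt (deg V) (act V x v) (scalar 1) + elt (deg V) v 0"
    using act_tensor_elt[OF V is_rep_trivial, of v "scalar 1" x] by simp
  moreover have "elt (deg V) v 0 = 0" by (auto simp: elt_def)
  ultimately show "act ?L x v = act V x v"
    using elt_scalar_right[OF rep_fd[OF V]] v act_mem[OF V v] by simp
qed simp

lemma gmod_simps [simp]:
  "obj gmod = {V. is_rep V}" "idm gmod V = Arrow V (\<lambda>v\<in>space V. v) V"
  "cmp gmod g f = Arrow (src f) (compose (space (src f)) (fn g) (fn f)) (tgt g)"
  "unit gmod = trivial_rep" "tobj gmod = tensor_rep" "tmor gmod = tensor_arrow"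
  "zer gmod V W = Arrow V (\<lambda>v\<in>space V. 0) W"
  "madd gmod f g = Arrow (src f) (\<lambda>v\<in>space (src f). fn f v + fn g v) (tgt f)"
  "smul gmod c f = Arrow (src f) (\<lambda>v\<in>space (src f). fscale c (fn f v)) (tgt f)"
  by (simp_all add: gmod_def)

lemma hom_gmod: "f \<in> hom gmod V W \<longleftrightarrow> src f = V \<and> tgt f = W \<and> is_intertwiner V W (fn f)"
  by (cases f) (auto simp: gmod_def)

lemma
  assumes "f \<in> hom gmod V W"
  shows hom_src: "src f = V" and hom_tgt: "tgt f = W"
    and fn_mem: "v \<in> space V \<Longrightarrow> fn f v \<in> space W"
    and fn_extensional: "fn f \<in> extensional (space V)"
    and fn_linear: "linear_map_on (space V) (fn f)"
    and fn_act: "v \<in> space V \<Longrightarrow> fn f (act V x v) = act W x (fn f v)"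
  using assms unfolding hom_gmod is_intertwiner_def PiE_def by blast+

lemma hom_gmodI:
  assumes "src f = V" "tgt f = W" "\<And>v. v \<in> space V \<Longrightarrow> fn f v \<in> space W"
    and "fn f \<in> extensional (space V)" "linear_map_on (space V) (fn f)"
    and "\<And>x v. v \<in> space V \<Longrightarrow> fn f (act V x v) = act W x (fn f v)"
  shows "f \<in> hom gmod V W"
  using assms unfolding hom_gmod is_intertwiner_def PiE_def by blast

lemma arrow_eqI:
  assumes f: "f \<in> hom gmod V W" and g: "g \<in> hom gmod V W"
    and eq: "\<And>v. v \<in> space V \<Longrightarrow> fn f v = fn g v"
  shows "f = g"
proof (rule arrow.expand)
  have "fn f = fn g"
    by (rule extensionalityI[OF fn_extensional[OF f] fn_extensional[OF g] eq])
  then show "src f = src g \<and> fn f = fn g \<and> tgt f = tgt g"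
    using f g by (simp add: hom_gmod)
qed

text \<open>
  Most arrows are given by a formula, restricted to the space to become extensional.
\<close>

lemma restricted_in_hom:
  assumes V: "is_rep V" and "linear_map_on (space V) h" "\<And>v. v \<in> space V \<Longrightarrow> h v \<in> space W"
    and "\<And>x v. v \<in> space V \<Longrightarrow> h (act V x v) = act W x (h v)"
  shows "Arrow V (\<lambda>v\<in>space V. h v) W \<in> hom gmod V W"
proof (rule hom_gmodI)
  show "linear_map_on (space V) (fn (Arrow V (\<lambda>v\<in>space V. h v) W))"
    by (rule linear_map_on_cong[OF rep_subspace[OF V] _ assms(2)]) simp
qed (simp_all add: assms act_mem)

lemma id_in_hom: "is_rep V \<Longrightarrow> idm gmod V \<in> hom gmod V V"
  unfolding gmod_simps by (rule restricted_in_hom) (simp_all add: linear_map_on_id)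

lemma cmp_in_hom:
  assumes U: "is_rep U" and g: "g \<in> hom gmod V W" and f: "f \<in> hom gmod U V"
  shows "cmp gmod g f \<in> hom gmod U W"
  unfolding gmod_simps compose_def hom_src[OF f] hom_tgt[OF g]
  by (rule restricted_in_hom[OF U linear_map_on_compose[OF fn_linear[OF f] fn_linear[OF g]]])
    (simp_all add: fn_mem[OF f] fn_mem[OF g] fn_act[OF f] fn_act[OF g])

lemma zer_in_hom:
  assumes V: "is_rep V" and W: "is_rep W"
  shows "zer gmod V W \<in> hom gmod V W"
  unfolding gmod_simps
  by (rule restricted_in_hom[OF V linear_map_on_null])
    (simp_all only: fun_vs.subspace_0[OF rep_subspace[OF W]] linear_map_on_zero[OF act_linear[OF W]])

lemma madd_in_hom:
  assumes V: "is_rep V" and W: "is_rep W" and f: "f \<in> hom gmod V W" and g: "g \<in> hom gmod V W"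
  shows "madd gmod f g \<in> hom gmod V W"
  unfolding gmod_simps hom_src[OF f] hom_tgt[OF f]
  by (rule restricted_in_hom[OF V linear_map_on_plus[OF fn_linear[OF f] fn_linear[OF g]]])
    (simp_all only: fun_vs.subspace_add[OF rep_subspace[OF W]] fn_mem[OF f] fn_mem[OF g]
      fn_act[OF f] fn_act[OF g] linear_map_on_add[OF act_linear[OF W]])

lemma smul_in_hom:
  assumes V: "is_rep V" and W: "is_rep W" and f: "f \<in> hom gmod V W"
  shows "smul gmod c f \<in> hom gmod V W"
  unfolding gmod_simps hom_src[OF f] hom_tgt[OF f]
  by (rule restricted_in_hom[OF V linear_map_on_fscale[OF fn_linear[OF f]]])
    (simp_all only: fun_vs.subspace_scale[OF rep_subspace[OF W]] fn_mem[OF f]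
      fn_act[OF f] linear_map_on_scale[OF act_linear[OF W]])

lemma fn_id: "v \<in> space V \<Longrightarrow> fn (idm gmod V) v = v"
  by simp

lemma fn_cmp: "f \<in> hom gmod U V \<Longrightarrow> v \<in> space U \<Longrightarrow> fn (cmp gmod g f) v = fn g (fn f v)"
  by (simp add: hom_src compose_def)

lemma fn_madd: "f \<in> hom gmod U V \<Longrightarrow> v \<in> space U \<Longrightarrow> fn (madd gmod f g) v = fn f v + fn g v"
  by (simp add: hom_src)

lemma fn_smul: "f \<in> hom gmod U V \<Longrightarrow> v \<in> space U \<Longrightarrow> fn (smul gmod c f) v = fscale c (fn f v)"
  by (simp add: hom_src)

lemma fn_zer: "v \<in> space U \<Longrightarrow> fn (zer gmod U V) v = 0"
  by simp

text \<open>
  The tensor product of two arrows is equivariant because this can be tested on elementary tensors, where it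
  is the Leibniz rule on both sides.
\<close>

lemma
  assumes V: "is_rep V" and W: "is_rep W" and V': "is_rep V'" and W': "is_rep W'"
    and f: "f \<in> hom gmod V V'" and g: "g \<in> hom gmod W W'"
  shows tmor_in_hom: "tmor gmod f g \<in> hom gmod (tensor_rep V W) (tensor_rep V' W')"
    and fn_tmor: "v \<in> space V \<Longrightarrow> w \<in> space W \<Longrightarrow>
      fn (tmor gmod f g) (elt (deg V) v w) = elt (deg V') (fn f v) (fn g w)"
proof -
  let ?T = "tensor_space (deg V) (space V) (space W)"
  let ?b = "\<lambda>v w. elt (deg V') (fn f v) (fn g w)"
  have "linear_map_on (space V) (\<lambda>v. ?b v w)" for w
    using fn_linear[OF f] by (simp add: linear_map_on_def elt_add_left elt_scale_left)
  moreover have "linear_map_on (space W) (\<lambda>w. ?b v w)" for v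
    using fn_linear[OF g] by (simp add: linear_map_on_def elt_add_right elt_scale_right)
  ultimately have bil: "bilinear_on (space V) (space W) ?b" unfolding bilinear_on_def by blast
  note lift = rep_fd[OF V] rep_fd[OF W] bil
  have fn: "fn (tmor gmod f g) = tensor_lift (deg V) (space V) (space W) ?b"
    by (simp add: tensor_arrow_def hom_src[OF f] hom_src[OF g] hom_tgt[OF f])
  show elt: "fn (tmor gmod f g) (elt (deg V) v w) = ?b v w" if "v \<in> space V" "w \<in> space W" for v w
    unfolding fn by (rule tensor_lift_elt[OF lift that])
  have lin: "linear_map_on ?T (fn (tmor gmod f g))" unfolding fn by (rule tensor_lift_linear[OF lift])
  have mem: "fn (tmor gmod f g) t \<in> space (tensor_rep V' W')" if "t \<in> ?T" for t
    unfolding tensor_rep_simps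
    by (rule tensor_map_mem[OF lin subspace_tensor _ that])
      (simp only: elt elt_mem fn_mem[OF f] fn_mem[OF g])
  have VW: "is_rep (tensor_rep V W)" and VW': "is_rep (tensor_rep V' W')"
    using V W V' W' is_rep_tensor by blast+
  have memT: "act (tensor_rep V W) x t \<in> ?T" if "t \<in> ?T" for t x
    using act_mem[OF VW, of t x] that by simp
  show "tmor gmod f g \<in> hom gmod (tensor_rep V W) (tensor_rep V' W')"
  proof (rule hom_gmodI)
    show "fn (tmor gmod f g) \<in> extensional (space (tensor_rep V W))"
      unfolding fn tensor_rep_simps by (rule tensor_lift_extensional[OF lift])
    fix x t assume "t \<in> space (tensor_rep V W)"
    then have t: "t \<in> ?T" by simp
    show "fn (tmor gmod f g) (act (tensor_rep V W) x t) = act (tensor_rep V' W') x (fn (tmor gmod f g) t)"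
    proof (rule tensor_map_eqI[OF _ _ _ t])
      show "linear_map_on ?T (\<lambda>t. fn (tmor gmod f g) (act (tensor_rep V W) x t))"
        by (rule linear_map_on_compose[OF act_tensor_linear[OF V W] lin memT])
      show "linear_map_on ?T (\<lambda>t. act (tensor_rep V' W') x (fn (tmor gmod f g) t))"
        by (rule linear_map_on_compose[OF lin act_linear[OF VW'] mem])
      fix v w assume vw: "v \<in> space V" "w \<in> space W"
      have "fn (tmor gmod f g) (act (tensor_rep V W) x (elt (deg V) v w)) =
        ?b (act V x v) w + ?b v (act W x w)"
        using vw by (simp only: act_tensor_elt[OF V W] linear_map_on_add[OF lin] elt_mem act_mem V W elt)
      also have "\<dots> = act (tensor_rep V' W') x (?b v w)"
        using vw by (simp only: act_tensor_elt[OF V' W'] fn_mem[OF f] fn_mem[OF g] fn_act[OF f] fn_act[OF g])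
      finally show "fn (tmor gmod f g) (act (tensor_rep V W) x (elt (deg V) v w)) =
        act (tensor_rep V' W') x (fn (tmor gmod f g) (elt (deg V) v w))"
        using vw by (simp only: elt)
    qed
  qed (use lin mem in \<open>simp_all add: tensor_arrow_def hom_src[OF f] hom_src[OF g] hom_tgt[OF f] hom_tgt[OF g]\<close>)
qed

lemma gmod_linear_category: "linear_category gmod"
proof (unfold_locales, unfold gmod_simps(1) mem_Collect_eq)
  fix V W V' W' :: "('g, 'x) repn" and f
  assume "f \<in> hom gmod V W" "f \<in> hom gmod V' W'"
  then show "V = V' \<and> W = W'" by (simp add: hom_gmod)
next
  fix V W :: "('g, 'x) repn" and f assume V: "is_rep V" and W: "is_rep W" and f: "f \<in> hom gmod V W"
  note h = fn_mem[OF f] cmp_in_hom[OF V id_in_hom[OF W] f] cmp_in_hom[OF V f id_in_hom[OF V]]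
    fn_cmp[OF f] fn_cmp[OF id_in_hom[OF V]] fn_id
  show "cmp gmod (idm gmod W) f = f"
    by (rule arrow_eqI[OF h(2) f]) (simp only: h)
  show "cmp gmod f (idm gmod V) = f"
    by (rule arrow_eqI[OF h(3) f]) (simp only: h)
  show "madd gmod f (zer gmod V W) = f"
    by (rule arrow_eqI[OF madd_in_hom[OF V W f zer_in_hom[OF V W]] f])
      (simp only: fn_madd[OF f] fn_zer add_0_right)
  have neg: "fscale (-1) v = - v" for v :: "'x tup" by (simp add: fscale_def fun_eq_iff)
  show "madd gmod f (smul gmod (-1) f) = zer gmod V W"
    by (rule arrow_eqI[OF madd_in_hom[OF V W f smul_in_hom[OF V W f]] zer_in_hom[OF V W]])
      (simp only: fn_madd[OF f] fn_smul[OF f] fn_zer neg right_minus)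
  fix r t :: complex
  note sr = smul_in_hom[OF V W f, of r] and st = smul_in_hom[OF V W f, of t]
  show "smul gmod (r + t) f = madd gmod (smul gmod r f) (smul gmod t f)"
    by (rule arrow_eqI[OF smul_in_hom[OF V W f] madd_in_hom[OF V W sr st]])
      (simp only: fn_smul[OF f] fn_madd[OF sr] fun_vs.scale_left_distrib)
  show "smul gmod r (smul gmod t f) = smul gmod (r * t) f"
    by (rule arrow_eqI[OF smul_in_hom[OF V W st] smul_in_hom[OF V W f]])
      (simp only: fn_smul[OF f] fn_smul[OF st] fun_vs.scale_scale)
  show "smul gmod 1 f = f"
    by (rule arrow_eqI[OF smul_in_hom[OF V W f] f]) (simp only: fn_smul[OF f] fun_vs.scale_one)
next
  fix V W :: "('g, 'x) repn" and f g :: "('g, 'x) arrow" and r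
  assume V: "is_rep V" and W: "is_rep W" and f: "f \<in> hom gmod V W" and g: "g \<in> hom gmod V W"
  show "madd gmod f g = madd gmod g f"
    by (rule arrow_eqI[OF madd_in_hom[OF V W f g] madd_in_hom[OF V W g f]])
      (simp only: fn_madd[OF f] fn_madd[OF g] add.commute)
  show "smul gmod r (madd gmod f g) = madd gmod (smul gmod r f) (smul gmod r g)"
    by (rule arrow_eqI[OF smul_in_hom[OF V W madd_in_hom[OF V W f g]]
          madd_in_hom[OF V W smul_in_hom[OF V W f] smul_in_hom[OF V W g]]])
      (simp only: fn_madd[OF f] fn_madd[OF smul_in_hom[OF V W f]] fn_smul[OF f] fn_smul[OF g]
        fn_smul[OF madd_in_hom[OF V W f g]] fun_vs.scale_right_distrib)
  fix h assume h: "h \<in> hom gmod V W"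
  note fg = madd_in_hom[OF V W f g] and gh = madd_in_hom[OF V W g h]
  show "madd gmod (madd gmod f g) h = madd gmod f (madd gmod g h)"
    by (rule arrow_eqI[OF madd_in_hom[OF V W fg h] madd_in_hom[OF V W f gh]])
      (simp only: fn_madd[OF f] fn_madd[OF g] fn_madd[OF fg] add.assoc)
next
  fix U V W :: "('g, 'x) repn" and f f' g g' :: "('g, 'x) arrow" and r
  assume U: "is_rep U" and V: "is_rep V" and W: "is_rep W" and f: "f \<in> hom gmod U V"
    and g: "g \<in> hom gmod V W"
  show "cmp gmod (smul gmod r g) f = smul gmod r (cmp gmod g f)"
    by (rule arrow_eqI[OF cmp_in_hom[OF U smul_in_hom[OF V W g] f] smul_in_hom[OF U W cmp_in_hom[OF U g f]]])
      (simp only: fn_cmp[OF f] fn_smul[OF g] fn_smul[OF cmp_in_hom[OF U g f]] fn_mem[OF f])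
  show "cmp gmod g (smul gmod r f) = smul gmod r (cmp gmod g f)"
    by (rule arrow_eqI[OF cmp_in_hom[OF U g smul_in_hom[OF U V f]] smul_in_hom[OF U W cmp_in_hom[OF U g f]]])
      (simp only: fn_cmp[OF f] fn_cmp[OF smul_in_hom[OF U V f]] fn_smul[OF f]
        fn_smul[OF cmp_in_hom[OF U g f]] fn_mem[OF f] linear_map_on_scale[OF fn_linear[OF g]])
  {
    assume g': "g' \<in> hom gmod V W"
    show "cmp gmod (madd gmod g g') f = madd gmod (cmp gmod g f) (cmp gmod g' f)"
      by (rule arrow_eqI[OF cmp_in_hom[OF U madd_in_hom[OF V W g g'] f]
            madd_in_hom[OF U W cmp_in_hom[OF U g f] cmp_in_hom[OF U g' f]]])
        (simp only: fn_cmp[OF f] fn_madd[OF g] fn_madd[OF cmp_in_hom[OF U g f]] fn_mem[OF f])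
  next
    assume f': "f' \<in> hom gmod U V"
    show "cmp gmod g (madd gmod f f') = madd gmod (cmp gmod g f) (cmp gmod g f')"
      by (rule arrow_eqI[OF cmp_in_hom[OF U g madd_in_hom[OF U V f f']]
            madd_in_hom[OF U W cmp_in_hom[OF U g f] cmp_in_hom[OF U g f']]])
        (simp only: fn_cmp[OF f] fn_cmp[OF f'] fn_cmp[OF madd_in_hom[OF U V f f']] fn_madd[OF f]
          fn_madd[OF cmp_in_hom[OF U g f]] fn_mem[OF f] fn_mem[OF f'] linear_map_on_add[OF fn_linear[OF g]])
  }
next
  fix U V W Z :: "('g, 'x) repn" and h g f
  assume U: "is_rep U" and V: "is_rep V" and h: "h \<in> hom gmod W Z" and g: "g \<in> hom gmod V W"
    and f: "f \<in> hom gmod U V"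
  note hg = cmp_in_hom[OF V h g] and gf = cmp_in_hom[OF U g f]
  show "cmp gmod (cmp gmod h g) f = cmp gmod h (cmp gmod g f)"
    by (rule arrow_eqI[OF cmp_in_hom[OF U hg f] cmp_in_hom[OF U h gf]])
      (simp only: fn_cmp[OF f] fn_cmp[OF g] fn_cmp[OF gf] fn_mem[OF f])
qed (rule id_in_hom cmp_in_hom zer_in_hom madd_in_hom smul_in_hom; assumption)+

lemma mor_gmodE:
  assumes "f \<in> mor gmod"
  obtains V W where "is_rep V" "is_rep W" "f \<in> hom gmod V W"
  using assms unfolding mor_def by auto

lemma tensor_arrow_eqI:
  assumes f: "f \<in> hom gmod (tensor_rep U V) W" and g: "g \<in> hom gmod (tensor_rep U V) W"
    and eq: "\<And>u v. u \<in> space U \<Longrightarrow> v \<in> space V \<Longrightarrow> fn f (elt (deg U) u v) = fn g (elt (deg U) u v)"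
  shows "f = g"
proof (rule arrow_eqI[OF f g])
  fix t assume t: "t \<in> space (tensor_rep U V)"
  show "fn f t = fn g t"
    by (rule tensor_map_eqI[OF fn_linear[OF f, unfolded tensor_rep_simps]
        fn_linear[OF g, unfolded tensor_rep_simps] eq t[unfolded tensor_rep_simps]])
qed

lemma tensor3_arrow_eqI:
  assumes f: "f \<in> hom gmod (tensor_rep U (tensor_rep V W)) Z"
    and g: "g \<in> hom gmod (tensor_rep U (tensor_rep V W)) Z"
    and eq: "\<And>u v w. u \<in> space U \<Longrightarrow> v \<in> space V \<Longrightarrow> w \<in> space W \<Longrightarrow>
      fn f (elt (deg U) u (elt (deg V) v w)) = fn g (elt (deg U) u (elt (deg V) v w))"
  shows "f = g"
proof (rule arrow_eqI[OF f g])
  fix t assume t: "t \<in> space (tensor_rep U (tensor_rep V W))"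
  show "fn f t = fn g t"
    by (rule tensor3_map_eqI[OF fn_linear[OF f, unfolded tensor_rep_simps]
        fn_linear[OF g, unfolded tensor_rep_simps] eq t[unfolded tensor_rep_simps]])
qed

text \<open>
  All axioms reduce to elementary tensors; the unit laws use that \<open>v\<close> itself is the elementary tensor of
  \<open>v\<close> with the scalar \<open>1\<close>.
\<close>

theorem gmod_strict_monoidal: "strict_linear_monoidal_category gmod"
proof (intro strict_linear_monoidal_category.intro gmod_linear_category
    strict_linear_monoidal_category_axioms.intro, unfold gmod_simps(1,4,5) mem_Collect_eq)
  show "is_rep trivial_rep" by (rule is_rep_trivial)
next
  fix f assume "f \<in> mor gmod"
  then obtain V W where V: "is_rep V" and W: "is_rep W" and f: "f \<in> hom gmod V W" by (rule mor_gmodE)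
  have id1: "idm gmod trivial_rep \<in> hom gmod trivial_rep trivial_rep" by (rule id_in_hom[OF is_rep_trivial])
  show "tmor gmod (idm gmod trivial_rep) f = f"
  proof (rule arrow_eqI[OF _ f])
    show "tmor gmod (idm gmod trivial_rep) f \<in> hom gmod V W"
      using tmor_in_hom[OF is_rep_trivial V is_rep_trivial W id1 f]
      by (simp only: tensor_rep_unit_left V W)
    fix v assume v: "v \<in> space V"
    have 1: "scalar 1 \<in> space trivial_rep" by simp
    show "fn (tmor gmod (idm gmod trivial_rep) f) v = fn f v"
      using fn_tmor[OF is_rep_trivial V is_rep_trivial W id1 f 1 v]
      by (simp only: fn_id 1 trivial_rep_simps(1) elt_scalar_left fun_vs.scale_one)
  qed
  show "tmor gmod f (idm gmod trivial_rep) = f"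
  proof (rule arrow_eqI[OF _ f])
    show "tmor gmod f (idm gmod trivial_rep) \<in> hom gmod V W"
      using tmor_in_hom[OF V is_rep_trivial W is_rep_trivial f id1]
      by (simp only: tensor_rep_unit_right V W)
    fix v assume v: "v \<in> space V"
    have 1: "scalar 1 \<in> space trivial_rep" by simp
    show "fn (tmor gmod f (idm gmod trivial_rep)) v = fn f v"
      using fn_tmor[OF V is_rep_trivial W is_rep_trivial f id1 v 1]
      by (simp only: fn_id 1 elt_scalar_right[OF rep_fd[OF V] v]
          elt_scalar_right[OF rep_fd[OF W] fn_mem[OF f v]] fun_vs.scale_one)
  qed
next
  fix V W :: "('g, 'x) repn" assume V: "is_rep V" and W: "is_rep W"
  show "tmor gmod (idm gmod V) (idm gmod W) = idm gmod (tensor_rep V W)"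
    by (rule tensor_arrow_eqI[OF tmor_in_hom[OF V W V W id_in_hom[OF V] id_in_hom[OF W]]
          id_in_hom[OF is_rep_tensor[OF V W]]])
      (simp only: fn_tmor[OF V W V W id_in_hom[OF V] id_in_hom[OF W]] fn_id tensor_rep_simps elt_mem)
next
  fix f g h :: "('g, 'x) arrow" assume "f \<in> mor gmod" "g \<in> mor gmod" "h \<in> mor gmod"
  then obtain U U' V V' W W' where U: "is_rep U" "is_rep U'" and V: "is_rep V" "is_rep V'"
    and W: "is_rep W" "is_rep W'" and f: "f \<in> hom gmod U U'" and g: "g \<in> hom gmod V V'"
    and h: "h \<in> hom gmod W W'"
    by (elim mor_gmodE)
  note fg = tmor_in_hom[OF U(1) V(1) U(2) V(2) f g] and gh = tmor_in_hom[OF V(1) W(1) V(2) W(2) g h]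
  note UV = is_rep_tensor[OF U(1) V(1)] is_rep_tensor[OF U(2) V(2)]
  note VW = is_rep_tensor[OF V(1) W(1)] is_rep_tensor[OF V(2) W(2)]
  show "tmor gmod (tmor gmod f g) h = tmor gmod f (tmor gmod g h)"
  proof (rule tensor3_arrow_eqI)
    show "tmor gmod (tmor gmod f g) h \<in> hom gmod (tensor_rep U (tensor_rep V W)) (tensor_rep U' (tensor_rep V' W'))"
      using tmor_in_hom[OF UV(1) W(1) UV(2) W(2) fg h] U V W by (simp only: tensor_rep_assoc)
    show "tmor gmod f (tmor gmod g h) \<in> hom gmod (tensor_rep U (tensor_rep V W)) (tensor_rep U' (tensor_rep V' W'))"
      by (rule tmor_in_hom[OF U(1) VW(1) U(2) VW(2) f gh])
    fix u v w assume u: "u \<in> space U" and v: "v \<in> space V" and w: "w \<in> space W"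
    have uv: "elt (deg U) u v \<in> space (tensor_rep U V)" and vw: "elt (deg V) v w \<in> space (tensor_rep V W)"
      using u v w by (simp_all add: elt_mem)
    have "fn (tmor gmod (tmor gmod f g) h) (elt (deg U) u (elt (deg V) v w)) =
        elt (deg U' + deg V') (elt (deg U') (fn f u) (fn g v)) (fn h w)"
      using fn_tmor[OF UV(1) W(1) UV(2) W(2) fg h uv w]
      by (simp only: tensor_rep_simps elt_assoc fn_tmor[OF U(1) V(1) U(2) V(2) f g u v])
    also have "\<dots> = fn (tmor gmod f (tmor gmod g h)) (elt (deg U) u (elt (deg V) v w))"
      by (simp only: elt_assoc fn_tmor[OF U(1) VW(1) U(2) VW(2) f gh u vw]
          fn_tmor[OF V(1) W(1) V(2) W(2) g h v w])
    finally show "fn (tmor gmod (tmor gmod f g) h) (elt (deg U) u (elt (deg V) v w)) =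
      fn (tmor gmod f (tmor gmod g h)) (elt (deg U) u (elt (deg V) v w))" .
  qed
next
  fix U V W U' V' W' :: "('g, 'x) repn" and f g f' g'
  assume U: "is_rep U" "is_rep U'" and V: "is_rep V" "is_rep V'" and W: "is_rep W" "is_rep W'"
    and f: "f \<in> hom gmod U V" and g: "g \<in> hom gmod V W"
    and f': "f' \<in> hom gmod U' V'" and g': "g' \<in> hom gmod V' W'"
  note ff = tmor_in_hom[OF U V f f'] and gg = tmor_in_hom[OF V W g g']
  note gf = cmp_in_hom[OF U(1) g f] and gf' = cmp_in_hom[OF U(2) g' f']
  note UU = is_rep_tensor[OF U]
  show "cmp gmod (tmor gmod g g') (tmor gmod f f') = tmor gmod (cmp gmod g f) (cmp gmod g' f')"
    by (rule tensor_arrow_eqI[OF cmp_in_hom[OF UU gg ff] tmor_in_hom[OF U W gf gf']])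
      (simp only: fn_cmp[OF ff] tensor_rep_simps elt_mem fn_tmor[OF U V f f'] fn_tmor[OF V W g g']
        fn_mem[OF f] fn_mem[OF f'] fn_tmor[OF U W gf gf'] fn_cmp[OF f] fn_cmp[OF f'])
next
  fix V W :: "('g, 'x) repn" and f f' g :: "('g, 'x) arrow"
  assume V: "is_rep V" "is_rep W" and f: "f \<in> hom gmod V W" and f': "f' \<in> hom gmod V W"
    and "g \<in> mor gmod"
  then obtain V' W' where W: "is_rep V'" "is_rep W'" and g: "g \<in> hom gmod V' W'" by (elim mor_gmodE)
  note VV = is_rep_tensor[OF V(1) W(1)] is_rep_tensor[OF V(2) W(2)]
  note h = V(1) W(1) V(2) W(2)
  note fg = tmor_in_hom[OF h f g] tmor_in_hom[OF h f' g]
  note val = fn_tmor[OF h f g] fn_tmor[OF h f' g] fn_tmor[OF h madd_in_hom[OF V f f'] g]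
  show "tmor gmod (madd gmod f f') g = madd gmod (tmor gmod f g) (tmor gmod f' g)"
    by (rule tensor_arrow_eqI[OF tmor_in_hom[OF h madd_in_hom[OF V f f'] g] madd_in_hom[OF VV fg]])
      (simp only: val fn_madd[OF fg(1)] tensor_rep_simps elt_mem fn_madd[OF f] elt_add_left)
next
  fix V W :: "('g, 'x) repn" and f f' g :: "('g, 'x) arrow"
  assume V: "is_rep V" "is_rep W" and f: "f \<in> hom gmod V W" and f': "f' \<in> hom gmod V W"
    and "g \<in> mor gmod"
  then obtain V' W' where W: "is_rep V'" "is_rep W'" and g: "g \<in> hom gmod V' W'" by (elim mor_gmodE)
  note VV = is_rep_tensor[OF W(1) V(1)] is_rep_tensor[OF W(2) V(2)]
  note h = W(1) V(1) W(2) V(2)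
  note fg = tmor_in_hom[OF h g f] tmor_in_hom[OF h g f']
  note val = fn_tmor[OF h g f] fn_tmor[OF h g f'] fn_tmor[OF h g madd_in_hom[OF V f f']]
  show "tmor gmod g (madd gmod f f') = madd gmod (tmor gmod g f) (tmor gmod g f')"
    by (rule tensor_arrow_eqI[OF tmor_in_hom[OF h g madd_in_hom[OF V f f']] madd_in_hom[OF VV fg]])
      (simp only: val fn_madd[OF fg(1)] tensor_rep_simps elt_mem fn_madd[OF f] elt_add_right)
next
  fix f g :: "('g, 'x) arrow" and r assume "f \<in> mor gmod" "g \<in> mor gmod"
  then obtain U U' V V' where U: "is_rep U" "is_rep U'" and V: "is_rep V" "is_rep V'"
    and f: "f \<in> hom gmod U U'" and g: "g \<in> hom gmod V V'"
    by (elim mor_gmodE)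
  note h = U(1) V(1) U(2) V(2)
  note UV = is_rep_tensor[OF U(1) V(1)] is_rep_tensor[OF U(2) V(2)]
  note fg = tmor_in_hom[OF h f g]
  show "tmor gmod (smul gmod r f) g = smul gmod r (tmor gmod f g)"
    by (rule tensor_arrow_eqI[OF tmor_in_hom[OF h smul_in_hom[OF U f] g] smul_in_hom[OF UV fg]])
      (simp only: fn_tmor[OF h f g] fn_tmor[OF h smul_in_hom[OF U f] g] fn_smul[OF fg]
        tensor_rep_simps elt_mem fn_smul[OF f] elt_scale_left)
  show "tmor gmod f (smul gmod r g) = smul gmod r (tmor gmod f g)"
    by (rule tensor_arrow_eqI[OF tmor_in_hom[OF h f smul_in_hom[OF V g]] smul_in_hom[OF UV fg]])
      (simp only: fn_tmor[OF h f g] fn_tmor[OF h f smul_in_hom[OF V g]] fn_smul[OF fg]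
        tensor_rep_simps elt_mem fn_smul[OF g] elt_scale_right)
qed (rule is_rep_tensor tensor_rep_assoc tensor_rep_unit_left tensor_rep_unit_right tmor_in_hom; assumption)+

end

section \<open>The Killing form and dual bases\<close>

locale fd_lie_algebra = lie_algebra scale bracket
  for scale :: "complex \<Rightarrow> 'g::ab_group_add \<Rightarrow> 'g" and bracket :: "'g \<Rightarrow> 'g \<Rightarrow> 'g" +
  assumes fin_dim: "\<exists>A. finite A \<and> span A = UNIV"
begin

lemma basis_finite: "is_basis B \<Longrightarrow> finite B"
  using fin_dim independent_span_bound unfolding is_basis_def by (metis subset_UNIV)

lemma ex_basis: "\<exists>B. is_basis B"
proof -
  obtain B where "independent B" "UNIV \<subseteq> span B"
    by (rule maximal_independent_subset[of UNIV])
  then show ?thesis unfolding is_basis_def by blast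
qed

lemma basis_expand:
  assumes "is_basis B"
  shows "(\<Sum>b\<in>B. scale (representation B v b) b) = v"
  using assms basis_finite by (intro sum_representation_eq) (auto simp: is_basis_def)

lemma representation_linear:
  assumes "is_basis B"
  shows "Vector_Spaces.linear scale (*) (\<lambda>v. representation B v b)"
  using assms
  by unfold_locales (auto simp: is_basis_def representation_add representation_scale algebra_simps)

lemma linear_expand:
  assumes "is_basis B" "Vector_Spaces.linear scale t f"
  shows "f v = (\<Sum>b\<in>B. t (representation B v b) (f b))"
proof -
  interpret f: Vector_Spaces.linear scale t f by fact
  have "f v = f (\<Sum>b\<in>B. scale (representation B v b) b)" by (simp only: basis_expand[OF assms(1)])
  also have "\<dots> = (\<Sum>b\<in>B. t (representation B v b) (f b))" by (simp only: f.sum f.scale)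
  finally show ?thesis .
qed

lemma linear_representation_compose:
  assumes "is_basis B" "Vector_Spaces.linear scale scale f"
  shows "Vector_Spaces.linear scale (*) (\<lambda>v. representation B (f v) b)"
  using Vector_Spaces.linear_compose[OF assms(2) representation_linear[OF assms(1), of b]]
  by (simp only: o_def)

text \<open>
  The identity \<open>tr (f g) = tr (g f)\<close> with each side computed in its own basis.  Taking \<open>g\<close> to be the identity
  gives independence of the basis, and taking both bases equal gives commutativity of the trace.
\<close>

lemma trace_compose_swap:
  assumes B: "is_basis B" and C: "is_basis C"
    and f: "Vector_Spaces.linear scale scale f" and g: "Vector_Spaces.linear scale scale g"
  shows "(\<Sum>b\<in>B. representation B (f (g b)) b) = (\<Sum>c\<in>C. representation C (g (f c)) c)"
proof -
  have "(\<Sum>b\<in>B. representation B (f (g b)) b) =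
      (\<Sum>b\<in>B. \<Sum>c\<in>C. representation C (g b) c * representation B (f c) b)"
    by (rule sum.cong[OF HOL.refl], rule linear_expand[OF C linear_representation_compose[OF B f]])
  also have "\<dots> = (\<Sum>c\<in>C. \<Sum>b\<in>B. representation B (f c) b * representation C (g b) c)"
    by (subst sum.swap) (simp only: mult.commute)
  also have "\<dots> = (\<Sum>c\<in>C. representation C (g (f c)) c)"
    by (rule sum.cong[OF HOL.refl], rule linear_expand[OF B linear_representation_compose[OF C g], symmetric])
  finally show ?thesis .
qed

lemma trace_basis:
  assumes B: "is_basis B" and f: "Vector_Spaces.linear scale scale f"
  shows "trace f = (\<Sum>b\<in>B. representation B (f b) b)"
proof -
  have id: "Vector_Spaces.linear scale scale (\<lambda>v. v)" by (rule linear_ident)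
  have "is_basis (SOME B. is_basis B)" using ex_basis by (rule someI_ex)
  from trace_compose_swap[OF this B f id] show ?thesis unfolding trace_def Let_def .
qed

lemma trace_commute:
  assumes "Vector_Spaces.linear scale scale f" "Vector_Spaces.linear scale scale g"
  shows "trace (\<lambda>z. f (g z)) = trace (\<lambda>z. g (f z))"
proof -
  obtain B where B: "is_basis B" using ex_basis by blast
  note compose = Vector_Spaces.linear_compose[unfolded o_def]
  show ?thesis
    unfolding trace_basis[OF B compose[OF assms]] trace_basis[OF B compose[OF assms(2,1)]]
    by (rule trace_compose_swap[OF B B assms])
qed

lemma trace_add:
  assumes "Vector_Spaces.linear scale scale f" "Vector_Spaces.linear scale scale g"
  shows "trace (\<lambda>z. f z + g z) = trace f + trace g"
proof -
  obtain B where B: "is_basis B" using ex_basis by blast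
  have "Vector_Spaces.linear scale scale (\<lambda>z. f z + g z)"
  proof -
    interpret f: Vector_Spaces.linear scale scale f by fact
    interpret g: Vector_Spaces.linear scale scale g by fact
    show ?thesis
      by unfold_locales (simp_all add: f.add g.add f.scale g.scale scale_right_distrib add_ac)
  qed
  then show ?thesis using assms B by (simp add: trace_basis[OF B] representation_add is_basis_def sum.distrib)
qed

lemma linear_scaled:
  assumes "Vector_Spaces.linear scale scale f"
  shows "Vector_Spaces.linear scale scale (\<lambda>z. scale c (f z))"
proof -
  interpret f: Vector_Spaces.linear scale scale f by fact
  show ?thesis
    by unfold_locales (simp_all add: f.add f.scale scale_right_distrib mult.commute)
qed

lemma trace_scale:
  assumes "Vector_Spaces.linear scale scale f"
  shows "trace (\<lambda>z. scale c (f z)) = c * trace f"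
proof -
  obtain B where B: "is_basis B" using ex_basis by blast
  have "Vector_Spaces.linear scale scale (\<lambda>z. scale c (f z))"
    using assms by (rule linear_scaled)
  then show ?thesis using assms B
    by (simp add: trace_basis[OF B] representation_scale is_basis_def sum_distrib_left)
qed

lemma linear_bracket: "Vector_Spaces.linear scale scale (bracket x)"
  by unfold_locales (simp_all add: bracket_add_right bracket_scale_right)

lemma linear_bracket2: "Vector_Spaces.linear scale scale (\<lambda>z. bracket x (bracket y z))"
  by unfold_locales (simp_all add: bracket_add_right bracket_scale_right)

lemma linear_bracket3: "Vector_Spaces.linear scale scale (\<lambda>z. bracket x (bracket y (bracket w z)))"
  by unfold_locales (simp_all add: bracket_add_right bracket_scale_right)

lemma bracket_diff_right: "bracket x (y - z) = bracket x y - bracket x z"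
proof -
  interpret l: Vector_Spaces.linear scale scale "bracket x" by (rule linear_bracket)
  show ?thesis by (rule l.diff)
qed

lemma bracket_skew: "bracket x y = - bracket y x"
proof -
  have "bracket x y + bracket y x = bracket (x + y) (x + y)"
    unfolding bracket_add_left bracket_add_right by (simp add: bracket_self)
  then have "bracket x y + bracket y x = 0" by (simp only: bracket_self)
  then show ?thesis by (simp add: eq_neg_iff_add_eq_0)
qed

lemma bracket_bracket: "bracket (bracket x y) z = bracket x (bracket y z) - bracket y (bracket x z)"
proof -
  have "bracket y (bracket z x) = - bracket y (bracket x z)"
    using bracket_diff_right[of y 0 "bracket x z"] bracket_diff_right[of y 0 0]
    by (simp add: bracket_skew[of z x])
  moreover have "bracket x (bracket y z) + bracket y (bracket z x) = - bracket z (bracket x y)"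
    using jacobi[of x y z] by (simp only: eq_neg_iff_add_eq_0)
  moreover have "- bracket z (bracket x y) = bracket (bracket x y) z"
    by (rule bracket_skew[symmetric])
  ultimately show ?thesis by simp
qed

lemma killing_linear: "Vector_Spaces.linear scale (*) (killing x)"
proof -
  have "killing x (y + z) = killing x y + killing x z" for y z
    unfolding killing_def using trace_add[OF linear_bracket2[of x y] linear_bracket2[of x z]]
    by (simp only: bracket_add_left bracket_add_right)
  moreover have "killing x (scale c y) = c * killing x y" for c y
    unfolding killing_def using trace_scale[OF linear_bracket2[of x y], of c]
    by (simp only: bracket_scale_left bracket_scale_right)
  ultimately show ?thesis by unfold_locales (auto simp: algebra_simps)
qed

lemma killing_sym: "killing x y = killing y x"
  unfolding killing_def by (rule trace_commute[OF linear_bracket linear_bracket])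

text \<open>
  Expanding \<open>ad [x, y]\<close> and \<open>ad [y, z]\<close> as commutators, the two sides differ only by the cyclic rotation of
  \<open>ad y (ad x ad z)\<close> under the trace.
\<close>

lemma killing_invariant: "killing (bracket x y) z = killing x (bracket y z)"
proof -
  note L = linear_bracket3
  have neg: "Vector_Spaces.linear scale scale (\<lambda>w. scale (-1) (bracket x (bracket y (bracket z w))))" for x y z
    by (rule linear_scaled[OF L])
  have 1: "bracket (bracket x y) (bracket z w) =
      bracket x (bracket y (bracket z w)) + scale (-1) (bracket y (bracket x (bracket z w)))" for w
    by (simp add: bracket_bracket)
  have 2: "bracket x (bracket (bracket y z) w) =
      bracket x (bracket y (bracket z w)) + scale (-1) (bracket x (bracket z (bracket y w)))" for w
    by (simp add: bracket_bracket bracket_diff_right)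
  have "trace (\<lambda>w. bracket y (bracket x (bracket z w))) = trace (\<lambda>w. bracket x (bracket z (bracket y w)))"
    by (rule trace_commute[OF linear_bracket linear_bracket2])
  then show ?thesis
    unfolding killing_def 1 2 trace_add[OF L neg] trace_scale[OF L] by simp
qed

end

text \<open>
  The existence of a dual family forces the Killing form to be nondegenerate.
\<close>

locale killing_dual_basis = fd_lie_algebra scale bracket
  for scale :: "complex \<Rightarrow> 'g::ab_group_add \<Rightarrow> 'g" and bracket :: "'g \<Rightarrow> 'g \<Rightarrow> 'g" +
  fixes B :: "'g set" and dual :: "'g \<Rightarrow> 'g"
  assumes basis: "is_basis B"
    and dual: "a \<in> B \<Longrightarrow> b \<in> B \<Longrightarrow> killing (dual a) b = (if a = b then 1 else 0)"
begin

lemma finite_B: "finite B"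
  by (rule basis_finite[OF basis])

lemma card_B: "of_nat (card B) = dimension"
proof -
  have "dim UNIV = card B" using basis dim_eq_card[of B UNIV] by (auto simp: is_basis_def)
  then show ?thesis by (simp add: dimension_def)
qed

lemma representation_eq_killing:
  assumes b: "b \<in> B"
  shows "representation B x b = killing (dual b) x"
proof -
  have "killing (dual b) x = (\<Sum>c\<in>B. representation B x c * killing (dual b) c)"
    by (rule linear_expand[OF basis killing_linear])
  also have "\<dots> = (\<Sum>c\<in>B. if c = b then representation B x c else 0)"
    using b dual by (intro sum.cong) auto
  also have "\<dots> = representation B x b" using b finite_B by simp
  finally show ?thesis ..
qed

lemma expand_basis: "(\<Sum>b\<in>B. scale (killing (dual b) x) b) = x"
  using basis_expand[OF basis, of x] by (simp add: representation_eq_killing)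

lemma killing_nondegenerate:
  assumes "\<And>b. b \<in> B \<Longrightarrow> killing x b = killing y b"
  shows "x = y"
proof -
  have "killing x z = killing y z" for z
    unfolding linear_expand[OF basis killing_linear, of _ z]
    by (rule sum.cong[OF HOL.refl]) (simp only: assms)
  then have "killing (dual b) x = killing (dual b) y" for b
    by (subst (1 2) killing_sym)
  then have "(\<Sum>b\<in>B. scale (killing (dual b) x) b) = (\<Sum>b\<in>B. scale (killing (dual b) y) b)"
    by (simp only:)
  then show ?thesis unfolding expand_basis .
qed

lemma killing_sum_left:
  "killing (\<Sum>i\<in>A. scale (c i) (v i)) y = (\<Sum>i\<in>A. c i * killing (v i) y)"
proof -
  interpret k: Vector_Spaces.linear scale "(*)" "killing y" by (rule killing_linear)
  show ?thesis unfolding killing_sym[of _ y] by (simp only: k.sum k.scale)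
qed

lemma expand_dual: "(\<Sum>b\<in>B. scale (killing x b) (dual b)) = x"
proof (rule killing_nondegenerate)
  fix c assume c: "c \<in> B"
  have "killing (\<Sum>b\<in>B. scale (killing x b) (dual b)) c = (\<Sum>b\<in>B. killing x b * killing (dual b) c)"
    by (rule killing_sum_left)
  also have "\<dots> = (\<Sum>b\<in>B. if b = c then killing x b else 0)"
    using c dual by (intro sum.cong) auto
  also have "\<dots> = killing x c" using c finite_B by simp
  finally show "killing (\<Sum>b\<in>B. scale (killing x b) (dual b)) c = killing x c" .
qed

text \<open>
  Pair with an arbitrary \<open>x\<close> and use invariance: the result is the sum of the diagonal coordinates of
  \<open>ad x \<circ> ad a\<close>, which is \<open>\<kappa>(x, a)\<close> by definition of the Killing form.  Nondegeneracy concludes.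
\<close>

lemma casimir: "(\<Sum>b\<in>B. bracket (bracket a b) (dual b)) = a"
proof (rule killing_nondegenerate)
  fix x
  have "killing (\<Sum>b\<in>B. bracket (bracket a b) (dual b)) x =
      (\<Sum>b\<in>B. killing (bracket (bracket a b) (dual b)) x)"
    using killing_sum_left[of "\<lambda>b. 1" _ B] by simp
  also have "\<dots> = (\<Sum>b\<in>B. representation B (bracket x (bracket a b)) b)"
  proof (rule sum.cong[OF HOL.refl])
    fix b assume b: "b \<in> B"
    have "killing (bracket (bracket a b) (dual b)) x = killing (bracket x (bracket a b)) (dual b)"
      by (rule HOL.trans[OF killing_sym killing_invariant[symmetric]])
    then show "killing (bracket (bracket a b) (dual b)) x = representation B (bracket x (bracket a b)) b"
      by (simp only: representation_eq_killing[OF b] killing_sym[of "dual b"])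
  qed
  also have "\<dots> = killing x a"
    unfolding killing_def by (rule trace_basis[OF basis linear_bracket2, symmetric])
  finally show "killing (\<Sum>b\<in>B. bracket (bracket a b) (dual b)) x = killing a x"
    by (simp only: killing_sym)
qed

end

context fd_lie_algebra
begin

section \<open>The adjoint representation\<close>

lemma linear_add: "Vector_Spaces.linear scale t f \<Longrightarrow> f (a + b) = f a + f b"
  and linear_scale: "Vector_Spaces.linear scale t f \<Longrightarrow> f (scale c a) = t c (f a)"
  and linear_sum: "Vector_Spaces.linear scale t f \<Longrightarrow> f (\<Sum>i\<in>A. v i) = (\<Sum>i\<in>A. f (v i))"
  by (drule Vector_Spaces.linear.axioms(3), erule module_hom.add module_hom.scale module_hom.sum)+

lemma vec_linear: "Vector_Spaces.linear scale fscale vec"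
proof -
  have "vec (a + b) = vec a + vec b" for a b
  proof
    fix xs show "vec (a + b) xs = (vec a + vec b) xs"
      by (auto simp: vec_def Vector_Spaces.linear.axioms module_hom.add split: list.splits
        dest: Vector_Spaces.linear.axioms(3))
  qed
  moreover have "vec (scale c a) = fscale c (vec a)" for c a
  proof
    fix xs show "vec (scale c a) xs = fscale c (vec a) xs"
      by (auto simp: vec_def fscale_def module_hom.scale split: list.splits
        dest: Vector_Spaces.linear.axioms(3))
  qed
  ultimately show ?thesis by unfold_locales
qed

lemma vec_add: "vec (a + b) = vec a + vec b"
  and vec_scale: "vec (scale c a) = fscale c (vec a)"
  and vec_sum: "vec (\<Sum>i\<in>A. f i) = (\<Sum>i\<in>A. vec (f i))"
proof -
  interpret v: Vector_Spaces.linear scale fscale vec by (rule vec_linear)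
  show "vec (a + b) = vec a + vec b" "vec (scale c a) = fscale c (vec a)"
    "vec (\<Sum>i\<in>A. f i) = (\<Sum>i\<in>A. vec (f i))"
    by (rule v.add v.scale v.sum)+
qed

lemma inv_vec [simp]: "inv vec (vec a) = a"
  by (rule inv_f_f[OF inj_vec])

lemma fd_space_vec: "fd_space 1 (range vec)"
proof -
  interpret v: Vector_Spaces.linear scale fscale vec by (rule vec_linear)
  obtain A where A: "finite A" "span A = UNIV" using fin_dim by blast
  have "finite (vec ` A) \<and> fun_vs.span (vec ` A) = range vec"
    using A v.span_image[of A] by simp
  then have "\<exists>A. finite A \<and> fun_vs.span A = range vec" by blast
  moreover have "fun_vs.subspace (range vec)" by (rule v.subspace_image[OF subspace_UNIV])
  moreover have "vec a xs = 0" if "length xs \<noteq> 1" for a xs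
    using that by (auto simp: vec_def split: list.splits)
  ultimately show ?thesis unfolding fd_space_def by blast
qed

lemma adjoint_rep_simps [simp]: "deg adjoint_rep = 1" "space adjoint_rep = range vec"
  by (simp_all add: adjoint_rep_def)

lemma act_adjoint [simp]: "act adjoint_rep x (vec a) = vec (bracket x a)"
  by (simp add: adjoint_rep_def)

lemma linear_on_vec:
  assumes "\<And>a b. f (vec (a + b)) = f (vec a) + f (vec b)"
    and "\<And>c a. f (vec (scale c a)) = fscale c (f (vec a))"
  shows "linear_map_on (range vec) f"
  using assms unfolding linear_map_on_def by (auto simp only: vec_add vec_scale)

lemma is_rep_adjoint: "is_rep adjoint_rep"
proof (rule is_repI)
  show "linear_map_on (space adjoint_rep) (act adjoint_rep x)" for x
    unfolding adjoint_rep_simps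
    by (rule linear_on_vec)
      (simp_all only: act_adjoint bracket_add_right bracket_scale_right vec_add[symmetric] vec_scale[symmetric])
  show "act adjoint_rep x \<in> extensional (space adjoint_rep)" for x
    by (simp add: adjoint_rep_def)
  fix v assume "v \<in> space adjoint_rep"
  then obtain a where v: "v = vec a" by auto
  fix x y c
  show "act adjoint_rep x v \<in> space adjoint_rep" unfolding v by simp
  show "act adjoint_rep (x + y) v = act adjoint_rep x v + act adjoint_rep y v"
    unfolding v act_adjoint bracket_add_left vec_add ..
  show "act adjoint_rep (scale c x) v = fscale c (act adjoint_rep x v)"
    unfolding v act_adjoint bracket_scale_left vec_scale ..
  interpret l: Vector_Spaces.linear scale fscale vec by (rule vec_linear)
  show "act adjoint_rep (bracket x y) v =
    act adjoint_rep x (act adjoint_rep y v) - act adjoint_rep y (act adjoint_rep x v)"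
    unfolding v act_adjoint bracket_bracket l.diff ..
qed (use fd_space_vec in simp)

abbreviation adj2 where "adj2 \<equiv> tensor_rep adjoint_rep adjoint_rep"
abbreviation adj3 where "adj3 \<equiv> tensor_rep adjoint_rep adj2"

lemma is_rep_adj2: "is_rep adj2" and is_rep_adj3: "is_rep adj3"
  by (intro is_rep_tensor is_rep_adjoint)+

lemma adj2_simps [simp]: "deg adj2 = 2" "space adj2 = tensor_space 1 (range vec) (range vec)"
  by simp_all

lemma vtensor_mem [simp]: "vtensor a b \<in> space adj2"
  unfolding vtensor_def adj2_simps by (intro elt_mem) simp_all

lemma vtensor_linear_left: "Vector_Spaces.linear scale fscale (\<lambda>a. vtensor a b)"
  and vtensor_linear_right: "Vector_Spaces.linear scale fscale (vtensor a)"
  unfolding vtensor_def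
  by (unfold_locales; simp only: vec_add vec_scale elt_add_left elt_add_right elt_scale_left elt_scale_right)+

definition vtensor3 where "vtensor3 a b c = elt 1 (vec a) (vtensor b c)"

lemma vtensor3_left: "elt 2 (vtensor a b) (vec c) = vtensor3 a b c"
  unfolding vtensor3_def vtensor_def using elt_assoc[of 1 1 "vec a" "vec b" "vec c"]
  by (simp only: one_add_one)

lemma vtensor3_mem [simp]: "vtensor3 a b c \<in> space adj3"
  unfolding vtensor3_def tensor_rep_simps(2)[of _ adj2] adjoint_rep_simps
  by (intro elt_mem vtensor_mem) simp

lemma act_vtensor: "act adj2 x (vtensor a b) = vtensor (bracket x a) b + vtensor a (bracket x b)"
  unfolding vtensor_def
  using act_tensor_elt[OF is_rep_adjoint is_rep_adjoint, of "vec a" "vec b" x] by simp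

lemma adj_arrow_eqI:
  assumes "f \<in> hom gmod adjoint_rep W" "g \<in> hom gmod adjoint_rep W" "\<And>a. fn f (vec a) = fn g (vec a)"
  shows "f = g"
  by (rule arrow_eqI[OF assms(1,2)]) (use assms(3) in auto)

lemma adj2_arrow_eqI:
  assumes "f \<in> hom gmod adj2 W" "g \<in> hom gmod adj2 W" "\<And>a b. fn f (vtensor a b) = fn g (vtensor a b)"
  shows "f = g"
proof (rule tensor_arrow_eqI[OF assms(1,2)])
  fix u v assume "u \<in> space adjoint_rep" "v \<in> space adjoint_rep"
  then obtain a b where "u = vec a" "v = vec b" by auto
  then show "fn f (elt (deg adjoint_rep) u v) = fn g (elt (deg adjoint_rep) u v)"
    using assms(3)[of a b] by (simp only: vtensor_def adjoint_rep_simps)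
qed

lemma adj3_arrow_eqI:
  assumes "f \<in> hom gmod adj3 W" "g \<in> hom gmod adj3 W"
    "\<And>a b c. fn f (vtensor3 a b c) = fn g (vtensor3 a b c)"
  shows "f = g"
proof (rule tensor3_arrow_eqI[OF assms(1,2)])
  fix u v w assume "u \<in> space adjoint_rep" "v \<in> space adjoint_rep" "w \<in> space adjoint_rep"
  then obtain a b c where "u = vec a" "v = vec b" "w = vec c" by auto
  then show "fn f (elt (deg adjoint_rep) u (elt (deg adjoint_rep) v w)) =
      fn g (elt (deg adjoint_rep) u (elt (deg adjoint_rep) v w))"
    using assms(3)[of a b c] by (simp only: vtensor_def vtensor3_def adjoint_rep_simps)
qed

lemma trivial_arrow_eqI:
  fixes f g :: "('g, 'x) arrow"
  assumes f: "f \<in> hom gmod trivial_rep W" and g: "g \<in> hom gmod trivial_rep W"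
    and eq: "fn f (scalar 1) = fn g (scalar 1)"
  shows "f = g"
proof (rule arrow_eqI[OF f g])
  fix v :: "'x tup" assume "v \<in> space trivial_rep"
  then obtain c where "v = fscale c (scalar 1)" using scalar_mult[of _ 1] by auto
  moreover have "(scalar 1 :: 'x tup) \<in> space trivial_rep" by simp
  ultimately show "fn f v = fn g v"
    using eq linear_map_on_scale[OF fn_linear[OF f]] linear_map_on_scale[OF fn_linear[OF g]] by metis
qed

text \<open>
  The arrow out of the tensor square that an equivariant bilinear map on the Lie algebra induces.
\<close>

definition lift2 :: "('g, 'g \<Rightarrow> complex) repn \<Rightarrow> ('g \<Rightarrow> 'g \<Rightarrow> ('g \<Rightarrow> complex) tup) \<Rightarrow>
    ('g, 'g \<Rightarrow> complex) arrow" where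
  "lift2 W \<beta> = Arrow adj2
     (tensor_lift 1 (range vec) (range vec) (\<lambda>u v. \<beta> (inv vec u) (inv vec v))) W"

lemma
  assumes W: "is_rep W"
    and l: "\<And>b. Vector_Spaces.linear scale fscale (\<lambda>a. \<beta> a b)"
    and r: "\<And>a. Vector_Spaces.linear scale fscale (\<beta> a)"
    and mem: "\<And>a b. \<beta> a b \<in> space W"
    and inv: "\<And>x a b. act W x (\<beta> a b) = \<beta> (bracket x a) b + \<beta> a (bracket x b)"
  shows lift2_in_hom: "lift2 W \<beta> \<in> hom gmod adj2 W"
    and fn_lift2: "fn (lift2 W \<beta>) (vtensor a b) = \<beta> a b"
proof -
  let ?b = "\<lambda>u v. \<beta> (inv vec u) (inv vec v)"
  have add: "\<beta> (a + a') b = \<beta> a b + \<beta> a' b" "\<beta> b (a + a') = \<beta> b a + \<beta> b a'"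
    and scl: "\<beta> (scale c a) b = fscale c (\<beta> a b)" "\<beta> b (scale c a) = fscale c (\<beta> b a)" for a a' b c
    by (rule linear_add[OF l] linear_add[OF r] linear_scale[OF l] linear_scale[OF r])+
  have bil: "bilinear_on (range vec) (range vec) ?b"
    unfolding bilinear_on_def
    by (intro conjI ballI linear_on_vec) (simp_all only: inv_vec add scl)
  note lift = fd_space_vec fd_space_vec bil
  have fn: "fn (lift2 W \<beta>) = tensor_lift 1 (range vec) (range vec) ?b" by (simp add: lift2_def)
  show val: "fn (lift2 W \<beta>) (vtensor a b) = \<beta> a b" for a b
    unfolding fn vtensor_def tensor_lift_elt[OF lift rangeI rangeI] inv_vec ..
  have val': "fn (lift2 W \<beta>) (elt 1 u v) = ?b u v" if "u \<in> range vec" "v \<in> range vec" for u v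
    unfolding fn by (rule tensor_lift_elt[OF lift that])
  have lin: "linear_map_on (space adj2) (fn (lift2 W \<beta>))"
    unfolding fn adj2_simps by (rule tensor_lift_linear[OF lift])
  show "lift2 W \<beta> \<in> hom gmod adj2 W"
  proof (rule hom_gmodI[OF _ _ _ _ lin])
    show "fn (lift2 W \<beta>) \<in> extensional (space adj2)"
      unfolding fn adj2_simps by (rule tensor_lift_extensional[OF lift])
    show Wm: "fn (lift2 W \<beta>) t \<in> space W" if "t \<in> space adj2" for t
      by (rule tensor_map_mem[OF lin[unfolded adj2_simps] rep_subspace[OF W] _ that[unfolded adj2_simps]])
        (simp only: val' mem)
    fix x t assume t: "t \<in> space adj2"
    show "fn (lift2 W \<beta>) (act adj2 x t) = act W x (fn (lift2 W \<beta>) t)"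
    proof (rule tensor_map_eqI[OF _ _ _ t[unfolded adj2_simps]])
      show "linear_map_on (tensor_space 1 (range vec) (range vec)) (\<lambda>t. fn (lift2 W \<beta>) (act adj2 x t))"
        using linear_map_on_compose[OF act_linear[OF is_rep_adj2] lin act_mem[OF is_rep_adj2]]
        unfolding adj2_simps .
      show "linear_map_on (tensor_space 1 (range vec) (range vec)) (\<lambda>t. act W x (fn (lift2 W \<beta>) t))"
        using linear_map_on_compose[OF lin act_linear[OF W] Wm] unfolding adj2_simps .
      fix u v assume "u \<in> range vec" "v \<in> range vec"
      then obtain a b where uv: "elt 1 u v = vtensor a b" unfolding vtensor_def by blast
      show "fn (lift2 W \<beta>) (act adj2 x (elt 1 u v)) = act W x (fn (lift2 W \<beta>) (elt 1 u v))"
        unfolding uv act_vtensor linear_map_on_add[OF lin vtensor_mem vtensor_mem] val inv ..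
    qed
  qed (simp_all add: lift2_def)
qed

end

context killing_dual_basis
begin

section \<open>The defining relations in the category of representations\<close>

text \<open>
  Both sides equal \<open>\<Sum> \<kappa>(c', [a, b]) c \<otimes> b'\<close>, summed over \<open>b\<close> and \<open>c\<close>: on the left expand \<open>[a, b]\<close> in
  the basis, on the right expand \<open>[c', a]\<close> in the dual basis and use invariance to write
  \<open>\<kappa>([c', a], b)\<close> as \<open>\<kappa>(c', [a, b])\<close>.
\<close>

lemma copairing_slide:
  "(\<Sum>b\<in>B. vtensor (bracket a b) (dual b)) = (\<Sum>b\<in>B. vtensor b (bracket (dual b) a))"
proof -
  have "(\<Sum>b\<in>B. vtensor (bracket a b) (dual b)) =
      (\<Sum>b\<in>B. \<Sum>c\<in>B. fscale (killing (dual c) (bracket a b)) (vtensor c (dual b)))"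
  proof (rule sum.cong[OF HOL.refl])
    fix b
    have "vtensor (bracket a b) (dual b) =
        vtensor (\<Sum>c\<in>B. scale (killing (dual c) (bracket a b)) c) (dual b)"
      unfolding expand_basis ..
    also have "\<dots> = (\<Sum>c\<in>B. fscale (killing (dual c) (bracket a b)) (vtensor c (dual b)))"
      unfolding linear_sum[OF vtensor_linear_left] linear_scale[OF vtensor_linear_left] ..
    finally show "vtensor (bracket a b) (dual b) =
      (\<Sum>c\<in>B. fscale (killing (dual c) (bracket a b)) (vtensor c (dual b)))" .
  qed
  also have "\<dots> = (\<Sum>c\<in>B. \<Sum>b\<in>B. fscale (killing (bracket (dual c) a) b) (vtensor c (dual b)))"
    unfolding killing_invariant by (rule sum.swap)
  also have "\<dots> = (\<Sum>c\<in>B. vtensor c (\<Sum>b\<in>B. scale (killing (bracket (dual c) a) b) (dual b)))"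
    unfolding linear_sum[OF vtensor_linear_right] linear_scale[OF vtensor_linear_right] ..
  also have "\<dots> = (\<Sum>b\<in>B. vtensor b (bracket (dual b) a))"
    unfolding expand_dual ..
  finally show ?thesis .
qed

definition "bracket_arrow = lift2 adjoint_rep (\<lambda>a b. vec (bracket a b))"
definition "swap_arrow = lift2 adj2 (\<lambda>a b. vtensor b a)"
definition "killing_arrow = lift2 trivial_rep (\<lambda>a b. scalar (killing a b))"
definition "copairing = (\<Sum>b\<in>B. vtensor b (dual b))"
text \<open>
  A vector \<open>v\<close> of the trivial representation is the scalar \<open>v []\<close>.
\<close>

definition "copairing_arrow = Arrow trivial_rep (\<lambda>v\<in>range scalar. fscale (v []) copairing) adj2"

lemma bracket_arrow_hom: "bracket_arrow \<in> hom gmod adj2 adjoint_rep"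
  and fn_bracket_arrow: "fn bracket_arrow (vtensor a b) = vec (bracket a b)"
proof -
  have l: "Vector_Spaces.linear scale fscale (\<lambda>a. vec (bracket a b))"
    and r: "Vector_Spaces.linear scale fscale (\<lambda>b. vec (bracket a b))" for a b
    by (unfold_locales; simp only: bracket_add_left bracket_scale_left bracket_add_right
        bracket_scale_right vec_add vec_scale)+
  have inv: "act adjoint_rep x (vec (bracket a b)) = vec (bracket (bracket x a) b) + vec (bracket a (bracket x b))"
    for x a b
    unfolding act_adjoint vec_add[symmetric] by (simp add: bracket_bracket)
  note arrow = is_rep_adjoint l r _ inv
  show "bracket_arrow \<in> hom gmod adj2 adjoint_rep" "fn bracket_arrow (vtensor a b) = vec (bracket a b)"
    unfolding bracket_arrow_def by (rule lift2_in_hom[OF arrow] fn_lift2[OF arrow]; simp)+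
qed

lemma swap_arrow_hom: "swap_arrow \<in> hom gmod adj2 adj2"
  and fn_swap_arrow: "fn swap_arrow (vtensor a b) = vtensor b a"
proof -
  have inv: "act adj2 x (vtensor b a) = vtensor b (bracket x a) + vtensor (bracket x b) a" for x a b
    unfolding act_vtensor by (rule add.commute)
  note arrow = is_rep_adj2 vtensor_linear_right vtensor_linear_left vtensor_mem inv
  show "swap_arrow \<in> hom gmod adj2 adj2" "fn swap_arrow (vtensor a b) = vtensor b a"
    unfolding swap_arrow_def by (rule lift2_in_hom[OF arrow] fn_lift2[OF arrow])+
qed

lemma killing_arrow_hom: "killing_arrow \<in> hom gmod adj2 trivial_rep"
  and fn_killing_arrow: "fn killing_arrow (vtensor a b) = scalar (killing a b)"
proof -
  have r: "Vector_Spaces.linear scale fscale (\<lambda>b. scalar (killing a b))" for a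
    by (unfold_locales; simp only: linear_add[OF killing_linear] linear_scale[OF killing_linear]
        scalar_add scalar_mult)
  then have l: "Vector_Spaces.linear scale fscale (\<lambda>a. scalar (killing a b))" for b
    unfolding killing_sym[of _ b] .
  have inv: "act trivial_rep x (scalar (killing a b)) =
    scalar (killing (bracket x a) b) + scalar (killing a (bracket x b))" for x a b
  proof -
    have "bracket x a + bracket a x = scale 0 0" by (simp add: bracket_skew[of x a])
    then have "killing b (bracket x a) + killing b (bracket a x) = 0"
      unfolding linear_add[OF killing_linear, symmetric] by (simp only: linear_scale[OF killing_linear] mult_zero_left)
    then have "killing (bracket x a) b = - killing (bracket a x) b"
      unfolding killing_sym[of _ b] by (simp only: eq_neg_iff_add_eq_0)
    then show ?thesis by (simp add: killing_invariant scalar_add[symmetric] scalar_0)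
  qed
  note arrow = is_rep_trivial l r _ inv
  show "killing_arrow \<in> hom gmod adj2 trivial_rep" "fn killing_arrow (vtensor a b) = scalar (killing a b)"
    unfolding killing_arrow_def by (rule lift2_in_hom[OF arrow] fn_lift2[OF arrow]; simp)+
qed

lemma copairing_mem: "copairing \<in> space adj2"
  unfolding copairing_def by (intro fun_vs.subspace_sum rep_subspace is_rep_adj2 vtensor_mem)

text \<open>
  By the sliding identity, the first Leibniz term \<open>\<Sum> [x, b] \<otimes> b'\<close> is minus the second one.
\<close>

lemma act_copairing: "act adj2 x copairing = 0"
proof -
  have "act adj2 x copairing = (\<Sum>b\<in>B. act adj2 x (vtensor b (dual b)))"
    unfolding copairing_def
    by (rule linear_map_on_sum[OF rep_subspace[OF is_rep_adj2] act_linear[OF is_rep_adj2] finite_B vtensor_mem])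
  also have "\<dots> = (\<Sum>b\<in>B. vtensor b (bracket (dual b) x)) + (\<Sum>b\<in>B. vtensor b (bracket x (dual b)))"
    unfolding act_vtensor sum.distrib copairing_slide ..
  also have "\<dots> = (\<Sum>b\<in>B. vtensor b (bracket (dual b) x + bracket x (dual b)))"
    unfolding linear_add[OF vtensor_linear_right] sum.distrib ..
  also have "\<dots> = (\<Sum>b\<in>B. vtensor b (scale 0 0))"
    by (rule sum.cong[OF HOL.refl]) (simp add: bracket_skew[of _ x])
  also have "\<dots> = 0"
    unfolding linear_scale[OF vtensor_linear_right] fun_vs.scale_zero_left by (rule sum.neutral_const)
  finally show ?thesis .
qed

lemma copairing_arrow_hom: "copairing_arrow \<in> hom gmod trivial_rep adj2"
  and fn_copairing_arrow: "fn copairing_arrow (scalar 1) = copairing"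
proof -
  have lin: "linear_map_on (range scalar) (\<lambda>v. fscale (v []) copairing)"
    by (auto simp: linear_map_on_def fscale_def algebra_simps)
  have "Arrow trivial_rep (\<lambda>v\<in>space trivial_rep. fscale (v []) copairing) adj2 \<in> hom gmod trivial_rep adj2"
  proof (rule restricted_in_hom[OF is_rep_trivial])
    show "linear_map_on (space trivial_rep) (\<lambda>v. fscale (v []) copairing)" using lin by simp
    fix v :: "('g \<Rightarrow> complex) tup" assume v: "v \<in> space trivial_rep"
    show "fscale (v []) copairing \<in> space adj2"
      by (rule fun_vs.subspace_scale[OF rep_subspace[OF is_rep_adj2] copairing_mem])
    fix x show "fscale (act trivial_rep x v []) copairing = act adj2 x (fscale (v []) copairing)"
      using v unfolding linear_map_on_scale[OF act_linear[OF is_rep_adj2] copairing_mem] act_copairing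
      by (simp add: fun_vs.scale_zero_right)
  qed
  then show "copairing_arrow \<in> hom gmod trivial_rep adj2"
    unfolding copairing_arrow_def by simp
  have "(scalar 1 :: ('g \<Rightarrow> complex) tup) [] = 1" by (simp add: scalar_def)
  then show "fn copairing_arrow (scalar 1) = copairing"
    by (simp add: copairing_arrow_def fun_vs.scale_one)
qed

sublocale model: T_data gmod adjoint_rep bracket_arrow swap_arrow copairing_arrow killing_arrow
  by (intro T_data.intro gmod_strict_monoidal T_data_axioms.intro, unfold gmod_simps)
    (simp_all only: mem_Collect_eq is_rep_adjoint bracket_arrow_hom swap_arrow_hom copairing_arrow_hom killing_arrow_hom)

lemma fn_sum:
  assumes "is_rep V" "f \<in> hom gmod V W" "\<And>b. v b \<in> space V"
  shows "fn f (\<Sum>b\<in>B. v b) = (\<Sum>b\<in>B. fn f (v b))"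
  by (rule linear_map_on_sum[OF rep_subspace[OF assms(1)] fn_linear[OF assms(2)] finite_B assms(3)])

abbreviation "id_adj \<equiv> idm gmod adjoint_rep"

lemma id_adj_hom: "id_adj \<in> hom gmod adjoint_rep adjoint_rep"
  by (rule id_in_hom[OF is_rep_adjoint])

lemma fn_id_adj: "fn id_adj (vec a) = vec a"
  by (rule fn_id) simp

text \<open>
  The relations are composites of generators tensored with one identity strand.  The following lemmas
  record, for each possible source of the generator, type and values of such a whiskered arrow.
\<close>

lemma
  assumes V: "is_rep V" and f: "f \<in> hom gmod adj2 V"
  shows whisker_right_adj2: "tmor gmod f id_adj \<in> hom gmod adj3 (tensor_rep V adjoint_rep)"
    and fn_whisker_right_adj2: "fn (tmor gmod f id_adj) (vtensor3 a b c) = elt (deg V) (fn f (vtensor a b)) (vec c)"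
    and whisker_left_adj2: "tmor gmod id_adj f \<in> hom gmod adj3 (tensor_rep adjoint_rep V)"
    and fn_whisker_left_adj2: "fn (tmor gmod id_adj f) (vtensor3 a b c) = elt 1 (vec a) (fn f (vtensor b c))"
proof -
  note r = is_rep_adj2 is_rep_adjoint V is_rep_adjoint f id_adj_hom
  note l = is_rep_adjoint is_rep_adj2 is_rep_adjoint V id_adj_hom f
  have c: "vec c \<in> space adjoint_rep" for c by simp
  show "tmor gmod f id_adj \<in> hom gmod adj3 (tensor_rep V adjoint_rep)"
    using tmor_in_hom[OF r] unfolding tensor_rep_assoc[OF is_rep_adjoint is_rep_adjoint is_rep_adjoint] .
  show "fn (tmor gmod f id_adj) (vtensor3 a b c) = elt (deg V) (fn f (vtensor a b)) (vec c)"
    using fn_tmor[OF r vtensor_mem c] unfolding adj2_simps vtensor3_left fn_id_adj .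
  show "tmor gmod id_adj f \<in> hom gmod adj3 (tensor_rep adjoint_rep V)"
    by (rule tmor_in_hom[OF l])
  show "fn (tmor gmod id_adj f) (vtensor3 a b c) = elt 1 (vec a) (fn f (vtensor b c))"
    using fn_tmor[OF l c vtensor_mem] unfolding adjoint_rep_simps vtensor3_def[symmetric] fn_id_adj .
qed

lemma
  assumes V: "is_rep V" and f: "f \<in> hom gmod adjoint_rep V"
  shows whisker_right_adj: "tmor gmod f id_adj \<in> hom gmod adj2 (tensor_rep V adjoint_rep)"
    and fn_whisker_right_adj: "fn (tmor gmod f id_adj) (vtensor a b) = elt (deg V) (fn f (vec a)) (vec b)"
    and whisker_left_adj: "tmor gmod id_adj f \<in> hom gmod adj2 (tensor_rep adjoint_rep V)"
    and fn_whisker_left_adj: "fn (tmor gmod id_adj f) (vtensor a b) = elt 1 (vec a) (fn f (vec b))"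
proof -
  note r = is_rep_adjoint is_rep_adjoint V is_rep_adjoint f id_adj_hom
  note l = is_rep_adjoint is_rep_adjoint is_rep_adjoint V id_adj_hom f
  have c: "vec c \<in> space adjoint_rep" for c by simp
  show "tmor gmod f id_adj \<in> hom gmod adj2 (tensor_rep V adjoint_rep)"
    by (rule tmor_in_hom[OF r])
  show "fn (tmor gmod f id_adj) (vtensor a b) = elt (deg V) (fn f (vec a)) (vec b)"
    using fn_tmor[OF r c c] unfolding adjoint_rep_simps vtensor_def[symmetric] fn_id_adj .
  show "tmor gmod id_adj f \<in> hom gmod adj2 (tensor_rep adjoint_rep V)"
    by (rule tmor_in_hom[OF l])
  show "fn (tmor gmod id_adj f) (vtensor a b) = elt 1 (vec a) (fn f (vec b))"
    using fn_tmor[OF l c c] unfolding adjoint_rep_simps vtensor_def[symmetric] fn_id_adj .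
qed

lemma
  assumes V: "is_rep V" and f: "f \<in> hom gmod trivial_rep V"
  shows whisker_right_unit: "tmor gmod f id_adj \<in> hom gmod adjoint_rep (tensor_rep V adjoint_rep)"
    and fn_whisker_right_unit: "fn (tmor gmod f id_adj) (vec a) = elt (deg V) (fn f (scalar 1)) (vec a)"
    and whisker_left_unit: "tmor gmod id_adj f \<in> hom gmod adjoint_rep (tensor_rep adjoint_rep V)"
    and fn_whisker_left_unit: "fn (tmor gmod id_adj f) (vec a) = elt 1 (vec a) (fn f (scalar 1))"
proof -
  note r = is_rep_trivial is_rep_adjoint V is_rep_adjoint f id_adj_hom
  note l = is_rep_adjoint is_rep_trivial is_rep_adjoint V id_adj_hom f
  have c: "vec c \<in> space adjoint_rep" for c by simp
  have 1: "(scalar 1 :: ('g \<Rightarrow> complex) tup) \<in> space trivial_rep" by simp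
  show "tmor gmod f id_adj \<in> hom gmod adjoint_rep (tensor_rep V adjoint_rep)"
    using tmor_in_hom[OF r] unfolding tensor_rep_unit_left[OF is_rep_adjoint] .
  show "fn (tmor gmod f id_adj) (vec a) = elt (deg V) (fn f (scalar 1)) (vec a)"
    using fn_tmor[OF r 1 c] unfolding trivial_rep_simps elt_scalar_left fn_id_adj fun_vs.scale_one .
  show "tmor gmod id_adj f \<in> hom gmod adjoint_rep (tensor_rep adjoint_rep V)"
    using tmor_in_hom[OF l] unfolding tensor_rep_unit_right[OF is_rep_adjoint] .
  show "fn (tmor gmod id_adj f) (vec a) = elt 1 (vec a) (fn f (scalar 1))"
    using fn_tmor[OF l c 1]
    unfolding adjoint_rep_simps elt_scalar_right[OF fd_space_vec rangeI] fn_id_adj fun_vs.scale_one .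
qed

lemmas bracket_right_hom = whisker_right_adj2[OF is_rep_adjoint bracket_arrow_hom]
lemmas bracket_left_hom = whisker_left_adj2[OF is_rep_adjoint bracket_arrow_hom]
lemmas swap_right_hom = whisker_right_adj2[OF is_rep_adj2 swap_arrow_hom,
    unfolded tensor_rep_assoc[OF is_rep_adjoint is_rep_adjoint is_rep_adjoint]]
lemmas swap_left_hom = whisker_left_adj2[OF is_rep_adj2 swap_arrow_hom]
lemmas killing_right_hom = whisker_right_adj2[OF is_rep_trivial killing_arrow_hom,
    unfolded tensor_rep_unit_left[OF is_rep_adjoint]]
lemmas killing_left_hom = whisker_left_adj2[OF is_rep_trivial killing_arrow_hom,
    unfolded tensor_rep_unit_right[OF is_rep_adjoint]]
lemmas copairing_right_hom = whisker_right_unit[OF is_rep_adj2 copairing_arrow_hom,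
    unfolded tensor_rep_assoc[OF is_rep_adjoint is_rep_adjoint is_rep_adjoint]]
lemmas copairing_left_hom = whisker_left_unit[OF is_rep_adj2 copairing_arrow_hom]

lemma fn_bracket_right: "fn (tmor gmod bracket_arrow id_adj) (vtensor3 a b c) = vtensor (bracket a b) c"
  unfolding fn_whisker_right_adj2[OF is_rep_adjoint bracket_arrow_hom] fn_bracket_arrow
    adjoint_rep_simps by (simp only: vtensor_def)

lemma fn_bracket_left: "fn (tmor gmod id_adj bracket_arrow) (vtensor3 a b c) = vtensor a (bracket b c)"
  unfolding fn_whisker_left_adj2[OF is_rep_adjoint bracket_arrow_hom] fn_bracket_arrow
  by (simp only: vtensor_def)

lemma fn_swap_right: "fn (tmor gmod swap_arrow id_adj) (vtensor3 a b c) = vtensor3 b a c"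
  unfolding fn_whisker_right_adj2[OF is_rep_adj2 swap_arrow_hom] fn_swap_arrow adj2_simps vtensor3_left ..

lemma fn_swap_left: "fn (tmor gmod id_adj swap_arrow) (vtensor3 a b c) = vtensor3 a c b"
  unfolding fn_whisker_left_adj2[OF is_rep_adj2 swap_arrow_hom] fn_swap_arrow
  by (simp only: vtensor3_def)

lemma fn_killing_right: "fn (tmor gmod killing_arrow id_adj) (vtensor3 a b c) = vec (scale (killing a b) c)"
  unfolding fn_whisker_right_adj2[OF is_rep_trivial killing_arrow_hom] fn_killing_arrow
    trivial_rep_simps elt_scalar_left vec_scale ..

lemma fn_killing_left: "fn (tmor gmod id_adj killing_arrow) (vtensor3 a b c) = vec (scale (killing b c) a)"
  unfolding fn_whisker_left_adj2[OF is_rep_trivial killing_arrow_hom] fn_killing_arrow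
    elt_scalar_right[OF fd_space_vec rangeI] vec_scale ..

lemma fn_copairing_right:
  "fn (tmor gmod copairing_arrow id_adj) (vec a) = (\<Sum>b\<in>B. vtensor3 b (dual b) a)"
  unfolding fn_whisker_right_unit[OF is_rep_adj2 copairing_arrow_hom] fn_copairing_arrow copairing_def
    adj2_simps elt_sum_left vtensor3_left ..

lemma fn_copairing_left:
  "fn (tmor gmod id_adj copairing_arrow) (vec a) = (\<Sum>b\<in>B. vtensor3 a b (dual b))"
  unfolding fn_whisker_left_unit[OF is_rep_adj2 copairing_arrow_hom] fn_copairing_arrow copairing_def vtensor3_def
  by (rule linear_map_on_sum[OF fun_vs.subspace_UNIV linear_elt_right finite_B UNIV_I])

lemma cmp_adj_hom: "g \<in> hom gmod V W \<Longrightarrow> f \<in> hom gmod adjoint_rep V \<Longrightarrow> cmp gmod g f \<in> hom gmod adjoint_rep W"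
  and cmp_adj2_hom: "g \<in> hom gmod V W \<Longrightarrow> f \<in> hom gmod adj2 V \<Longrightarrow> cmp gmod g f \<in> hom gmod adj2 W"
  and cmp_adj3_hom: "g \<in> hom gmod V W \<Longrightarrow> f \<in> hom gmod adj3 V \<Longrightarrow> cmp gmod g f \<in> hom gmod adj3 W"
  and cmp_trivial_hom: "g \<in> hom gmod V W \<Longrightarrow> f \<in> hom gmod trivial_rep V \<Longrightarrow> cmp gmod g f \<in> hom gmod trivial_rep W"
  by (rule cmp_in_hom[OF is_rep_adjoint] cmp_in_hom[OF is_rep_adj2] cmp_in_hom[OF is_rep_adj3]
      cmp_in_hom[OF is_rep_trivial]; assumption)+

lemma fn_cmp_adj: "f \<in> hom gmod adjoint_rep V \<Longrightarrow> fn (cmp gmod g f) (vec a) = fn g (fn f (vec a))"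
  by (erule fn_cmp) simp

lemma fn_cmp_adj2: "f \<in> hom gmod adj2 V \<Longrightarrow> fn (cmp gmod g f) (vtensor a b) = fn g (fn f (vtensor a b))"
  by (erule fn_cmp) (rule vtensor_mem)

lemma fn_cmp_adj3: "f \<in> hom gmod adj3 V \<Longrightarrow> fn (cmp gmod g f) (vtensor3 a b c) = fn g (fn f (vtensor3 a b c))"
  by (erule fn_cmp) (rule vtensor3_mem)

lemmas sum_adj3 = fn_sum[OF is_rep_adj3 _ vtensor3_mem]
lemmas sum_adj2 = fn_sum[OF is_rep_adj2 _ vtensor_mem]

lemma sig_hom: "model.sig \<in> hom gmod adjoint_rep adj2"
  unfolding model.sig_def by (rule cmp_adj_hom[OF bracket_left_hom copairing_right_hom])

text \<open>
  By definition \<open>\<sigma>\<close> sends \<open>a\<close> to \<open>\<Sum> b \<otimes> [b', a]\<close>; sliding turns this into the stated form.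
\<close>

lemma fn_sig: "fn model.sig (vec a) = (\<Sum>b\<in>B. vtensor (bracket a b) (dual b))"
  unfolding model.sig_def fn_cmp_adj[OF copairing_right_hom] fn_copairing_right
    sum_adj3[OF bracket_left_hom] fn_bracket_left copairing_slide ..

lemmas sig_right_hom = whisker_right_adj[OF is_rep_adj2 sig_hom,
    unfolded tensor_rep_assoc[OF is_rep_adjoint is_rep_adjoint is_rep_adjoint]]
lemmas sig_left_hom = whisker_left_adj[OF is_rep_adj2 sig_hom]

lemma fn_sig_right: "fn (tmor gmod model.sig id_adj) (vtensor a c) = (\<Sum>b\<in>B. vtensor3 (bracket a b) (dual b) c)"
  unfolding fn_whisker_right_adj[OF is_rep_adj2 sig_hom] fn_sig adj2_simps elt_sum_left vtensor3_left ..

lemma fn_sig_left: "fn (tmor gmod id_adj model.sig) (vtensor a c) = (\<Sum>b\<in>B. vtensor3 a (bracket c b) (dual b))"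
  unfolding fn_whisker_left_adj[OF is_rep_adj2 sig_hom] fn_sig vtensor3_def
  by (rule linear_map_on_sum[OF fun_vs.subspace_UNIV linear_elt_right finite_B UNIV_I])

sublocale model: T_algebra gmod adjoint_rep bracket_arrow swap_arrow copairing_arrow killing_arrow dimension 1
proof (intro T_algebra.intro model.T_data_axioms T_algebra_axioms.intro)
  show "cmp gmod (tmor gmod killing_arrow id_adj) (tmor gmod id_adj copairing_arrow) = id_adj"
  proof (rule adj_arrow_eqI[OF cmp_adj_hom[OF killing_right_hom copairing_left_hom] id_adj_hom])
    show "fn (cmp gmod (tmor gmod killing_arrow id_adj) (tmor gmod id_adj copairing_arrow)) (vec a) = fn id_adj (vec a)" for a
      unfolding fn_cmp_adj[OF copairing_left_hom] fn_copairing_left sum_adj3[OF killing_right_hom]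
        fn_killing_right vec_sum[symmetric] expand_dual fn_id_adj ..
  qed
  show "cmp gmod (tmor gmod id_adj killing_arrow) (tmor gmod copairing_arrow id_adj) = id_adj"
  proof (rule adj_arrow_eqI[OF cmp_adj_hom[OF killing_left_hom copairing_right_hom] id_adj_hom])
    show "fn (cmp gmod (tmor gmod id_adj killing_arrow) (tmor gmod copairing_arrow id_adj)) (vec a) = fn id_adj (vec a)" for a
      unfolding fn_cmp_adj[OF copairing_right_hom] fn_copairing_right sum_adj3[OF killing_left_hom]
        fn_killing_left vec_sum[symmetric] expand_basis fn_id_adj ..
  qed
  show "model.sig = cmp gmod (tmor gmod bracket_arrow id_adj) (tmor gmod id_adj copairing_arrow)"
    by (rule adj_arrow_eqI[OF sig_hom cmp_adj_hom[OF bracket_right_hom copairing_left_hom]])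
      (simp only: fn_sig fn_cmp_adj[OF copairing_left_hom] fn_copairing_left sum_adj3[OF bracket_right_hom]
        fn_bracket_right)
  show "cmp gmod (tmor gmod id_adj killing_arrow) (tmor gmod swap_arrow id_adj) =
      cmp gmod (tmor gmod killing_arrow id_adj) (tmor gmod id_adj swap_arrow)"
    by (rule adj3_arrow_eqI[OF cmp_adj3_hom[OF killing_left_hom swap_right_hom]
          cmp_adj3_hom[OF killing_right_hom swap_left_hom]])
      (simp only: fn_cmp_adj3[OF swap_right_hom] fn_cmp_adj3[OF swap_left_hom] fn_swap_right fn_swap_left
        fn_killing_right fn_killing_left)
  show "cmp gmod swap_arrow swap_arrow = tmor gmod id_adj id_adj"
  proof -
    have id: "tmor gmod id_adj id_adj \<in> hom gmod adj2 adj2"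
      by (rule whisker_left_adj[OF is_rep_adjoint id_adj_hom])
    have "fn (tmor gmod id_adj id_adj) (vtensor a b) = vtensor a b" for a b
      unfolding fn_whisker_left_adj[OF is_rep_adjoint id_adj_hom] fn_id_adj by (simp only: vtensor_def)
    then show ?thesis
      by (intro adj2_arrow_eqI[OF cmp_adj2_hom[OF swap_arrow_hom swap_arrow_hom] id])
        (simp only: fn_cmp_adj2[OF swap_arrow_hom] fn_swap_arrow)
  qed
  show "cmp gmod (tmor gmod swap_arrow id_adj)
      (cmp gmod (tmor gmod id_adj swap_arrow) (tmor gmod swap_arrow id_adj)) =
    cmp gmod (tmor gmod id_adj swap_arrow)
      (cmp gmod (tmor gmod swap_arrow id_adj) (tmor gmod id_adj swap_arrow))"
    by (rule adj3_arrow_eqI[OF cmp_adj3_hom[OF swap_right_hom cmp_adj3_hom[OF swap_left_hom swap_right_hom]]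
          cmp_adj3_hom[OF swap_left_hom cmp_adj3_hom[OF swap_right_hom swap_left_hom]]])
      (simp only: fn_cmp_adj3[OF swap_right_hom] fn_cmp_adj3[OF swap_left_hom]
        fn_cmp_adj3[OF cmp_adj3_hom[OF swap_left_hom swap_right_hom]]
        fn_cmp_adj3[OF cmp_adj3_hom[OF swap_right_hom swap_left_hom]] fn_swap_right fn_swap_left)
  show "cmp gmod (tmor gmod id_adj bracket_arrow)
      (cmp gmod (tmor gmod swap_arrow id_adj) (tmor gmod id_adj swap_arrow)) =
    cmp gmod swap_arrow (tmor gmod bracket_arrow id_adj)"
    by (rule adj3_arrow_eqI[OF cmp_adj3_hom[OF bracket_left_hom cmp_adj3_hom[OF swap_right_hom swap_left_hom]]
          cmp_adj3_hom[OF swap_arrow_hom bracket_right_hom]])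
      (simp only: fn_cmp_adj3[OF swap_left_hom] fn_cmp_adj3[OF bracket_right_hom]
        fn_cmp_adj3[OF cmp_adj3_hom[OF swap_right_hom swap_left_hom]] fn_swap_right fn_swap_left
        fn_bracket_left fn_bracket_right fn_swap_arrow)
  show "cmp gmod (tmor gmod id_adj swap_arrow)
      (cmp gmod (tmor gmod swap_arrow id_adj) (tmor gmod id_adj model.sig)) =
    cmp gmod (tmor gmod model.sig id_adj) swap_arrow"
    by (rule adj2_arrow_eqI[OF cmp_adj2_hom[OF swap_left_hom cmp_adj2_hom[OF swap_right_hom sig_left_hom]]
          cmp_adj2_hom[OF sig_right_hom swap_arrow_hom]])
      (simp only: fn_cmp_adj2[OF sig_left_hom] fn_cmp_adj2[OF swap_arrow_hom]
        fn_cmp_adj2[OF cmp_adj2_hom[OF swap_right_hom sig_left_hom]] fn_sig_left fn_sig_right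
        sum_adj3[OF swap_right_hom] sum_adj3[OF swap_left_hom] fn_swap_right fn_swap_left fn_swap_arrow)
  show "cmp gmod killing_arrow swap_arrow = killing_arrow"
  proof (rule adj2_arrow_eqI[OF cmp_adj2_hom[OF killing_arrow_hom swap_arrow_hom] killing_arrow_hom])
    show "fn (cmp gmod killing_arrow swap_arrow) (vtensor a b) = fn killing_arrow (vtensor a b)" for a b
      unfolding fn_cmp_adj2[OF swap_arrow_hom] fn_swap_arrow fn_killing_arrow killing_sym[of b a] ..
  qed
  show "cmp gmod bracket_arrow swap_arrow = smul gmod (-1) bracket_arrow"
  proof (rule adj2_arrow_eqI[OF cmp_adj2_hom[OF bracket_arrow_hom swap_arrow_hom]
        smul_in_hom[OF is_rep_adj2 is_rep_adjoint bracket_arrow_hom]])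
    fix a b
    have "vec (bracket b a) = vec (scale (-1) (bracket a b))"
      by (simp add: bracket_skew[of b a])
    then show "fn (cmp gmod bracket_arrow swap_arrow) (vtensor a b) = fn (smul gmod (-1) bracket_arrow) (vtensor a b)"
      unfolding fn_cmp_adj2[OF swap_arrow_hom] fn_swap_arrow fn_smul[OF bracket_arrow_hom vtensor_mem]
        fn_bracket_arrow vec_scale .
  qed
  show "cmp gmod bracket_arrow model.sig = smul gmod 1 id_adj"
  proof (rule adj_arrow_eqI[OF cmp_adj_hom[OF bracket_arrow_hom sig_hom]
        smul_in_hom[OF is_rep_adjoint is_rep_adjoint id_adj_hom]])
    fix a
    have "vec a \<in> space adjoint_rep" by simp
    then show "fn (cmp gmod bracket_arrow model.sig) (vec a) = fn (smul gmod 1 id_adj) (vec a)"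
      by (simp only: fn_cmp_adj[OF sig_hom] fn_sig sum_adj2[OF bracket_arrow_hom] fn_bracket_arrow
          vec_sum[symmetric] casimir fn_smul[OF id_adj_hom] fn_id_adj fun_vs.scale_one)
  qed
  show "cmp gmod killing_arrow copairing_arrow = smul gmod dimension (idm gmod (unit gmod))"
    unfolding gmod_simps(4)
  proof (rule trivial_arrow_eqI[OF cmp_trivial_hom[OF killing_arrow_hom copairing_arrow_hom]
        smul_in_hom[OF is_rep_trivial is_rep_trivial id_in_hom[OF is_rep_trivial]]])
    have 1: "(scalar 1 :: ('g \<Rightarrow> complex) tup) \<in> space trivial_rep" by simp
    have "(\<Sum>b\<in>A. scalar 1) = (scalar (of_nat (card A)) :: ('g \<Rightarrow> complex) tup)" if "finite A" for A :: "'g set"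
      using that by (induction A rule: finite_induct) (simp_all only: sum.empty card.empty of_nat_0
          scalar_0 sum.insert card_insert_disjoint of_nat_Suc scalar_add simp_thms)
    then have "(\<Sum>b\<in>B. scalar 1) = (scalar dimension :: ('g \<Rightarrow> complex) tup)"
      using finite_B card_B by metis
    moreover have "killing b (dual b) = 1" if "b \<in> B" for b
      using dual[OF that that] killing_sym[of b] by simp
    ultimately have "(\<Sum>b\<in>B. scalar (killing b (dual b))) = (scalar dimension :: ('g \<Rightarrow> complex) tup)"
      by (metis (no_types, lifting) sum.cong)
    then show "fn (cmp gmod killing_arrow copairing_arrow) (scalar 1) =
        fn (smul gmod dimension (idm gmod trivial_rep)) (scalar 1)"
      unfolding fn_cmp[OF copairing_arrow_hom 1] fn_copairing_arrow copairing_def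
        sum_adj2[OF killing_arrow_hom] fn_killing_arrow fn_smul[OF id_in_hom[OF is_rep_trivial] 1] fn_id[OF 1]
        scalar_mult[symmetric] by simp
  qed
qed

section \<open>The adjoint functor\<close>

text \<open>
  Prescribing the values of the generators on elementary tensors pins down the generators as arrows, since
  a monoidal functor determines their sources and targets from the image of the generating object.
\<close>

lemma is_adjoint_functor_iff:
  "is_adjoint_functor B dual \<Phi> \<longleftrightarrow> monoidal_functor (T dimension 1) gmod \<Phi> \<and> on_obj \<Phi> 1 = adjoint_rep \<and>
    on_mor \<Phi> (cls dimension 1 M) = bracket_arrow \<and> on_mor \<Phi> (cls dimension 1 S) = swap_arrow \<and>
    on_mor \<Phi> (cls dimension 1 Eta) = copairing_arrow \<and> on_mor \<Phi> (cls dimension 1 Eps) = killing_arrow"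
  (is "_ \<longleftrightarrow> ?functor \<and> ?obj \<and> ?M \<and> ?S \<and> ?Eta \<and> ?Eps")
proof -
  {
    assume func: ?functor and obj: ?obj
    interpret F: monoidal_functor "T dimension 1" gmod \<Phi> by (rule func)
    have obj2: "on_obj \<Phi> 2 = adj2" using F.F_tobj[of 1 1] obj by (simp add: numeral_2_eq_2)
    have obj0: "on_obj \<Phi> 0 = trivial_rep" using F.F_unit by simp
    have hom: "on_mor \<Phi> (cls dimension 1 f) \<in> hom gmod (on_obj \<Phi> (tsrc f)) (on_obj \<Phi> (ttgt f))"
      if "wf_tm f" for f
      using that by (intro F.F_hom cls_in_hom) simp_all
    have "on_mor \<Phi> (cls dimension 1 M) \<in> hom gmod adj2 adjoint_rep"
      using hom[of M] obj obj2 by simp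
    then have "?M \<longleftrightarrow> (\<forall>a b. fn (on_mor \<Phi> (cls dimension 1 M)) (vtensor a b) = vec (bracket a b))"
      using adj2_arrow_eqI[OF _ bracket_arrow_hom] fn_bracket_arrow by metis
    moreover have "on_mor \<Phi> (cls dimension 1 S) \<in> hom gmod adj2 adj2"
      using hom[of S] obj2 by simp
    then have "?S \<longleftrightarrow> (\<forall>a b. fn (on_mor \<Phi> (cls dimension 1 S)) (vtensor a b) = vtensor b a)"
      using adj2_arrow_eqI[OF _ swap_arrow_hom] fn_swap_arrow by metis
    moreover have "on_mor \<Phi> (cls dimension 1 Eta) \<in> hom gmod trivial_rep adj2"
      using hom[of Eta] obj2 obj0 by simp
    then have "?Eta \<longleftrightarrow> fn (on_mor \<Phi> (cls dimension 1 Eta)) (scalar 1) = (\<Sum>b\<in>B. vtensor b (dual b))"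
      using trivial_arrow_eqI[OF _ copairing_arrow_hom] fn_copairing_arrow copairing_def by metis
    moreover have "on_mor \<Phi> (cls dimension 1 Eps) \<in> hom gmod adj2 trivial_rep"
      using hom[of Eps] obj2 obj0 by simp
    then have "?Eps \<longleftrightarrow> (\<forall>a b. fn (on_mor \<Phi> (cls dimension 1 Eps)) (vtensor a b) = scalar (killing a b))"
      using adj2_arrow_eqI[OF _ killing_arrow_hom] fn_killing_arrow by metis
    ultimately have "is_adjoint_functor B dual \<Phi> \<longleftrightarrow> ?M \<and> ?S \<and> ?Eta \<and> ?Eps"
      unfolding is_adjoint_functor_def using func obj by blast
  }
  then show ?thesis unfolding is_adjoint_functor_def by blast
qed

theorem adjoint_functor_unique: "\<exists>!\<Phi>. is_adjoint_functor B dual \<Phi>"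
  unfolding is_adjoint_functor_iff by (rule model.universal_property)

theorem adjoint_functor_sigma:
  assumes "is_adjoint_functor B dual \<Phi>"
  shows "fn (on_mor \<Phi> (cls dimension 1 sigma)) (vec a) = (\<Sum>b\<in>B. vtensor (bracket a b) (dual b))"
proof -
  have \<Phi>: "\<Phi> = model.eval_functor"
    using assms unfolding is_adjoint_functor_iff by (blast intro: model.functor_eq_eval_functor)
  have "wf_tm sigma" by (simp add: sigma_def)
  then show ?thesis unfolding \<Phi> by (simp only: model.on_mor_eval_functor model.eval_sigma fn_sig)
qed

end

theorem proposition2p6:
  fixes scale :: "complex \<Rightarrow> 'g::ab_group_add \<Rightarrow> 'g"
    and bracket :: "'g \<Rightarrow> 'g \<Rightarrow> 'g"
    and B :: "'g set"
    and dual :: "'g \<Rightarrow> 'g"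
  assumes "fd_simple_lie_algebra scale bracket"
    and "lie_algebra.is_basis scale B"
    and "\<forall>a\<in>B. \<forall>b\<in>B. lie_algebra.killing scale bracket (dual a) b = (if a = b then 1 else 0)"
  shows "(\<exists>!\<Phi>. lie_algebra.is_adjoint_functor scale bracket B dual \<Phi>) \<and>
    (\<forall>\<Phi>. lie_algebra.is_adjoint_functor scale bracket B dual \<Phi> \<longrightarrow>
      (\<forall>a. fn (on_mor \<Phi> (cls (lie_algebra.dimension scale) 1 sigma)) (lie_algebra.vec scale a) =
        (\<Sum>b\<in>B. lie_algebra.vtensor scale (bracket a b) (dual b))))"
proof -
  interpret L: fd_simple_lie_algebra scale bracket by (rule assms(1))
  interpret killing_dual_basis scale bracket B dual
    using L.finite_dim assms(2,3) by unfold_locales simp_all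
  show ?thesis using adjoint_functor_unique adjoint_functor_sigma by blast
qed

end
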